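(* In $\mathbf{emTT}^c$, and thus also in $\mathbf{emTT}$, the collections $\mathbb R$ (Dedekind real numbers) and $\mathsf{FunRel}(\mathbb N,\mathbb N)$ (number-theoretic functional relations) are not isomorphic to any set.
   Context: $\mathbf{emTT}^c$ is $\mathbf{emTT}$ extended with the rule $\mathsf{LEM}$: from $\varphi\ prop\ [\Gamma]$ infer $\varphi\vee\neg\varphi$ true $[\Gamma]$ (where "$\varphi$ true $[\Gamma]$" means $\mathsf{true}\in\varphi\ [\Gamma]$). Two collections $A,B$ (here in the empty context) are isomorphic in a theory if there are derivable terms $t(x)\in B\ [x\in A]$ and $t^{-1}(y)\in A\ [y\in B]$ with $(\forall x\in A)\,t^{-1}(t(x))=_A x\wedge(\forall y\in B)\,t(t^{-1}(y))=_B y$ derivably true. "Not isomorphic to any set" means: there is no $A$ with $A\ set\ [\,]$ derivable in the theory and isomorphic in the theory to the given collection. Definitions inside the theory: $\mathsf{Dc}(U):\equiv\mathsf{Eq}(\mathcal P(1),U,[\top])$ for $U\in\mathcal P(1)$; for a set $A$, $\mathcal P(A):\equiv A\to\mathcal P(1)$; for $a\in A$, $V\in\mathcal P(A)$, $a\,\varepsilon\,V$ is the small proposition $\mathsf{Dc}(\mathsf{Ap}(V,a))$; $\mathbb N:\equiv\mathsf{List}(\mathsf N_1)$; $\mathbb Q$ is the usual set of rational numbers constructed from $\mathbb N$, with its usual strict order $<$ (a small proposition); $(\forall q\,\varepsilon\,A)\varphi$ and $(\exists q\,\varepsilon\,A)\varphi$ are $(\forall q\in\mathbb Q)(q\,\varepsilon\,A\Rightarrow\varphi)$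 and $(\exists q\in\mathbb Q)(q\,\varepsilon\,A\wedge\varphi)$; $\exists!$ is unique existence. Then $$\mathbb R:\equiv(\Sigma A\in\mathcal P(\mathbb Q))\big((\exists q\in\mathbb Q)\,q\,\varepsilon\,A\wedge(\exists q\in\mathbb Q)\,\neg\,q\,\varepsilon\,A\wedge(\forall q\,\varepsilon\,A)(\forall r\in\mathbb Q)(r<q\Rightarrow r\,\varepsilon\,A)\wedge(\forall q\,\varepsilon\,A)(\exists r\,\varepsilon\,A)\,q<r\big),$$ $$\mathsf{FunRel}(\mathbb N,\mathbb N):\equiv(\Sigma R\in\mathcal P(\mathbb N\times\mathbb N))(\forall x\in\mathbb N)(\exists!y\in\mathbb N)\,\langle x,y\rangle\,\varepsilon\,R.$$ THE THEORY $\mathbf{emTT}$. Judgements: $\Gamma\ ctx$, $A\ type\ [\Gamma]$, $A=B\ type\ [\Gamma]$, $a\in A\ [\Gamma]$, $a=b\in A\ [\Gamma]$, where $type$ is one of the kinds $prop_s$ (small propositions), $prop$, $set$, $col$ (collections). Contexts are lists $x_1\in A_1,\dots,x_n\in A_n$, each $A_i$ a collection in the preceding context. The common context is left implicit below. Structural rules: variables, weakening, substitution; $=$ is an equivalence relation on types and on terms; conversion; every type and term constructor (including binders) is a congruence for $=$; inclusions $prop_s\subseteq prop$, $prop_s\subseteq set$, $prop\subseteq col$, $set\subseteq col$. Formation. Propositions: $\bot$ is small; $\varphi\wedge\psi,\varphi\vee\psi,\varphi\Rightarrow\psi$ are propositions, small if $\varphi,\psi$ are; $(\exists x\in A)\varphi$,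 $(\forall x\in A)\varphi$ for $A\ col$, $\varphi\ prop\ [x\in A]$, small if $A\ set$ and $\varphi\ prop_s$; $\mathsf{Eq}(A,a,b)$ (written $a=_A b$) for $A\ col$, $a,b\in A$, small if $A\ set$. Sets: $\mathsf N_0$, $\mathsf N_1$; $\mathsf{List}(A)$, $A+B$ for sets $A,B$; $(\Sigma x\in A)B$, $(\Pi x\in A)B$ for $A\ set$, $B\ set\ [x\in A]$; $A/R$ for $A\ set$ and $R(x,y)\ prop_s\ [x,y\in A]$ derivably an equivalence relation. Collections: $\mathcal P(1)$; $A\to\mathcal P(1)$ for $A\ set$; $(\Sigma x\in A)B$ for $A\ col$, $B\ col\ [x\in A]$. Terms. Propositions are proof-irrelevant: if $\varphi\ prop$ and $p\in\varphi$ then $\mathsf{true}\in\varphi$; if $p,q\in\varphi$ then $p=q\in\varphi$. The usual intuitionistic natural deduction rules hold for the connectives and quantifiers, with all proof-terms $\mathsf{true}$ and hypotheses given by context variables; eliminations are only towards propositions (not depending on the eliminated proof). $a\in A$ gives $\mathsf{true}\in\mathsf{Eq}(A,a,a)$; reflection: $\mathsf{true}\in\mathsf{Eq}(A,a,b)$ gives $a=b\in A$. $\mathsf N_0$ (no constructor), $\mathsf N_1$ (constructor $\star$), $\mathsf{List}(A)$ ($\epsilon$, $\mathsf{cons}(l,a)$), $A+B$ ($\mathsf{inl},\mathsf{inr}$), $(\Sigma x\in A)B$ ($\langle a,b\rangle$) have the usual dependent eliminators $\mathsf{El}$ towards arbitrary dependent collections, with $\beta$-equalities. Products $(\Pi x\in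 A)B$ and $A\to\mathcal P(1)$ have $\lambda$, $\mathsf{Ap}$ (also written $f(a)$), $\beta$ and $\eta$. Quotients: $a\in A$ gives $[a]\in A/R$; $R(a,b)$ true gives $[a]=[b]\in A/R$; conversely $[a]=[b]\in A/R$ gives $R(a,b)$ true; eliminator $\mathsf{El_Q}(p,(x).l)\in L(p)$ for $L(z)\ col\ [z\in A/R]$, $p\in A/R$, $l(x)\in L([x])\ [x\in A]$ with $l(x)=l(y)\in L([x])\ [x,y\in A, w\in R(x,y)]$, with $\beta$. $\mathcal P(1)$: $\varphi\ prop_s$ gives $[\varphi]\in\mathcal P(1)$; for small $\varphi,\psi$, $[\varphi]=[\psi]\in\mathcal P(1)$ is derivable from $\varphi\Leftrightarrow\psi$ true, and conversely; for $U\in\mathcal P(1)$, $U=[\mathsf{Eq}(\mathcal P(1),U,[\top])]\in\mathcal P(1)$. Here $\neg\varphi:\equiv\varphi\Rightarrow\bot$, $\top:\equiv\neg\bot$, $\varphi\Leftrightarrow\psi:\equiv(\varphi\Rightarrow\psi)\wedge(\psi\Rightarrow\varphi)$. *)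

theory Defs
  imports Main
begin

section \<open>Pre-types and pre-terms\<close>

text \<open>
  Variables are de Bruijn indices. An argument that binds variables lives in the context extended
  by them, the variable bound last having index 0: in \<open>Quot A R\<close> (the quotient \<open>A/R\<close>)
  the two variables \<open>x, y\<close> of \<open>R(x,y)\<close> are \<open>Var 1\<close> and \<open>Var 0\<close>;
  in \<open>ElList p a c\<close> the step \<open>c(x,y,w)\<close> (tail, head, value at the tail) has
  \<open>x = Var 2\<close>, \<open>y = Var 1\<close>, \<open>w = Var 0\<close>; in \<open>ElSig p m\<close> the branch
  \<open>m(x,y)\<close> has \<open>x = Var 1\<close>, \<open>y = Var 0\<close>.
  \<open>ConsT l a\<close> is \<open>cons(l,a)\<close>, with the tail first. \<open>Powr A\<close> is
  \<open>A \<rightarrow> P(1)\<close>, \<open>Cls a\<close> is \<open>[a] \<in> A/R\<close>, and \<open>Code \<phi>\<close> is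
  \<open>[\<phi>] \<in> P(1)\<close>. \<open>Lam\<close> and \<open>App\<close> serve both \<open>PiS\<close> and
  \<open>Powr\<close>.
\<close>

datatype ty =
    BotP
  | AndP ty ty
  | OrP ty ty
  | ImpP ty ty
  | ExP ty ty
  | AllP ty ty
  | EqP ty tm tm
  | N0
  | N1
  | ListS ty
  | SumS ty ty
  | Sig ty ty
  | PiS ty ty
  | Quot ty ty
  | P1
  | Powr ty
and tm =
    Var nat
  | TrueT
  | El0 tm
  | Star
  | El1 tm tm
  | NilT
  | ConsT tm tm
  | ElList tm tm tm
  | InlT tm
  | InrT tm
  | ElSum tm tm tm
  | PairT tm tm
  | ElSig tm tm
  | Lam tm
  | App tm tm
  | Cls tm
  | ElQ tm tm
  | Code ty

type_synonym ctx = "ty list"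

definition up_rn :: "(nat \<Rightarrow> nat) \<Rightarrow> nat \<Rightarrow> nat" where
  "up_rn r = case_nat 0 (\<lambda>i. Suc (r i))"

primrec rn_ty :: "(nat \<Rightarrow> nat) \<Rightarrow> ty \<Rightarrow> ty"
  and rn_tm :: "(nat \<Rightarrow> nat) \<Rightarrow> tm \<Rightarrow> tm" where
  "rn_ty r BotP = BotP"
| "rn_ty r (AndP A B) = AndP (rn_ty r A) (rn_ty r B)"
| "rn_ty r (OrP A B) = OrP (rn_ty r A) (rn_ty r B)"
| "rn_ty r (ImpP A B) = ImpP (rn_ty r A) (rn_ty r B)"
| "rn_ty r (ExP A B) = ExP (rn_ty r A) (rn_ty (up_rn r) B)"
| "rn_ty r (AllP A B) = AllP (rn_ty r A) (rn_ty (up_rn r) B)"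
| "rn_ty r (EqP A a b) = EqP (rn_ty r A) (rn_tm r a) (rn_tm r b)"
| "rn_ty r N0 = N0"
| "rn_ty r N1 = N1"
| "rn_ty r (ListS A) = ListS (rn_ty r A)"
| "rn_ty r (SumS A B) = SumS (rn_ty r A) (rn_ty r B)"
| "rn_ty r (Sig A B) = Sig (rn_ty r A) (rn_ty (up_rn r) B)"
| "rn_ty r (PiS A B) = PiS (rn_ty r A) (rn_ty (up_rn r) B)"
| "rn_ty r (Quot A R) = Quot (rn_ty r A) (rn_ty (up_rn (up_rn r)) R)"
| "rn_ty r P1 = P1"
| "rn_ty r (Powr A) = Powr (rn_ty r A)"
| "rn_tm r (Var i) = Var (r i)"
| "rn_tm r TrueT = TrueT"
| "rn_tm r (El0 p) = El0 (rn_tm r p)"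
| "rn_tm r Star = Star"
| "rn_tm r (El1 p c) = El1 (rn_tm r p) (rn_tm r c)"
| "rn_tm r NilT = NilT"
| "rn_tm r (ConsT l a) = ConsT (rn_tm r l) (rn_tm r a)"
| "rn_tm r (ElList p a c) =
     ElList (rn_tm r p) (rn_tm r a) (rn_tm (up_rn (up_rn (up_rn r))) c)"
| "rn_tm r (InlT a) = InlT (rn_tm r a)"
| "rn_tm r (InrT a) = InrT (rn_tm r a)"
| "rn_tm r (ElSum p d e) = ElSum (rn_tm r p) (rn_tm (up_rn r) d) (rn_tm (up_rn r) e)"
| "rn_tm r (PairT a b) = PairT (rn_tm r a) (rn_tm r b)"
| "rn_tm r (ElSig p m) = ElSig (rn_tm r p) (rn_tm (up_rn (up_rn r)) m)"
| "rn_tm r (Lam b) = Lam (rn_tm (up_rn r) b)"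
| "rn_tm r (App f a) = App (rn_tm r f) (rn_tm r a)"
| "rn_tm r (Cls a) = Cls (rn_tm r a)"
| "rn_tm r (ElQ p l) = ElQ (rn_tm r p) (rn_tm (up_rn r) l)"
| "rn_tm r (Code A) = Code (rn_ty r A)"

definition up_sb :: "(nat \<Rightarrow> tm) \<Rightarrow> nat \<Rightarrow> tm" where
  "up_sb s = case_nat (Var 0) (\<lambda>i. rn_tm Suc (s i))"

primrec sb_ty :: "(nat \<Rightarrow> tm) \<Rightarrow> ty \<Rightarrow> ty"
  and sb_tm :: "(nat \<Rightarrow> tm) \<Rightarrow> tm \<Rightarrow> tm" where
  "sb_ty s BotP = BotP"
| "sb_ty s (AndP A B) = AndP (sb_ty s A) (sb_ty s B)"
| "sb_ty s (OrP A B) = OrP (sb_ty s A) (sb_ty s B)"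
| "sb_ty s (ImpP A B) = ImpP (sb_ty s A) (sb_ty s B)"
| "sb_ty s (ExP A B) = ExP (sb_ty s A) (sb_ty (up_sb s) B)"
| "sb_ty s (AllP A B) = AllP (sb_ty s A) (sb_ty (up_sb s) B)"
| "sb_ty s (EqP A a b) = EqP (sb_ty s A) (sb_tm s a) (sb_tm s b)"
| "sb_ty s N0 = N0"
| "sb_ty s N1 = N1"
| "sb_ty s (ListS A) = ListS (sb_ty s A)"
| "sb_ty s (SumS A B) = SumS (sb_ty s A) (sb_ty s B)"
| "sb_ty s (Sig A B) = Sig (sb_ty s A) (sb_ty (up_sb s) B)"
| "sb_ty s (PiS A B) = PiS (sb_ty s A) (sb_ty (up_sb s) B)"
| "sb_ty s (Quot A R) = Quot (sb_ty s A) (sb_ty (up_sb (up_sb s)) R)"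
| "sb_ty s P1 = P1"
| "sb_ty s (Powr A) = Powr (sb_ty s A)"
| "sb_tm s (Var i) = s i"
| "sb_tm s TrueT = TrueT"
| "sb_tm s (El0 p) = El0 (sb_tm s p)"
| "sb_tm s Star = Star"
| "sb_tm s (El1 p c) = El1 (sb_tm s p) (sb_tm s c)"
| "sb_tm s NilT = NilT"
| "sb_tm s (ConsT l a) = ConsT (sb_tm s l) (sb_tm s a)"
| "sb_tm s (ElList p a c) =
     ElList (sb_tm s p) (sb_tm s a) (sb_tm (up_sb (up_sb (up_sb s))) c)"
| "sb_tm s (InlT a) = InlT (sb_tm s a)"
| "sb_tm s (InrT a) = InrT (sb_tm s a)"
| "sb_tm s (ElSum p d e) = ElSum (sb_tm s p) (sb_tm (up_sb s) d) (sb_tm (up_sb s) e)"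
| "sb_tm s (PairT a b) = PairT (sb_tm s a) (sb_tm s b)"
| "sb_tm s (ElSig p m) = ElSig (sb_tm s p) (sb_tm (up_sb (up_sb s)) m)"
| "sb_tm s (Lam b) = Lam (sb_tm (up_sb s) b)"
| "sb_tm s (App f a) = App (sb_tm s f) (sb_tm s a)"
| "sb_tm s (Cls a) = Cls (sb_tm s a)"
| "sb_tm s (ElQ p l) = ElQ (sb_tm s p) (sb_tm (up_sb s) l)"
| "sb_tm s (Code A) = Code (sb_ty s A)"

abbreviation lift_ty :: "nat \<Rightarrow> ty \<Rightarrow> ty" where
  "lift_ty k \<equiv> rn_ty (\<lambda>i. i + k)"

abbreviation lift_tm :: "nat \<Rightarrow> tm \<Rightarrow> tm" where
  "lift_tm k \<equiv> rn_tm (\<lambda>i. i + k)"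

text \<open>
  \<open>inst_ty k ts B\<close>: the innermost \<open>length ts\<close> variables of \<open>B\<close> are replaced by
  \<open>ts\<close> (index 0 by the head of \<open>ts\<close>), and the result lives in the remaining context
  extended by \<open>k\<close> new variables, in which \<open>ts\<close> lives as well.
\<close>

definition inst_sb :: "nat \<Rightarrow> tm list \<Rightarrow> nat \<Rightarrow> tm" where
  "inst_sb k ts i = (if i < length ts then ts ! i else Var (i - length ts + k))"

abbreviation inst_ty :: "nat \<Rightarrow> tm list \<Rightarrow> ty \<Rightarrow> ty" where
  "inst_ty k ts \<equiv> sb_ty (inst_sb k ts)"

abbreviation inst_tm :: "nat \<Rightarrow> tm list \<Rightarrow> tm \<Rightarrow> tm" where
  "inst_tm k ts \<equiv> sb_tm (inst_sb k ts)"

definition NegP :: "ty \<Rightarrow> ty" where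
  "NegP \<phi> = ImpP \<phi> BotP"

definition TopP :: ty where
  "TopP = NegP BotP"

definition IffP :: "ty \<Rightarrow> ty \<Rightarrow> ty" where
  "IffP \<phi> \<psi> = AndP (ImpP \<phi> \<psi>) (ImpP \<psi> \<phi>)"

definition Ex1P :: "ty \<Rightarrow> ty \<Rightarrow> ty" where
  "Ex1P A \<phi> = ExP A (AndP \<phi>
     (AllP (lift_ty 1 A) (ImpP (inst_ty 2 [Var 0] \<phi>) (EqP (lift_ty 2 A) (Var 0) (Var 1)))))"

definition EquivP :: "ty \<Rightarrow> ty \<Rightarrow> ty" where
  "EquivP A R =
     AndP (AllP A (inst_ty 1 [Var 0, Var 0] R))
    (AndP (AllP A (AllP (lift_ty 1 A) (ImpP R (inst_ty 2 [Var 1, Var 0] R))))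
          (AllP A (AllP (lift_ty 1 A) (AllP (lift_ty 2 A)
             (ImpP (inst_ty 3 [Var 1, Var 2] R)
             (ImpP (inst_ty 3 [Var 0, Var 1] R)
                   (inst_ty 3 [Var 0, Var 2] R)))))))"


section \<open>The theory emTT and its classical extension\<close>

datatype kind = PropS | Prop | Set | Col

datatype judgement =
    IsCtx ("CTX")
  | IsType ty kind ("(_ IS _)" [56, 56] 55)
  | EqType ty ty kind ("(_ EQ _ IS _)" [56, 56, 56] 55)
  | IsTerm tm ty ("(_ IN _)" [56, 56] 55)
  | EqTerm tm tm ty ("(_ EQ _ IN _)" [56, 56, 56] 55)

abbreviation Holds :: "ty \<Rightarrow> judgement" where
  "Holds \<phi> \<equiv> TrueT IN \<phi>"

datatype system = emTT | emTTc

text \<open>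
  \<open>T \<rhd> \<Gamma> \<turnstile> J\<close>: the judgement \<open>J\<close> is derivable in context \<open>\<Gamma>\<close>
  in the theory \<open>T\<close>. The head of \<open>\<Gamma>\<close> is the type of the most recent variable
  \<open>Var 0\<close>. Weakening and substitution, at any position of the context, are the instances of
  the simultaneous substitution rules \<open>subst\<close>, \<open>subst_eq_type\<close>, \<open>subst_eq_term\<close>
  in which the terms substituted for the other variables are variables.
  Pairs \<open>(k, d)\<close> in side conditions abbreviate the two instances of a rule, one for small
  propositions over sets and one for propositions over collections.
\<close>

fun sb_judgement :: "(nat \<Rightarrow> tm) \<Rightarrow> judgement \<Rightarrow> judgement" where
  "sb_judgement s CTX = CTX"
| "sb_judgement s (A IS k) = (sb_ty s A IS k)"
| "sb_judgement s (A EQ B IS k) = (sb_ty s A EQ sb_ty s B IS k)"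
| "sb_judgement s (a IN A) = (sb_tm s a IN sb_ty s A)"
| "sb_judgement s (a EQ b IN A) = (sb_tm s a EQ sb_tm s b IN sb_ty s A)"

inductive derivable :: "system \<Rightarrow> ctx \<Rightarrow> judgement \<Rightarrow> bool"
    ("(_ \<rhd> _ \<turnstile> _)" [51, 51, 51] 50) for T :: system where

  ctx_empty: "T \<rhd> [] \<turnstile> CTX"
| ctx_extend: "T \<rhd> \<Gamma> \<turnstile> A IS Col \<Longrightarrow> T \<rhd> A # \<Gamma> \<turnstile> CTX"
| var: "\<lbrakk>T \<rhd> \<Gamma> \<turnstile> CTX; i < length \<Gamma>\<rbrakk> \<Longrightarrow> T \<rhd> \<Gamma> \<turnstile> Var i IN lift_ty (Suc i) (\<Gamma> ! i)"
| subst: "\<lbrakk>T \<rhd> \<Gamma> \<turnstile> J; T \<rhd> \<Delta> \<turnstile> CTX;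
     \<And>i. i < length \<Gamma> \<Longrightarrow> T \<rhd> \<Delta> \<turnstile> s i IN sb_ty s (lift_ty (Suc i) (\<Gamma> ! i))\<rbrakk>
    \<Longrightarrow> T \<rhd> \<Delta> \<turnstile> sb_judgement s J"
| subst_eq_type: "\<lbrakk>T \<rhd> \<Gamma> \<turnstile> A IS k; T \<rhd> \<Delta> \<turnstile> CTX;
     \<And>i. i < length \<Gamma> \<Longrightarrow> T \<rhd> \<Delta> \<turnstile> s i EQ s' i IN sb_ty s (lift_ty (Suc i) (\<Gamma> ! i))\<rbrakk>
    \<Longrightarrow> T \<rhd> \<Delta> \<turnstile> sb_ty s A EQ sb_ty s' A IS k"
| subst_eq_term: "\<lbrakk>T \<rhd> \<Gamma> \<turnstile> a IN A; T \<rhd> \<Delta> \<turnstile> CTX;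
     \<And>i. i < length \<Gamma> \<Longrightarrow> T \<rhd> \<Delta> \<turnstile> s i EQ s' i IN sb_ty s (lift_ty (Suc i) (\<Gamma> ! i))\<rbrakk>
    \<Longrightarrow> T \<rhd> \<Delta> \<turnstile> sb_tm s a EQ sb_tm s' a IN sb_ty s A"
| refl_type: "T \<rhd> \<Gamma> \<turnstile> A IS k \<Longrightarrow> T \<rhd> \<Gamma> \<turnstile> A EQ A IS k"
| sym_type: "T \<rhd> \<Gamma> \<turnstile> A EQ B IS k \<Longrightarrow> T \<rhd> \<Gamma> \<turnstile> B EQ A IS k"
| trans_type: "\<lbrakk>T \<rhd> \<Gamma> \<turnstile> A EQ B IS k; T \<rhd> \<Gamma> \<turnstile> B EQ C IS k\<rbrakk> \<Longrightarrow> T \<rhd> \<Gamma> \<turnstile> A EQ C IS k"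
| refl_term: "T \<rhd> \<Gamma> \<turnstile> a IN A \<Longrightarrow> T \<rhd> \<Gamma> \<turnstile> a EQ a IN A"
| sym_term: "T \<rhd> \<Gamma> \<turnstile> a EQ b IN A \<Longrightarrow> T \<rhd> \<Gamma> \<turnstile> b EQ a IN A"
| trans_term: "\<lbrakk>T \<rhd> \<Gamma> \<turnstile> a EQ b IN A; T \<rhd> \<Gamma> \<turnstile> b EQ c IN A\<rbrakk> \<Longrightarrow> T \<rhd> \<Gamma> \<turnstile> a EQ c IN A"
| conv: "\<lbrakk>T \<rhd> \<Gamma> \<turnstile> a IN A; T \<rhd> \<Gamma> \<turnstile> A EQ B IS Col\<rbrakk> \<Longrightarrow> T \<rhd> \<Gamma> \<turnstile> a IN B"
| conv_eq: "\<lbrakk>T \<rhd> \<Gamma> \<turnstile> a EQ b IN A; T \<rhd> \<Gamma> \<turnstile> A EQ B IS Col\<rbrakk> \<Longrightarrow> T \<rhd> \<Gamma> \<turnstile> a EQ b IN B"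
| incl: "\<lbrakk>T \<rhd> \<Gamma> \<turnstile> A IS k; (k, k') \<in> {(PropS, Prop), (PropS, Set), (Prop, Col), (Set, Col)}\<rbrakk>
    \<Longrightarrow> T \<rhd> \<Gamma> \<turnstile> A IS k'"
| incl_eq: "\<lbrakk>T \<rhd> \<Gamma> \<turnstile> A EQ B IS k; (k, k') \<in> {(PropS, Prop), (PropS, Set), (Prop, Col), (Set, Col)}\<rbrakk>
    \<Longrightarrow> T \<rhd> \<Gamma> \<turnstile> A EQ B IS k'"

\<comment> \<open>Formation and congruence of propositions\<close>
| bot_form: "T \<rhd> \<Gamma> \<turnstile> CTX \<Longrightarrow> T \<rhd> \<Gamma> \<turnstile> BotP IS PropS"
| and_form: "\<lbrakk>T \<rhd> \<Gamma> \<turnstile> \<phi> IS k; T \<rhd> \<Gamma> \<turnstile> \<psi> IS k; k \<in> {PropS, Prop}\<rbrakk>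
    \<Longrightarrow> T \<rhd> \<Gamma> \<turnstile> AndP \<phi> \<psi> IS k"
| and_cong: "\<lbrakk>T \<rhd> \<Gamma> \<turnstile> \<phi> EQ \<phi>' IS k; T \<rhd> \<Gamma> \<turnstile> \<psi> EQ \<psi>' IS k; k \<in> {PropS, Prop}\<rbrakk>
    \<Longrightarrow> T \<rhd> \<Gamma> \<turnstile> AndP \<phi> \<psi> EQ AndP \<phi>' \<psi>' IS k"
| or_form: "\<lbrakk>T \<rhd> \<Gamma> \<turnstile> \<phi> IS k; T \<rhd> \<Gamma> \<turnstile> \<psi> IS k; k \<in> {PropS, Prop}\<rbrakk>
    \<Longrightarrow> T \<rhd> \<Gamma> \<turnstile> OrP \<phi> \<psi> IS k"
| or_cong: "\<lbrakk>T \<rhd> \<Gamma> \<turnstile> \<phi> EQ \<phi>' IS k; T \<rhd> \<Gamma> \<turnstile> \<psi> EQ \<psi>' IS k; k \<in> {PropS, Prop}\<rbrakk>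
    \<Longrightarrow> T \<rhd> \<Gamma> \<turnstile> OrP \<phi> \<psi> EQ OrP \<phi>' \<psi>' IS k"
| imp_form: "\<lbrakk>T \<rhd> \<Gamma> \<turnstile> \<phi> IS k; T \<rhd> \<Gamma> \<turnstile> \<psi> IS k; k \<in> {PropS, Prop}\<rbrakk>
    \<Longrightarrow> T \<rhd> \<Gamma> \<turnstile> ImpP \<phi> \<psi> IS k"
| imp_cong: "\<lbrakk>T \<rhd> \<Gamma> \<turnstile> \<phi> EQ \<phi>' IS k; T \<rhd> \<Gamma> \<turnstile> \<psi> EQ \<psi>' IS k; k \<in> {PropS, Prop}\<rbrakk>
    \<Longrightarrow> T \<rhd> \<Gamma> \<turnstile> ImpP \<phi> \<psi> EQ ImpP \<phi>' \<psi>' IS k"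
| ex_form: "\<lbrakk>T \<rhd> \<Gamma> \<turnstile> A IS d; T \<rhd> A # \<Gamma> \<turnstile> \<phi> IS k; (k, d) \<in> {(PropS, Set), (Prop, Col)}\<rbrakk>
    \<Longrightarrow> T \<rhd> \<Gamma> \<turnstile> ExP A \<phi> IS k"
| ex_cong: "\<lbrakk>T \<rhd> \<Gamma> \<turnstile> A EQ A' IS d; T \<rhd> A # \<Gamma> \<turnstile> \<phi> EQ \<phi>' IS k;
     (k, d) \<in> {(PropS, Set), (Prop, Col)}\<rbrakk>
    \<Longrightarrow> T \<rhd> \<Gamma> \<turnstile> ExP A \<phi> EQ ExP A' \<phi>' IS k"
| all_form: "\<lbrakk>T \<rhd> \<Gamma> \<turnstile> A IS d; T \<rhd> A # \<Gamma> \<turnstile> \<phi> IS k; (k, d) \<in> {(PropS, Set), (Prop, Col)}\<rbrakk>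
    \<Longrightarrow> T \<rhd> \<Gamma> \<turnstile> AllP A \<phi> IS k"
| all_cong: "\<lbrakk>T \<rhd> \<Gamma> \<turnstile> A EQ A' IS d; T \<rhd> A # \<Gamma> \<turnstile> \<phi> EQ \<phi>' IS k;
     (k, d) \<in> {(PropS, Set), (Prop, Col)}\<rbrakk>
    \<Longrightarrow> T \<rhd> \<Gamma> \<turnstile> AllP A \<phi> EQ AllP A' \<phi>' IS k"
| eq_form: "\<lbrakk>T \<rhd> \<Gamma> \<turnstile> A IS d; T \<rhd> \<Gamma> \<turnstile> a IN A; T \<rhd> \<Gamma> \<turnstile> b IN A;
     (k, d) \<in> {(PropS, Set), (Prop, Col)}\<rbrakk>
    \<Longrightarrow> T \<rhd> \<Gamma> \<turnstile> EqP A a b IS k"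
| eq_cong: "\<lbrakk>T \<rhd> \<Gamma> \<turnstile> A EQ A' IS d; T \<rhd> \<Gamma> \<turnstile> a EQ a' IN A; T \<rhd> \<Gamma> \<turnstile> b EQ b' IN A;
     (k, d) \<in> {(PropS, Set), (Prop, Col)}\<rbrakk>
    \<Longrightarrow> T \<rhd> \<Gamma> \<turnstile> EqP A a b EQ EqP A' a' b' IS k"

\<comment> \<open>The propositions \<open>Dc(U)\<close> are small although \<open>P(1)\<close> is not a set; the rule
  \<open>power_eta\<close> presupposes this.\<close>
| dc_form: "T \<rhd> \<Gamma> \<turnstile> U IN P1 \<Longrightarrow> T \<rhd> \<Gamma> \<turnstile> EqP P1 U (Code TopP) IS PropS"
| dc_cong: "T \<rhd> \<Gamma> \<turnstile> U EQ U' IN P1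
    \<Longrightarrow> T \<rhd> \<Gamma> \<turnstile> EqP P1 U (Code TopP) EQ EqP P1 U' (Code TopP) IS PropS"

\<comment> \<open>Formation and congruence of sets and collections\<close>
| N0_form: "T \<rhd> \<Gamma> \<turnstile> CTX \<Longrightarrow> T \<rhd> \<Gamma> \<turnstile> N0 IS Set"
| N1_form: "T \<rhd> \<Gamma> \<turnstile> CTX \<Longrightarrow> T \<rhd> \<Gamma> \<turnstile> N1 IS Set"
| list_form: "T \<rhd> \<Gamma> \<turnstile> A IS Set \<Longrightarrow> T \<rhd> \<Gamma> \<turnstile> ListS A IS Set"
| list_cong: "T \<rhd> \<Gamma> \<turnstile> A EQ A' IS Set \<Longrightarrow> T \<rhd> \<Gamma> \<turnstile> ListS A EQ ListS A' IS Set"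
| sum_form: "\<lbrakk>T \<rhd> \<Gamma> \<turnstile> A IS Set; T \<rhd> \<Gamma> \<turnstile> B IS Set\<rbrakk> \<Longrightarrow> T \<rhd> \<Gamma> \<turnstile> SumS A B IS Set"
| sum_cong: "\<lbrakk>T \<rhd> \<Gamma> \<turnstile> A EQ A' IS Set; T \<rhd> \<Gamma> \<turnstile> B EQ B' IS Set\<rbrakk>
    \<Longrightarrow> T \<rhd> \<Gamma> \<turnstile> SumS A B EQ SumS A' B' IS Set"
| sig_form: "\<lbrakk>T \<rhd> \<Gamma> \<turnstile> A IS k; T \<rhd> A # \<Gamma> \<turnstile> B IS k; k \<in> {Set, Col}\<rbrakk>
    \<Longrightarrow> T \<rhd> \<Gamma> \<turnstile> Sig A B IS k"
| sig_cong: "\<lbrakk>T \<rhd> \<Gamma> \<turnstile> A EQ A' IS k; T \<rhd> A # \<Gamma> \<turnstile> B EQ B' IS k; k \<in> {Set, Col}\<rbrakk>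
    \<Longrightarrow> T \<rhd> \<Gamma> \<turnstile> Sig A B EQ Sig A' B' IS k"
| pi_form: "\<lbrakk>T \<rhd> \<Gamma> \<turnstile> A IS Set; T \<rhd> A # \<Gamma> \<turnstile> B IS Set\<rbrakk> \<Longrightarrow> T \<rhd> \<Gamma> \<turnstile> PiS A B IS Set"
| pi_cong: "\<lbrakk>T \<rhd> \<Gamma> \<turnstile> A EQ A' IS Set; T \<rhd> A # \<Gamma> \<turnstile> B EQ B' IS Set\<rbrakk>
    \<Longrightarrow> T \<rhd> \<Gamma> \<turnstile> PiS A B EQ PiS A' B' IS Set"
| quot_form: "\<lbrakk>T \<rhd> \<Gamma> \<turnstile> A IS Set; T \<rhd> lift_ty 1 A # A # \<Gamma> \<turnstile> R IS PropS;
     T \<rhd> \<Gamma> \<turnstile> Holds (EquivP A R)\<rbrakk>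
    \<Longrightarrow> T \<rhd> \<Gamma> \<turnstile> Quot A R IS Set"
| quot_cong: "\<lbrakk>T \<rhd> \<Gamma> \<turnstile> A EQ A' IS Set; T \<rhd> lift_ty 1 A # A # \<Gamma> \<turnstile> R EQ R' IS PropS;
     T \<rhd> \<Gamma> \<turnstile> Holds (EquivP A R); T \<rhd> \<Gamma> \<turnstile> Holds (EquivP A' R')\<rbrakk>
    \<Longrightarrow> T \<rhd> \<Gamma> \<turnstile> Quot A R EQ Quot A' R' IS Set"
| P1_form: "T \<rhd> \<Gamma> \<turnstile> CTX \<Longrightarrow> T \<rhd> \<Gamma> \<turnstile> P1 IS Col"
| powr_form: "T \<rhd> \<Gamma> \<turnstile> A IS Set \<Longrightarrow> T \<rhd> \<Gamma> \<turnstile> Powr A IS Col"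
| powr_cong: "T \<rhd> \<Gamma> \<turnstile> A EQ A' IS Set \<Longrightarrow> T \<rhd> \<Gamma> \<turnstile> Powr A EQ Powr A' IS Col"

\<comment> \<open>Propositions: proof irrelevance and intuitionistic natural deduction\<close>
| prop_true: "\<lbrakk>T \<rhd> \<Gamma> \<turnstile> \<phi> IS Prop; T \<rhd> \<Gamma> \<turnstile> p IN \<phi>\<rbrakk> \<Longrightarrow> T \<rhd> \<Gamma> \<turnstile> Holds \<phi>"
| prop_irrel: "\<lbrakk>T \<rhd> \<Gamma> \<turnstile> \<phi> IS Prop; T \<rhd> \<Gamma> \<turnstile> p IN \<phi>; T \<rhd> \<Gamma> \<turnstile> q IN \<phi>\<rbrakk>
    \<Longrightarrow> T \<rhd> \<Gamma> \<turnstile> p EQ q IN \<phi>"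
| bot_elim: "\<lbrakk>T \<rhd> \<Gamma> \<turnstile> \<phi> IS Prop; T \<rhd> \<Gamma> \<turnstile> Holds BotP\<rbrakk> \<Longrightarrow> T \<rhd> \<Gamma> \<turnstile> Holds \<phi>"
| and_intro: "\<lbrakk>T \<rhd> \<Gamma> \<turnstile> \<phi> IS Prop; T \<rhd> \<Gamma> \<turnstile> \<psi> IS Prop;
     T \<rhd> \<Gamma> \<turnstile> Holds \<phi>; T \<rhd> \<Gamma> \<turnstile> Holds \<psi>\<rbrakk> \<Longrightarrow> T \<rhd> \<Gamma> \<turnstile> Holds (AndP \<phi> \<psi>)"
| and_elim1: "\<lbrakk>T \<rhd> \<Gamma> \<turnstile> \<phi> IS Prop; T \<rhd> \<Gamma> \<turnstile> \<psi> IS Prop; T \<rhd> \<Gamma> \<turnstile> Holds (AndP \<phi> \<psi>)\<rbrakk>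
    \<Longrightarrow> T \<rhd> \<Gamma> \<turnstile> Holds \<phi>"
| and_elim2: "\<lbrakk>T \<rhd> \<Gamma> \<turnstile> \<phi> IS Prop; T \<rhd> \<Gamma> \<turnstile> \<psi> IS Prop; T \<rhd> \<Gamma> \<turnstile> Holds (AndP \<phi> \<psi>)\<rbrakk>
    \<Longrightarrow> T \<rhd> \<Gamma> \<turnstile> Holds \<psi>"
| or_intro1: "\<lbrakk>T \<rhd> \<Gamma> \<turnstile> \<phi> IS Prop; T \<rhd> \<Gamma> \<turnstile> \<psi> IS Prop; T \<rhd> \<Gamma> \<turnstile> Holds \<phi>\<rbrakk>
    \<Longrightarrow> T \<rhd> \<Gamma> \<turnstile> Holds (OrP \<phi> \<psi>)"
| or_intro2: "\<lbrakk>T \<rhd> \<Gamma> \<turnstile> \<phi> IS Prop; T \<rhd> \<Gamma> \<turnstile> \<psi> IS Prop; T \<rhd> \<Gamma> \<turnstile> Holds \<psi>\<rbrakk>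
    \<Longrightarrow> T \<rhd> \<Gamma> \<turnstile> Holds (OrP \<phi> \<psi>)"
| or_elim: "\<lbrakk>T \<rhd> \<Gamma> \<turnstile> \<phi> IS Prop; T \<rhd> \<Gamma> \<turnstile> \<psi> IS Prop; T \<rhd> \<Gamma> \<turnstile> \<chi> IS Prop;
     T \<rhd> \<Gamma> \<turnstile> Holds (OrP \<phi> \<psi>);
     T \<rhd> \<phi> # \<Gamma> \<turnstile> Holds (lift_ty 1 \<chi>); T \<rhd> \<psi> # \<Gamma> \<turnstile> Holds (lift_ty 1 \<chi>)\<rbrakk>
    \<Longrightarrow> T \<rhd> \<Gamma> \<turnstile> Holds \<chi>"
| imp_intro: "\<lbrakk>T \<rhd> \<Gamma> \<turnstile> \<phi> IS Prop; T \<rhd> \<Gamma> \<turnstile> \<psi> IS Prop; T \<rhd> \<phi> # \<Gamma> \<turnstile> Holds (lift_ty 1 \<psi>)\<rbrakk>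
    \<Longrightarrow> T \<rhd> \<Gamma> \<turnstile> Holds (ImpP \<phi> \<psi>)"
| imp_elim: "\<lbrakk>T \<rhd> \<Gamma> \<turnstile> \<phi> IS Prop; T \<rhd> \<Gamma> \<turnstile> \<psi> IS Prop;
     T \<rhd> \<Gamma> \<turnstile> Holds (ImpP \<phi> \<psi>); T \<rhd> \<Gamma> \<turnstile> Holds \<phi>\<rbrakk> \<Longrightarrow> T \<rhd> \<Gamma> \<turnstile> Holds \<psi>"
| ex_intro: "\<lbrakk>T \<rhd> \<Gamma> \<turnstile> A IS Col; T \<rhd> A # \<Gamma> \<turnstile> \<phi> IS Prop;
     T \<rhd> \<Gamma> \<turnstile> a IN A; T \<rhd> \<Gamma> \<turnstile> Holds (inst_ty 0 [a] \<phi>)\<rbrakk> \<Longrightarrow> T \<rhd> \<Gamma> \<turnstile> Holds (ExP A \<phi>)"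
| ex_elim: "\<lbrakk>T \<rhd> \<Gamma> \<turnstile> A IS Col; T \<rhd> A # \<Gamma> \<turnstile> \<phi> IS Prop; T \<rhd> \<Gamma> \<turnstile> \<chi> IS Prop;
     T \<rhd> \<Gamma> \<turnstile> Holds (ExP A \<phi>); T \<rhd> \<phi> # A # \<Gamma> \<turnstile> Holds (lift_ty 2 \<chi>)\<rbrakk>
    \<Longrightarrow> T \<rhd> \<Gamma> \<turnstile> Holds \<chi>"
| all_intro: "\<lbrakk>T \<rhd> \<Gamma> \<turnstile> A IS Col; T \<rhd> A # \<Gamma> \<turnstile> \<phi> IS Prop; T \<rhd> A # \<Gamma> \<turnstile> Holds \<phi>\<rbrakk>
    \<Longrightarrow> T \<rhd> \<Gamma> \<turnstile> Holds (AllP A \<phi>)"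
| all_elim: "\<lbrakk>T \<rhd> \<Gamma> \<turnstile> A IS Col; T \<rhd> A # \<Gamma> \<turnstile> \<phi> IS Prop;
     T \<rhd> \<Gamma> \<turnstile> Holds (AllP A \<phi>); T \<rhd> \<Gamma> \<turnstile> a IN A\<rbrakk> \<Longrightarrow> T \<rhd> \<Gamma> \<turnstile> Holds (inst_ty 0 [a] \<phi>)"
| eq_intro: "\<lbrakk>T \<rhd> \<Gamma> \<turnstile> A IS Col; T \<rhd> \<Gamma> \<turnstile> a IN A\<rbrakk> \<Longrightarrow> T \<rhd> \<Gamma> \<turnstile> Holds (EqP A a a)"
| eq_reflection: "\<lbrakk>T \<rhd> \<Gamma> \<turnstile> A IS Col; T \<rhd> \<Gamma> \<turnstile> a IN A; T \<rhd> \<Gamma> \<turnstile> b IN A;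
     T \<rhd> \<Gamma> \<turnstile> Holds (EqP A a b)\<rbrakk> \<Longrightarrow> T \<rhd> \<Gamma> \<turnstile> a EQ b IN A"
| LEM: "\<lbrakk>T = emTTc; T \<rhd> \<Gamma> \<turnstile> \<phi> IS Prop\<rbrakk> \<Longrightarrow> T \<rhd> \<Gamma> \<turnstile> Holds (OrP \<phi> (NegP \<phi>))"

\<comment> \<open>The empty set and the singleton\<close>
| N0_elim: "\<lbrakk>T \<rhd> N0 # \<Gamma> \<turnstile> L IS Col; T \<rhd> \<Gamma> \<turnstile> p IN N0\<rbrakk> \<Longrightarrow> T \<rhd> \<Gamma> \<turnstile> El0 p IN inst_ty 0 [p] L"
| N0_elim_cong: "\<lbrakk>T \<rhd> N0 # \<Gamma> \<turnstile> L IS Col; T \<rhd> \<Gamma> \<turnstile> p EQ p' IN N0\<rbrakk>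
    \<Longrightarrow> T \<rhd> \<Gamma> \<turnstile> El0 p EQ El0 p' IN inst_ty 0 [p] L"
| N1_intro: "T \<rhd> \<Gamma> \<turnstile> CTX \<Longrightarrow> T \<rhd> \<Gamma> \<turnstile> Star IN N1"
| N1_elim: "\<lbrakk>T \<rhd> N1 # \<Gamma> \<turnstile> L IS Col; T \<rhd> \<Gamma> \<turnstile> p IN N1; T \<rhd> \<Gamma> \<turnstile> c IN inst_ty 0 [Star] L\<rbrakk>
    \<Longrightarrow> T \<rhd> \<Gamma> \<turnstile> El1 p c IN inst_ty 0 [p] L"
| N1_elim_cong: "\<lbrakk>T \<rhd> N1 # \<Gamma> \<turnstile> L IS Col; T \<rhd> \<Gamma> \<turnstile> p EQ p' IN N1;
     T \<rhd> \<Gamma> \<turnstile> c EQ c' IN inst_ty 0 [Star] L\<rbrakk>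
    \<Longrightarrow> T \<rhd> \<Gamma> \<turnstile> El1 p c EQ El1 p' c' IN inst_ty 0 [p] L"
| N1_beta: "\<lbrakk>T \<rhd> N1 # \<Gamma> \<turnstile> L IS Col; T \<rhd> \<Gamma> \<turnstile> c IN inst_ty 0 [Star] L\<rbrakk>
    \<Longrightarrow> T \<rhd> \<Gamma> \<turnstile> El1 Star c EQ c IN inst_ty 0 [Star] L"

\<comment> \<open>Lists\<close>
| nil_intro: "T \<rhd> \<Gamma> \<turnstile> A IS Set \<Longrightarrow> T \<rhd> \<Gamma> \<turnstile> NilT IN ListS A"
| cons_intro: "\<lbrakk>T \<rhd> \<Gamma> \<turnstile> A IS Set; T \<rhd> \<Gamma> \<turnstile> l IN ListS A; T \<rhd> \<Gamma> \<turnstile> a IN A\<rbrakk>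
    \<Longrightarrow> T \<rhd> \<Gamma> \<turnstile> ConsT l a IN ListS A"
| cons_cong: "\<lbrakk>T \<rhd> \<Gamma> \<turnstile> A IS Set; T \<rhd> \<Gamma> \<turnstile> l EQ l' IN ListS A; T \<rhd> \<Gamma> \<turnstile> a EQ a' IN A\<rbrakk>
    \<Longrightarrow> T \<rhd> \<Gamma> \<turnstile> ConsT l a EQ ConsT l' a' IN ListS A"
| list_elim: "\<lbrakk>T \<rhd> \<Gamma> \<turnstile> A IS Set; T \<rhd> ListS A # \<Gamma> \<turnstile> L IS Col;
     T \<rhd> \<Gamma> \<turnstile> p IN ListS A; T \<rhd> \<Gamma> \<turnstile> a IN inst_ty 0 [NilT] L;
     T \<rhd> inst_ty 2 [Var 1] L # lift_ty 1 A # ListS A # \<Gamma> \<turnstile> c IN inst_ty 3 [ConsT (Var 2) (Var 1)] L\<rbrakk>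
    \<Longrightarrow> T \<rhd> \<Gamma> \<turnstile> ElList p a c IN inst_ty 0 [p] L"
| list_elim_cong: "\<lbrakk>T \<rhd> \<Gamma> \<turnstile> A IS Set; T \<rhd> ListS A # \<Gamma> \<turnstile> L IS Col;
     T \<rhd> \<Gamma> \<turnstile> p EQ p' IN ListS A; T \<rhd> \<Gamma> \<turnstile> a EQ a' IN inst_ty 0 [NilT] L;
     T \<rhd> inst_ty 2 [Var 1] L # lift_ty 1 A # ListS A # \<Gamma>
       \<turnstile> c EQ c' IN inst_ty 3 [ConsT (Var 2) (Var 1)] L\<rbrakk>
    \<Longrightarrow> T \<rhd> \<Gamma> \<turnstile> ElList p a c EQ ElList p' a' c' IN inst_ty 0 [p] L"
| list_beta_nil: "\<lbrakk>T \<rhd> \<Gamma> \<turnstile> A IS Set; T \<rhd> ListS A # \<Gamma> \<turnstile> L IS Col;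
     T \<rhd> \<Gamma> \<turnstile> a IN inst_ty 0 [NilT] L;
     T \<rhd> inst_ty 2 [Var 1] L # lift_ty 1 A # ListS A # \<Gamma> \<turnstile> c IN inst_ty 3 [ConsT (Var 2) (Var 1)] L\<rbrakk>
    \<Longrightarrow> T \<rhd> \<Gamma> \<turnstile> ElList NilT a c EQ a IN inst_ty 0 [NilT] L"
| list_beta_cons: "\<lbrakk>T \<rhd> \<Gamma> \<turnstile> A IS Set; T \<rhd> ListS A # \<Gamma> \<turnstile> L IS Col;
     T \<rhd> \<Gamma> \<turnstile> l IN ListS A; T \<rhd> \<Gamma> \<turnstile> b IN A; T \<rhd> \<Gamma> \<turnstile> a IN inst_ty 0 [NilT] L;
     T \<rhd> inst_ty 2 [Var 1] L # lift_ty 1 A # ListS A # \<Gamma> \<turnstile> c IN inst_ty 3 [ConsT (Var 2) (Var 1)] L\<rbrakk>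
    \<Longrightarrow> T \<rhd> \<Gamma> \<turnstile> ElList (ConsT l b) a c EQ inst_tm 0 [ElList l a c, b, l] c
          IN inst_ty 0 [ConsT l b] L"

\<comment> \<open>Disjoint sums\<close>
| inl_intro: "\<lbrakk>T \<rhd> \<Gamma> \<turnstile> A IS Set; T \<rhd> \<Gamma> \<turnstile> B IS Set; T \<rhd> \<Gamma> \<turnstile> a IN A\<rbrakk>
    \<Longrightarrow> T \<rhd> \<Gamma> \<turnstile> InlT a IN SumS A B"
| inl_cong: "\<lbrakk>T \<rhd> \<Gamma> \<turnstile> A IS Set; T \<rhd> \<Gamma> \<turnstile> B IS Set; T \<rhd> \<Gamma> \<turnstile> a EQ a' IN A\<rbrakk>
    \<Longrightarrow> T \<rhd> \<Gamma> \<turnstile> InlT a EQ InlT a' IN SumS A B"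
| inr_intro: "\<lbrakk>T \<rhd> \<Gamma> \<turnstile> A IS Set; T \<rhd> \<Gamma> \<turnstile> B IS Set; T \<rhd> \<Gamma> \<turnstile> b IN B\<rbrakk>
    \<Longrightarrow> T \<rhd> \<Gamma> \<turnstile> InrT b IN SumS A B"
| inr_cong: "\<lbrakk>T \<rhd> \<Gamma> \<turnstile> A IS Set; T \<rhd> \<Gamma> \<turnstile> B IS Set; T \<rhd> \<Gamma> \<turnstile> b EQ b' IN B\<rbrakk>
    \<Longrightarrow> T \<rhd> \<Gamma> \<turnstile> InrT b EQ InrT b' IN SumS A B"
| sum_elim: "\<lbrakk>T \<rhd> \<Gamma> \<turnstile> A IS Set; T \<rhd> \<Gamma> \<turnstile> B IS Set; T \<rhd> SumS A B # \<Gamma> \<turnstile> L IS Col;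
     T \<rhd> \<Gamma> \<turnstile> p IN SumS A B;
     T \<rhd> A # \<Gamma> \<turnstile> d IN inst_ty 1 [InlT (Var 0)] L; T \<rhd> B # \<Gamma> \<turnstile> e IN inst_ty 1 [InrT (Var 0)] L\<rbrakk>
    \<Longrightarrow> T \<rhd> \<Gamma> \<turnstile> ElSum p d e IN inst_ty 0 [p] L"
| sum_elim_cong: "\<lbrakk>T \<rhd> \<Gamma> \<turnstile> A IS Set; T \<rhd> \<Gamma> \<turnstile> B IS Set; T \<rhd> SumS A B # \<Gamma> \<turnstile> L IS Col;
     T \<rhd> \<Gamma> \<turnstile> p EQ p' IN SumS A B;
     T \<rhd> A # \<Gamma> \<turnstile> d EQ d' IN inst_ty 1 [InlT (Var 0)] L;
     T \<rhd> B # \<Gamma> \<turnstile> e EQ e' IN inst_ty 1 [InrT (Var 0)] L\<rbrakk>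
    \<Longrightarrow> T \<rhd> \<Gamma> \<turnstile> ElSum p d e EQ ElSum p' d' e' IN inst_ty 0 [p] L"
| sum_beta_inl: "\<lbrakk>T \<rhd> \<Gamma> \<turnstile> A IS Set; T \<rhd> \<Gamma> \<turnstile> B IS Set; T \<rhd> SumS A B # \<Gamma> \<turnstile> L IS Col;
     T \<rhd> \<Gamma> \<turnstile> a IN A;
     T \<rhd> A # \<Gamma> \<turnstile> d IN inst_ty 1 [InlT (Var 0)] L; T \<rhd> B # \<Gamma> \<turnstile> e IN inst_ty 1 [InrT (Var 0)] L\<rbrakk>
    \<Longrightarrow> T \<rhd> \<Gamma> \<turnstile> ElSum (InlT a) d e EQ inst_tm 0 [a] d IN inst_ty 0 [InlT a] L"
| sum_beta_inr: "\<lbrakk>T \<rhd> \<Gamma> \<turnstile> A IS Set; T \<rhd> \<Gamma> \<turnstile> B IS Set; T \<rhd> SumS A B # \<Gamma> \<turnstile> L IS Col;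
     T \<rhd> \<Gamma> \<turnstile> b IN B;
     T \<rhd> A # \<Gamma> \<turnstile> d IN inst_ty 1 [InlT (Var 0)] L; T \<rhd> B # \<Gamma> \<turnstile> e IN inst_ty 1 [InrT (Var 0)] L\<rbrakk>
    \<Longrightarrow> T \<rhd> \<Gamma> \<turnstile> ElSum (InrT b) d e EQ inst_tm 0 [b] e IN inst_ty 0 [InrT b] L"

\<comment> \<open>Indexed sums\<close>
| pair_intro: "\<lbrakk>T \<rhd> \<Gamma> \<turnstile> A IS Col; T \<rhd> A # \<Gamma> \<turnstile> B IS Col;
     T \<rhd> \<Gamma> \<turnstile> a IN A; T \<rhd> \<Gamma> \<turnstile> b IN inst_ty 0 [a] B\<rbrakk>
    \<Longrightarrow> T \<rhd> \<Gamma> \<turnstile> PairT a b IN Sig A B"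
| pair_cong: "\<lbrakk>T \<rhd> \<Gamma> \<turnstile> A IS Col; T \<rhd> A # \<Gamma> \<turnstile> B IS Col;
     T \<rhd> \<Gamma> \<turnstile> a EQ a' IN A; T \<rhd> \<Gamma> \<turnstile> b EQ b' IN inst_ty 0 [a] B\<rbrakk>
    \<Longrightarrow> T \<rhd> \<Gamma> \<turnstile> PairT a b EQ PairT a' b' IN Sig A B"
| sig_elim: "\<lbrakk>T \<rhd> \<Gamma> \<turnstile> A IS Col; T \<rhd> A # \<Gamma> \<turnstile> B IS Col; T \<rhd> Sig A B # \<Gamma> \<turnstile> L IS Col;
     T \<rhd> \<Gamma> \<turnstile> p IN Sig A B; T \<rhd> B # A # \<Gamma> \<turnstile> m IN inst_ty 2 [PairT (Var 1) (Var 0)] L\<rbrakk>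
    \<Longrightarrow> T \<rhd> \<Gamma> \<turnstile> ElSig p m IN inst_ty 0 [p] L"
| sig_elim_cong: "\<lbrakk>T \<rhd> \<Gamma> \<turnstile> A IS Col; T \<rhd> A # \<Gamma> \<turnstile> B IS Col; T \<rhd> Sig A B # \<Gamma> \<turnstile> L IS Col;
     T \<rhd> \<Gamma> \<turnstile> p EQ p' IN Sig A B;
     T \<rhd> B # A # \<Gamma> \<turnstile> m EQ m' IN inst_ty 2 [PairT (Var 1) (Var 0)] L\<rbrakk>
    \<Longrightarrow> T \<rhd> \<Gamma> \<turnstile> ElSig p m EQ ElSig p' m' IN inst_ty 0 [p] L"
| sig_beta: "\<lbrakk>T \<rhd> \<Gamma> \<turnstile> A IS Col; T \<rhd> A # \<Gamma> \<turnstile> B IS Col; T \<rhd> Sig A B # \<Gamma> \<turnstile> L IS Col;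
     T \<rhd> \<Gamma> \<turnstile> a IN A; T \<rhd> \<Gamma> \<turnstile> b IN inst_ty 0 [a] B;
     T \<rhd> B # A # \<Gamma> \<turnstile> m IN inst_ty 2 [PairT (Var 1) (Var 0)] L\<rbrakk>
    \<Longrightarrow> T \<rhd> \<Gamma> \<turnstile> ElSig (PairT a b) m EQ inst_tm 0 [b, a] m IN inst_ty 0 [PairT a b] L"

\<comment> \<open>Dependent products of sets\<close>
| pi_intro: "\<lbrakk>T \<rhd> \<Gamma> \<turnstile> A IS Set; T \<rhd> A # \<Gamma> \<turnstile> B IS Set; T \<rhd> A # \<Gamma> \<turnstile> b IN B\<rbrakk>
    \<Longrightarrow> T \<rhd> \<Gamma> \<turnstile> Lam b IN PiS A B"
| pi_lam_cong: "\<lbrakk>T \<rhd> \<Gamma> \<turnstile> A IS Set; T \<rhd> A # \<Gamma> \<turnstile> B IS Set; T \<rhd> A # \<Gamma> \<turnstile> b EQ b' IN B\<rbrakk>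
    \<Longrightarrow> T \<rhd> \<Gamma> \<turnstile> Lam b EQ Lam b' IN PiS A B"
| pi_elim: "\<lbrakk>T \<rhd> \<Gamma> \<turnstile> A IS Set; T \<rhd> A # \<Gamma> \<turnstile> B IS Set; T \<rhd> \<Gamma> \<turnstile> f IN PiS A B; T \<rhd> \<Gamma> \<turnstile> a IN A\<rbrakk>
    \<Longrightarrow> T \<rhd> \<Gamma> \<turnstile> App f a IN inst_ty 0 [a] B"
| pi_app_cong: "\<lbrakk>T \<rhd> \<Gamma> \<turnstile> A IS Set; T \<rhd> A # \<Gamma> \<turnstile> B IS Set;
     T \<rhd> \<Gamma> \<turnstile> f EQ f' IN PiS A B; T \<rhd> \<Gamma> \<turnstile> a EQ a' IN A\<rbrakk>
    \<Longrightarrow> T \<rhd> \<Gamma> \<turnstile> App f a EQ App f' a' IN inst_ty 0 [a] B"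
| pi_beta: "\<lbrakk>T \<rhd> \<Gamma> \<turnstile> A IS Set; T \<rhd> A # \<Gamma> \<turnstile> B IS Set; T \<rhd> A # \<Gamma> \<turnstile> b IN B; T \<rhd> \<Gamma> \<turnstile> a IN A\<rbrakk>
    \<Longrightarrow> T \<rhd> \<Gamma> \<turnstile> App (Lam b) a EQ inst_tm 0 [a] b IN inst_ty 0 [a] B"
| pi_eta: "\<lbrakk>T \<rhd> \<Gamma> \<turnstile> A IS Set; T \<rhd> A # \<Gamma> \<turnstile> B IS Set; T \<rhd> \<Gamma> \<turnstile> f IN PiS A B\<rbrakk>
    \<Longrightarrow> T \<rhd> \<Gamma> \<turnstile> Lam (App (lift_tm 1 f) (Var 0)) EQ f IN PiS A B"

\<comment> \<open>Quotient sets\<close>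
| quot_intro: "\<lbrakk>T \<rhd> \<Gamma> \<turnstile> Quot A R IS Set; T \<rhd> \<Gamma> \<turnstile> a IN A\<rbrakk> \<Longrightarrow> T \<rhd> \<Gamma> \<turnstile> Cls a IN Quot A R"
| quot_cls_cong: "\<lbrakk>T \<rhd> \<Gamma> \<turnstile> Quot A R IS Set; T \<rhd> \<Gamma> \<turnstile> a EQ a' IN A\<rbrakk>
    \<Longrightarrow> T \<rhd> \<Gamma> \<turnstile> Cls a EQ Cls a' IN Quot A R"
| quot_eq: "\<lbrakk>T \<rhd> \<Gamma> \<turnstile> Quot A R IS Set; T \<rhd> \<Gamma> \<turnstile> a IN A; T \<rhd> \<Gamma> \<turnstile> b IN A;
     T \<rhd> \<Gamma> \<turnstile> Holds (inst_ty 0 [b, a] R)\<rbrakk> \<Longrightarrow> T \<rhd> \<Gamma> \<turnstile> Cls a EQ Cls b IN Quot A R"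
| quot_eff: "\<lbrakk>T \<rhd> \<Gamma> \<turnstile> Quot A R IS Set; T \<rhd> \<Gamma> \<turnstile> a IN A; T \<rhd> \<Gamma> \<turnstile> b IN A;
     T \<rhd> \<Gamma> \<turnstile> Cls a EQ Cls b IN Quot A R\<rbrakk> \<Longrightarrow> T \<rhd> \<Gamma> \<turnstile> Holds (inst_ty 0 [b, a] R)"
| quot_elim: "\<lbrakk>T \<rhd> \<Gamma> \<turnstile> Quot A R IS Set; T \<rhd> Quot A R # \<Gamma> \<turnstile> L IS Col; T \<rhd> \<Gamma> \<turnstile> p IN Quot A R;
     T \<rhd> A # \<Gamma> \<turnstile> l IN inst_ty 1 [Cls (Var 0)] L;
     T \<rhd> R # lift_ty 1 A # A # \<Gamma> \<turnstile> inst_tm 3 [Var 2] l EQ inst_tm 3 [Var 1] l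
       IN inst_ty 3 [Cls (Var 2)] L\<rbrakk>
    \<Longrightarrow> T \<rhd> \<Gamma> \<turnstile> ElQ p l IN inst_ty 0 [p] L"
| quot_elim_cong: "\<lbrakk>T \<rhd> \<Gamma> \<turnstile> Quot A R IS Set; T \<rhd> Quot A R # \<Gamma> \<turnstile> L IS Col;
     T \<rhd> \<Gamma> \<turnstile> p EQ p' IN Quot A R;
     T \<rhd> A # \<Gamma> \<turnstile> l EQ l' IN inst_ty 1 [Cls (Var 0)] L;
     T \<rhd> R # lift_ty 1 A # A # \<Gamma> \<turnstile> inst_tm 3 [Var 2] l EQ inst_tm 3 [Var 1] l
       IN inst_ty 3 [Cls (Var 2)] L;
     T \<rhd> R # lift_ty 1 A # A # \<Gamma> \<turnstile> inst_tm 3 [Var 2] l' EQ inst_tm 3 [Var 1] l'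
       IN inst_ty 3 [Cls (Var 2)] L\<rbrakk>
    \<Longrightarrow> T \<rhd> \<Gamma> \<turnstile> ElQ p l EQ ElQ p' l' IN inst_ty 0 [p] L"
| quot_beta: "\<lbrakk>T \<rhd> \<Gamma> \<turnstile> Quot A R IS Set; T \<rhd> Quot A R # \<Gamma> \<turnstile> L IS Col; T \<rhd> \<Gamma> \<turnstile> a IN A;
     T \<rhd> A # \<Gamma> \<turnstile> l IN inst_ty 1 [Cls (Var 0)] L;
     T \<rhd> R # lift_ty 1 A # A # \<Gamma> \<turnstile> inst_tm 3 [Var 2] l EQ inst_tm 3 [Var 1] l
       IN inst_ty 3 [Cls (Var 2)] L\<rbrakk>
    \<Longrightarrow> T \<rhd> \<Gamma> \<turnstile> ElQ (Cls a) l EQ inst_tm 0 [a] l IN inst_ty 0 [Cls a] L"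

\<comment> \<open>The power collection of the singleton and power collections of sets\<close>
| code_intro: "T \<rhd> \<Gamma> \<turnstile> \<phi> IS PropS \<Longrightarrow> T \<rhd> \<Gamma> \<turnstile> Code \<phi> IN P1"
| code_cong: "T \<rhd> \<Gamma> \<turnstile> \<phi> EQ \<psi> IS PropS \<Longrightarrow> T \<rhd> \<Gamma> \<turnstile> Code \<phi> EQ Code \<psi> IN P1"
| code_eq: "\<lbrakk>T \<rhd> \<Gamma> \<turnstile> \<phi> IS PropS; T \<rhd> \<Gamma> \<turnstile> \<psi> IS PropS; T \<rhd> \<Gamma> \<turnstile> Holds (IffP \<phi> \<psi>)\<rbrakk>
    \<Longrightarrow> T \<rhd> \<Gamma> \<turnstile> Code \<phi> EQ Code \<psi> IN P1"
| code_eff: "\<lbrakk>T \<rhd> \<Gamma> \<turnstile> \<phi> IS PropS; T \<rhd> \<Gamma> \<turnstile> \<psi> IS PropS; T \<rhd> \<Gamma> \<turnstile> Code \<phi> EQ Code \<psi> IN P1\<rbrakk>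
    \<Longrightarrow> T \<rhd> \<Gamma> \<turnstile> Holds (IffP \<phi> \<psi>)"
| power_eta: "T \<rhd> \<Gamma> \<turnstile> U IN P1 \<Longrightarrow> T \<rhd> \<Gamma> \<turnstile> U EQ Code (EqP P1 U (Code TopP)) IN P1"
| powr_intro: "\<lbrakk>T \<rhd> \<Gamma> \<turnstile> A IS Set; T \<rhd> A # \<Gamma> \<turnstile> b IN P1\<rbrakk> \<Longrightarrow> T \<rhd> \<Gamma> \<turnstile> Lam b IN Powr A"
| powr_lam_cong: "\<lbrakk>T \<rhd> \<Gamma> \<turnstile> A IS Set; T \<rhd> A # \<Gamma> \<turnstile> b EQ b' IN P1\<rbrakk>
    \<Longrightarrow> T \<rhd> \<Gamma> \<turnstile> Lam b EQ Lam b' IN Powr A"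
| powr_elim: "\<lbrakk>T \<rhd> \<Gamma> \<turnstile> A IS Set; T \<rhd> \<Gamma> \<turnstile> f IN Powr A; T \<rhd> \<Gamma> \<turnstile> a IN A\<rbrakk> \<Longrightarrow> T \<rhd> \<Gamma> \<turnstile> App f a IN P1"
| powr_app_cong: "\<lbrakk>T \<rhd> \<Gamma> \<turnstile> A IS Set; T \<rhd> \<Gamma> \<turnstile> f EQ f' IN Powr A; T \<rhd> \<Gamma> \<turnstile> a EQ a' IN A\<rbrakk>
    \<Longrightarrow> T \<rhd> \<Gamma> \<turnstile> App f a EQ App f' a' IN P1"
| powr_beta: "\<lbrakk>T \<rhd> \<Gamma> \<turnstile> A IS Set; T \<rhd> A # \<Gamma> \<turnstile> b IN P1; T \<rhd> \<Gamma> \<turnstile> a IN A\<rbrakk>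
    \<Longrightarrow> T \<rhd> \<Gamma> \<turnstile> App (Lam b) a EQ inst_tm 0 [a] b IN P1"
| powr_eta: "\<lbrakk>T \<rhd> \<Gamma> \<turnstile> A IS Set; T \<rhd> \<Gamma> \<turnstile> f IN Powr A\<rbrakk>
    \<Longrightarrow> T \<rhd> \<Gamma> \<turnstile> Lam (App (lift_tm 1 f) (Var 0)) EQ f IN Powr A"


section \<open>Isomorphism of collections in the empty context\<close>

text \<open>\<open>t\<close> and \<open>s\<close> have the single free variable \<open>Var 0\<close>.\<close>

definition isomorphic :: "system \<Rightarrow> ty \<Rightarrow> ty \<Rightarrow> bool" where
  "isomorphic T A B \<longleftrightarrow> (\<exists>t s.
     (T \<rhd> [A] \<turnstile> t IN lift_ty 1 B) \<and> (T \<rhd> [B] \<turnstile> s IN lift_ty 1 A) \<and>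
     (T \<rhd> [] \<turnstile> Holds (AndP
        (AllP A (EqP (lift_ty 1 A) (inst_tm 1 [t] s) (Var 0)))
        (AllP B (EqP (lift_ty 1 B) (inst_tm 1 [s] t) (Var 0))))))"

definition isomorphic_to_some_set :: "system \<Rightarrow> ty \<Rightarrow> bool" where
  "isomorphic_to_some_set T C \<longleftrightarrow> (\<exists>A. (T \<rhd> [] \<turnstile> A IS Set) \<and> isomorphic T A C)"


section \<open>Number-theoretic functional relations\<close>

definition Dc :: "tm \<Rightarrow> ty" where
  "Dc U = EqP P1 U (Code TopP)"

definition memP :: "tm \<Rightarrow> tm \<Rightarrow> ty" where
  "memP a V = Dc (App V a)"

definition ProdS :: "ty \<Rightarrow> ty \<Rightarrow> ty" where
  "ProdS A B = Sig A (lift_ty 1 B)"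

definition NatS :: ty where
  "NatS = ListS N1"

definition FunRel :: "ty \<Rightarrow> ty \<Rightarrow> ty" where
  "FunRel A B = Sig (Powr (ProdS A B))
     (AllP (lift_ty 1 A) (Ex1P (lift_ty 2 B) (memP (PairT (Var 1) (Var 0)) (Var 2))))"


section \<open>Rational numbers and Dedekind reals\<close>

definition SucT :: "tm \<Rightarrow> tm" where
  "SucT n = ConsT n Star"

definition plusT :: "tm \<Rightarrow> tm \<Rightarrow> tm" where
  "plusT m n = ElList n m (SucT (Var 0))"

definition timesT :: "tm \<Rightarrow> tm \<Rightarrow> tm" where
  "timesT m n = ElList n NilT (plusT (Var 0) (lift_tm 3 m))"

definition lessN :: "tm \<Rightarrow> tm \<Rightarrow> ty" where
  "lessN m n = ExP NatS (EqP NatS (plusT (lift_tm 1 m) (SucT (Var 0))) (lift_tm 1 n))"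

definition fstT :: "tm \<Rightarrow> tm" where
  "fstT p = ElSig p (Var 1)"

definition sndT :: "tm \<Rightarrow> tm" where
  "sndT p = ElSig p (Var 0)"

text \<open>
  \<open>\<langle>\<langle>a, b\<rangle>, c\<rangle>\<close> represents the rational number \<open>(a - b) / (c + 1)\<close>.
  With \<open>\<langle>\<langle>a', b'\<rangle>, c'\<rangle>\<close> as second argument, \<open>cross\<close> is
  \<open>a (c' + 1) + b' (c + 1)\<close>; the two fractions are equal (ordered) iff this number is equal to
  (less than) the one with the arguments exchanged.
\<close>

definition Frac :: ty where
  "Frac = ProdS (ProdS NatS NatS) NatS"

definition cross :: "tm \<Rightarrow> tm \<Rightarrow> tm" where
  "cross p q = plusT (timesT (fstT (fstT p)) (SucT (sndT q)))
                     (timesT (sndT (fstT q)) (SucT (sndT p)))"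

definition RatS :: ty where
  "RatS = Quot Frac (EqP NatS (cross (Var 1) (Var 0)) (cross (Var 0) (Var 1)))"

definition lessQ :: "tm \<Rightarrow> tm \<Rightarrow> ty" where
  "lessQ q r = ExP Frac (ExP Frac
     (AndP (AndP (EqP RatS (Cls (Var 1)) (lift_tm 2 q)) (EqP RatS (Cls (Var 0)) (lift_tm 2 r)))
           (lessN (cross (Var 1) (Var 0)) (cross (Var 0) (Var 1)))))"

definition AllQ :: "tm \<Rightarrow> ty \<Rightarrow> ty" where
  "AllQ V \<phi> = AllP RatS (ImpP (memP (Var 0) (lift_tm 1 V)) \<phi>)"

definition ExQ :: "tm \<Rightarrow> ty \<Rightarrow> ty" where
  "ExQ V \<phi> = ExP RatS (AndP (memP (Var 0) (lift_tm 1 V)) \<phi>)"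

definition Reals :: ty where
  "Reals = Sig (Powr RatS)
     (AndP (ExP RatS (memP (Var 0) (Var 1)))
     (AndP (ExP RatS (NegP (memP (Var 0) (Var 1))))
     (AndP (AllQ (Var 0) (AllP RatS (ImpP (lessQ (Var 0) (Var 1)) (memP (Var 0) (Var 2)))))
           (AllQ (Var 0) (ExQ (Var 1) (lessQ (Var 1) (Var 0)))))))"

end

theory Submission
  imports "HOL-Library.Countable" "HOL-Analysis.Continuum_Not_Denumerable" Defs
begin

text \<open>
  The theory, with excluded middle, is sound for a classical realizability model in which a closed
  set has at most countably many elements, whereas \<open>P(\<nat>)\<close> contains all subsets of \<open>\<nat>\<close> of the
  metalanguage. An isomorphism between a set \<open>A\<close> and a collection \<open>C\<close> induces an injection of
  the elements of \<open>C\<close> into those of \<open>A\<close>; but \<open>FunRel(\<nat>, \<nat>)\<close> and the Dedekind reals have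
  uncountably many elements. Soundness holds for the theories with and without excluded middle
  alike, and the argument applies to both.

  The model separates computation from logic. An element of a collection is a pair of a
  \<^emph>\<open>realizer\<close>, which is a raw term run by weak head reduction, and a \<^emph>\<open>value\<close>, which carries the
  part of the element that is not computational: a truth value for an element of \<open>P(1)\<close>, an
  arbitrary predicate on realizers for an element of \<open>A \<rightarrow> P(1)\<close>, and a pair of values for a pair.
  A type denotes a partial equivalence relation on such pairs (\<open>ty_rel\<close>), depending on an
  assignment of pairs to the variables. Propositions are two-valued: they relate everything or
  nothing, whence excluded middle and proof irrelevance. The relation of a set ignores the values
  (\<open>realizer_determined\<close>), so an element of a set is determined by its realizer; in particular
  \<open>(\<Pi>x\<in>A)B\<close> contains only functions that are given by a raw term. There are countably many raw
  terms, and hence countably many elements of a closed set. Nothing of this kind restricts the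
  values, so the power collections are full.

  Why no rule breaks this separation: every term constructor computes the realizer of its result
  from the realizers of its arguments alone, so \<open>\<lambda>\<close>-abstraction over a set always yields a
  realizer, also in a context with variables of power collections; and the values may depend on
  everything, because they are never used as realizers.

  The work lies in \<open>sb_sem\<close> (substitution of terms is composition of assignments), in the lemmas on
  the individual rules that \<open>soundness\<close> combines, and in \<open>ty_rel_indicator_elt\<close> and
  \<open>ty_rel_cut_elt\<close>, which compute what \<open>FunRel(\<nat>, \<nat>)\<close> and the reals denote on enough
  elements: the indicator functions of sets of natural numbers, and the cuts of real numbers. The
  conclusion is drawn in \<open>not_isomorphic_to_set\<close>.
\<close>

section \<open>Substitution calculus\<close>

lemma up_rn_simps [simp]: "up_rn r 0 = 0" "up_rn r (Suc i) = Suc (r i)"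
  by (simp_all add: up_rn_def)

lemma up_sb_simps [simp]: "up_sb s 0 = Var 0" "up_sb s (Suc i) = rn_tm Suc (s i)"
  by (simp_all add: up_sb_def)

lemma up_rn_up_rn: "(\<lambda>i. up_rn r (up_rn r' i)) = up_rn (\<lambda>i. r (r' i))"
  by (rule ext) (simp add: up_rn_def split: nat.split)

lemma rn_rn:
  "rn_ty r (rn_ty r' A) = rn_ty (\<lambda>i. r (r' i)) A"
  "rn_tm r (rn_tm r' t) = rn_tm (\<lambda>i. r (r' i)) t"
  by (induction A and t arbitrary: r r' and r r') (simp_all add: up_rn_up_rn)

lemma up_sb_up_rn: "(\<lambda>i. up_sb s (up_rn r i)) = up_sb (\<lambda>i. s (r i))"
  by (rule ext) (simp add: up_rn_def up_sb_def split: nat.split)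

lemma sb_rn:
  "sb_ty s (rn_ty r A) = sb_ty (\<lambda>i. s (r i)) A"
  "sb_tm s (rn_tm r t) = sb_tm (\<lambda>i. s (r i)) t"
  by (induction A and t arbitrary: s r and s r) (simp_all add: up_sb_up_rn)

lemma rn_up_sb: "(\<lambda>i. rn_tm (up_rn r) (up_sb s i)) = up_sb (\<lambda>i. rn_tm r (s i))"
  by (rule ext) (simp add: up_sb_def rn_rn split: nat.split)

lemma rn_sb:
  "rn_ty r (sb_ty s A) = sb_ty (\<lambda>i. rn_tm r (s i)) A"
  "rn_tm r (sb_tm s t) = sb_tm (\<lambda>i. rn_tm r (s i)) t"
  by (induction A and t arbitrary: s r and s r) (simp_all add: rn_up_sb)

lemma sb_up_sb: "(\<lambda>i. sb_tm (up_sb s) (up_sb s' i)) = up_sb (\<lambda>i. sb_tm s (s' i))"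
  by (rule ext) (simp add: up_sb_def sb_rn rn_sb split: nat.split)

lemma sb_sb:
  "sb_ty s (sb_ty s' A) = sb_ty (\<lambda>i. sb_tm s (s' i)) A"
  "sb_tm s (sb_tm s' t) = sb_tm (\<lambda>i. sb_tm s (s' i)) t"
  by (induction A and t arbitrary: s s' and s s') (simp_all add: sb_up_sb)

lemma up_sb_Var [simp]: "up_sb Var = Var"
  by (rule ext) (simp add: up_sb_def split: nat.split)

lemma sb_Var [simp]: "sb_ty Var A = A" "sb_tm Var t = t"
  by (induction A and t) simp_all

text \<open>
  Used both for substitutions and for assignments: \<open>x\<close> is the meaning of the variable bound last.
\<close>

abbreviation push :: "'a \<Rightarrow> (nat \<Rightarrow> 'a) \<Rightarrow> nat \<Rightarrow> 'a"  (infixr "\<bullet>" 65) where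
  "x \<bullet> \<rho> \<equiv> case_nat x \<rho>"

lemma comp_push: "(\<lambda>i. f ((x \<bullet> \<rho>) i)) = f x \<bullet> (\<lambda>i. f (\<rho> i))"
  by (rule ext) (simp split: nat.split)

lemma push_up_rn: "(\<lambda>i. (x \<bullet> \<rho>) (up_rn r i)) = x \<bullet> (\<lambda>i. \<rho> (r i))"
  by (rule ext) (simp add: up_rn_def split: nat.split)

lemma inst_sb_simps [simp]:
  "inst_sb k [] i = Var (i + k)"
  "inst_sb k (t # ts) 0 = t"
  "inst_sb k (t # ts) (Suc i) = inst_sb k ts i"
  by (simp_all add: inst_sb_def)

lemma inst_sb_push: "inst_sb k (t # ts) = t \<bullet> inst_sb k ts"
  by (rule ext) (simp split: nat.split)

lemma inst_sb_Nil0: "inst_sb 0 [] = Var"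
  by (rule ext) simp

lemma push_up_sb: "(\<lambda>i. sb_tm (x \<bullet> s) (up_sb s' i)) = x \<bullet> (\<lambda>i. sb_tm s (s' i))"
  by (rule ext) (simp add: up_sb_def sb_rn split: nat.split)

text \<open>
  The form in which \<beta>-reduction meets assignments: contracting a redex whose body was
  instantiated under a binder amounts to instantiating the body with an extended substitution.
\<close>

lemma inst_up:
  "inst_tm 0 [a] (sb_tm (up_sb s) t) = sb_tm (a \<bullet> s) t"
  "inst_tm 0 [b, a] (sb_tm (up_sb (up_sb s)) t) = sb_tm (b \<bullet> a \<bullet> s) t"
  "inst_tm 0 [c, b, a] (sb_tm (up_sb (up_sb (up_sb s))) t) = sb_tm (c \<bullet> b \<bullet> a \<bullet> s) t"
  by (simp_all add: inst_sb_push inst_sb_Nil0 sb_sb push_up_sb)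


section \<open>Weak head reduction of raw terms\<close>

text \<open>
  Reduction is a partial function, which makes it deterministic by construction; this is all that
  replaces confluence. Every constructor, including \<open>Lam\<close> and \<open>Code\<close>, is a normal form, and
  eliminators evaluate only their principal argument. \<open>El0\<close> is stuck, since it is never applied to
  an element.
\<close>

primrec step :: "tm \<Rightarrow> tm option" where
  "step (Var i) = None"
| "step TrueT = None"
| "step (El0 p) = None"
| "step Star = None"
| "step (El1 p c) =
     (case p of Star \<Rightarrow> Some c | _ \<Rightarrow> map_option (\<lambda>p'. El1 p' c) (step p))"
| "step NilT = None"
| "step (ConsT l a) = None"
| "step (ElList p a c) =
     (case p of NilT \<Rightarrow> Some a | ConsT l b \<Rightarrow> Some (inst_tm 0 [ElList l a c, b, l] c)
      | _ \<Rightarrow> map_option (\<lambda>p'. ElList p' a c) (step p))"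
| "step (InlT a) = None"
| "step (InrT a) = None"
| "step (ElSum p d e) =
     (case p of InlT a \<Rightarrow> Some (inst_tm 0 [a] d) | InrT b \<Rightarrow> Some (inst_tm 0 [b] e)
      | _ \<Rightarrow> map_option (\<lambda>p'. ElSum p' d e) (step p))"
| "step (PairT a b) = None"
| "step (ElSig p m) =
     (case p of PairT a b \<Rightarrow> Some (inst_tm 0 [b, a] m)
      | _ \<Rightarrow> map_option (\<lambda>p'. ElSig p' m) (step p))"
| "step (Lam b) = None"
| "step (App f a) =
     (case f of Lam b \<Rightarrow> Some (inst_tm 0 [a] b) | _ \<Rightarrow> map_option (\<lambda>f'. App f' a) (step f))"
| "step (Cls a) = None"
| "step (ElQ p l) =
     (case p of Cls a \<Rightarrow> Some (inst_tm 0 [a] l) | _ \<Rightarrow> map_option (\<lambda>p'. ElQ p' l) (step p))"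
| "step (Code A) = None"

abbreviation steps :: "tm \<Rightarrow> tm \<Rightarrow> bool"  (infix "\<longrightarrow>*" 50) where
  "r \<longrightarrow>* r' \<equiv> (\<lambda>r r'. step r = Some r')\<^sup>*\<^sup>* r r'"

definition evaluates :: "tm \<Rightarrow> tm \<Rightarrow> bool"  (infix "\<Down>" 50) where
  "r \<Down> w \<longleftrightarrow> r \<longrightarrow>* w \<and> step w = None"

definition whnf :: "tm \<Rightarrow> tm" where
  "whnf r = (THE w. r \<Down> w)"

lemma evaluates_step: "step r = Some r' \<Longrightarrow> r \<Down> w \<longleftrightarrow> r' \<Down> w"
  unfolding evaluates_def
  by (metis (mono_tags, lifting) converse_rtranclp_into_rtranclp converse_rtranclpE option.distinct(1)
      option.inject)

lemma evaluates_steps: "r \<longrightarrow>* r' \<Longrightarrow> r \<Down> w \<longleftrightarrow> r' \<Down> w"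
  by (induction rule: rtranclp_induct) (auto simp: evaluates_step)

lemma evaluates_refl [simp]: "step r = None \<Longrightarrow> r \<Down> w \<longleftrightarrow> w = r"
  unfolding evaluates_def by (auto elim: converse_rtranclpE)

lemma evaluates_unique: "r \<Down> w \<Longrightarrow> r \<Down> w' \<Longrightarrow> w = w'"
  using evaluates_def evaluates_refl evaluates_steps by blast

lemma whnf_eqI [simp]: "r \<Down> w \<Longrightarrow> whnf r = w"
  unfolding whnf_def by (blast intro: evaluates_unique)

lemma steps_cong:
  assumes "r \<longrightarrow>* r'" "\<And>x y. step x = Some y \<Longrightarrow> step (F x) = Some (F y)"
  shows "F r \<longrightarrow>* F r'"
  using assms(1) by (induction rule: rtranclp_induct) (auto intro: rtranclp.rtrancl_into_rtrancl assms(2))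

lemma step_cong:
  assumes "step p = Some p'"
  shows "step (El1 p c) = Some (El1 p' c)"
    and "step (ElList p a d) = Some (ElList p' a d)"
    and "step (ElSum p d e) = Some (ElSum p' d e)"
    and "step (ElSig p m) = Some (ElSig p' m)"
    and "step (App p a) = Some (App p' a)"
    and "step (ElQ p l) = Some (ElQ p' l)"
  using assms by (cases p; simp)+

text \<open>
  The common pattern of the eliminators: run the principal argument \<open>p\<close> to its head form \<open>w\<close>
  inside the evaluation context \<open>F\<close>, then contract.
\<close>

lemma eliminator_steps:
  assumes "p \<Down> w" "\<And>p p'. step p = Some p' \<Longrightarrow> step (F p) = Some (F p')" "step (F w) = Some t"
  shows "F p \<longrightarrow>* t"
  using steps_cong[of p w F] assms unfolding evaluates_def
  by (metis (mono_tags, lifting) rtranclp.rtrancl_into_rtrancl)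

lemma El1_steps: "p \<Down> Star \<Longrightarrow> El1 p c \<longrightarrow>* c"
  by (rule eliminator_steps[where F="\<lambda>p. El1 p c"], assumption, erule step_cong, simp)

lemma ElList_steps:
  "p \<Down> NilT \<Longrightarrow> ElList p a c \<longrightarrow>* a"
  "p \<Down> ConsT l b \<Longrightarrow> ElList p a c \<longrightarrow>* inst_tm 0 [ElList l a c, b, l] c"
  by (rule eliminator_steps[where F="\<lambda>p. ElList p a c"], assumption, erule step_cong, simp)+

lemma ElSum_steps:
  "p \<Down> InlT a \<Longrightarrow> ElSum p d e \<longrightarrow>* inst_tm 0 [a] d"
  "p \<Down> InrT b \<Longrightarrow> ElSum p d e \<longrightarrow>* inst_tm 0 [b] e"
  by (rule eliminator_steps[where F="\<lambda>p. ElSum p d e"], assumption, erule step_cong, simp)+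

lemma ElSig_steps: "p \<Down> PairT a b \<Longrightarrow> ElSig p m \<longrightarrow>* inst_tm 0 [b, a] m"
  by (rule eliminator_steps[where F="\<lambda>p. ElSig p m"], assumption, erule step_cong, simp)

lemma ElQ_steps: "p \<Down> Cls a \<Longrightarrow> ElQ p l \<longrightarrow>* inst_tm 0 [a] l"
  by (rule eliminator_steps[where F="\<lambda>p. ElQ p l"], assumption, erule step_cong, simp)


section \<open>The model\<close>

text \<open>
  The non-computational component of an element. The subset carried by \<open>VFun\<close> is an arbitrary
  predicate of the metalanguage on the realizers of the elements of the base set; it is here that
  the power collections become uncountable. The selectors below are total, so that components of
  values can be used without first knowing their shape; on set-like data, where the value is
  irrelevant, the default \<open>VNone\<close> occurs.
\<close>

datatype val = VNone | VBool bool | VFun "tm \<Rightarrow> bool" | VPair val val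

fun val_bool :: "val \<Rightarrow> bool" where
  "val_bool (VBool b) = b"
| "val_bool _ = False"

fun val_fun :: "val \<Rightarrow> tm \<Rightarrow> bool" where
  "val_fun (VFun f) = f"
| "val_fun _ = (\<lambda>_. False)"

fun val_fst :: "val \<Rightarrow> val" where
  "val_fst (VPair u v) = u"
| "val_fst _ = VNone"

fun val_snd :: "val \<Rightarrow> val" where
  "val_snd (VPair u v) = v"
| "val_snd _ = VNone"

type_synonym elt = "tm \<times> val"
type_synonym env = "nat \<Rightarrow> elt"

inductive list_related :: "(tm \<Rightarrow> tm \<Rightarrow> bool) \<Rightarrow> tm \<Rightarrow> tm \<Rightarrow> bool" for E where
  list_related_Nil: "r \<Down> NilT \<Longrightarrow> r' \<Down> NilT \<Longrightarrow> list_related E r r'"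
| list_related_Cons: "r \<Down> ConsT l b \<Longrightarrow> r' \<Down> ConsT l' b' \<Longrightarrow> E b b' \<Longrightarrow> list_related E l l'
    \<Longrightarrow> list_related E r r'"

text \<open>
  Recursion on lists at the level of values: the list is read off from its realizer. The relation is
  functional, and total on realizers of lists.
\<close>

inductive list_rec :: "val \<Rightarrow> (tm \<Rightarrow> tm \<Rightarrow> val \<Rightarrow> val) \<Rightarrow> tm \<Rightarrow> val \<Rightarrow> bool" for z f where
  list_rec_Nil: "r \<Down> NilT \<Longrightarrow> list_rec z f r z"
| list_rec_Cons: "r \<Down> ConsT l b \<Longrightarrow> list_rec z f l v \<Longrightarrow> list_rec z f r (f l b v)"

text \<open>
  The relation denoted by a type, and the value denoted by a term; the realizer of a term is obtained
  by substituting the realizers of its variables. The two depend on each other through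
  \<open>EqP\<close> and \<open>Code\<close>.

  Elements of sets that are extracted from a realizer receive the value \<open>VNone\<close>; this is
  harmless because the relations of sets ignore values. Propositions, being constant relations,
  are evaluated at \<open>undefined\<close>. The clause for \<open>Sig\<close> serves indexed sums of sets and of
  collections alike, so that the inclusion of sets in collections is an identity; it inspects the
  value of a pair only through the relations of its components. Likewise \<open>tm_val\<close> gives
  \<open>Lam\<close> and \<open>App\<close> the value appropriate to \<open>Powr\<close>, which \<open>PiS\<close> disregards.
\<close>

primrec ty_rel :: "ty \<Rightarrow> env \<Rightarrow> elt \<Rightarrow> elt \<Rightarrow> bool"
  and tm_val :: "tm \<Rightarrow> env \<Rightarrow> val" where
  "ty_rel BotP \<rho> = (\<lambda>_ _. False)"
| "ty_rel (AndP \<phi> \<psi>) \<rho> =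
     (\<lambda>_ _. ty_rel \<phi> \<rho> undefined undefined \<and> ty_rel \<psi> \<rho> undefined undefined)"
| "ty_rel (OrP \<phi> \<psi>) \<rho> =
     (\<lambda>_ _. ty_rel \<phi> \<rho> undefined undefined \<or> ty_rel \<psi> \<rho> undefined undefined)"
| "ty_rel (ImpP \<phi> \<psi>) \<rho> =
     (\<lambda>_ _. ty_rel \<phi> \<rho> undefined undefined \<longrightarrow> ty_rel \<psi> \<rho> undefined undefined)"
| "ty_rel (ExP A \<phi>) \<rho> =
     (\<lambda>_ _. \<exists>x. ty_rel A \<rho> x x \<and> ty_rel \<phi> (x \<bullet> \<rho>) undefined undefined)"
| "ty_rel (AllP A \<phi>) \<rho> =
     (\<lambda>_ _. \<forall>x. ty_rel A \<rho> x x \<longrightarrow> ty_rel \<phi> (x \<bullet> \<rho>) undefined undefined)"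
| "ty_rel (EqP A a b) \<rho> =
     (\<lambda>_ _. ty_rel A \<rho> (sb_tm (\<lambda>i. fst (\<rho> i)) a, tm_val a \<rho>) (sb_tm (\<lambda>i. fst (\<rho> i)) b, tm_val b \<rho>))"
| "ty_rel N0 \<rho> = (\<lambda>_ _. False)"
| "ty_rel N1 \<rho> = (\<lambda>x y. fst x \<Down> Star \<and> fst y \<Down> Star)"
| "ty_rel (ListS A) \<rho> =
     (\<lambda>x y. list_related (\<lambda>r r'. ty_rel A \<rho> (r, VNone) (r', VNone)) (fst x) (fst y))"
| "ty_rel (SumS A B) \<rho> = (\<lambda>x y.
     (\<exists>a a'. fst x \<Down> InlT a \<and> fst y \<Down> InlT a' \<and> ty_rel A \<rho> (a, VNone) (a', VNone)) \<or>
     (\<exists>b b'. fst x \<Down> InrT b \<and> fst y \<Down> InrT b' \<and> ty_rel B \<rho> (b, VNone) (b', VNone)))"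
| "ty_rel (Sig A B) \<rho> = (\<lambda>x y.
     \<exists>a b a' b'. fst x \<Down> PairT a b \<and> fst y \<Down> PairT a' b' \<and>
       ty_rel A \<rho> (a, val_fst (snd x)) (a', val_fst (snd y)) \<and>
       ty_rel B ((a, val_fst (snd x)) \<bullet> \<rho>) (b, val_snd (snd x)) (b', val_snd (snd y)))"
| "ty_rel (PiS A B) \<rho> = (\<lambda>x y.
     \<forall>a a'. ty_rel A \<rho> a a' \<longrightarrow>
       ty_rel B (a \<bullet> \<rho>) (App (fst x) (fst a), VNone) (App (fst y) (fst a'), VNone))"
| "ty_rel (Quot A R) \<rho> = (\<lambda>x y.
     \<exists>a a'. fst x \<Down> Cls a \<and> fst y \<Down> Cls a' \<and>
       ty_rel A \<rho> (a, VNone) (a, VNone) \<and> ty_rel A \<rho> (a', VNone) (a', VNone) \<and>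
       ty_rel R ((a', VNone) \<bullet> (a, VNone) \<bullet> \<rho>) undefined undefined)"
| "ty_rel P1 \<rho> = (\<lambda>x y. val_bool (snd x) = val_bool (snd y))"
| "ty_rel (Powr A) \<rho> = (\<lambda>x y.
     \<forall>a a'. ty_rel A \<rho> a a' \<longrightarrow> val_fun (snd x) (fst a) = val_fun (snd y) (fst a'))"
| "tm_val (Var i) \<rho> = snd (\<rho> i)"
| "tm_val TrueT \<rho> = VNone"
| "tm_val (El0 p) \<rho> = VNone"
| "tm_val Star \<rho> = VNone"
| "tm_val (El1 p c) \<rho> = tm_val c \<rho>"
| "tm_val NilT \<rho> = VNone"
| "tm_val (ConsT l a) \<rho> = VNone"
| "tm_val (ElList p a c) \<rho> = (THE v. list_rec (tm_val a \<rho>)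
     (\<lambda>l b v. tm_val c
        ((ElList l (sb_tm (\<lambda>i. fst (\<rho> i)) a) (sb_tm (up_sb (up_sb (up_sb (\<lambda>i. fst (\<rho> i))))) c), v)
          \<bullet> (b, VNone) \<bullet> (l, VNone) \<bullet> \<rho>))
     (sb_tm (\<lambda>i. fst (\<rho> i)) p) v)"
| "tm_val (InlT a) \<rho> = VNone"
| "tm_val (InrT a) \<rho> = VNone"
| "tm_val (ElSum p d e) \<rho> = (case whnf (sb_tm (\<lambda>i. fst (\<rho> i)) p) of
       InlT a \<Rightarrow> tm_val d ((a, VNone) \<bullet> \<rho>)
     | InrT b \<Rightarrow> tm_val e ((b, VNone) \<bullet> \<rho>)
     | _ \<Rightarrow> VNone)"
| "tm_val (PairT a b) \<rho> = VPair (tm_val a \<rho>) (tm_val b \<rho>)"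
| "tm_val (ElSig p m) \<rho> = (case whnf (sb_tm (\<lambda>i. fst (\<rho> i)) p) of
       PairT a b \<Rightarrow> tm_val m ((b, val_snd (tm_val p \<rho>)) \<bullet> (a, val_fst (tm_val p \<rho>)) \<bullet> \<rho>)
     | _ \<Rightarrow> VNone)"
| "tm_val (Lam b) \<rho> = VFun (\<lambda>r. val_bool (tm_val b ((r, VNone) \<bullet> \<rho>)))"
| "tm_val (App f a) \<rho> = VBool (val_fun (tm_val f \<rho>) (sb_tm (\<lambda>i. fst (\<rho> i)) a))"
| "tm_val (Cls a) \<rho> = VNone"
| "tm_val (ElQ p l) \<rho> = (case whnf (sb_tm (\<lambda>i. fst (\<rho> i)) p) of
       Cls a \<Rightarrow> tm_val l ((a, VNone) \<bullet> \<rho>)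
     | _ \<Rightarrow> VNone)"
| "tm_val (Code \<phi>) \<rho> = VBool (ty_rel \<phi> \<rho> undefined undefined)"

abbreviation holds :: "ty \<Rightarrow> env \<Rightarrow> bool" where
  "holds \<phi> \<rho> \<equiv> ty_rel \<phi> \<rho> undefined undefined"

definition elt :: "tm \<Rightarrow> env \<Rightarrow> elt" where
  "elt t \<rho> = (sb_tm (\<lambda>i. fst (\<rho> i)) t, tm_val t \<rho>)"

lemma fst_push: "(\<lambda>i. fst ((x \<bullet> \<rho>) i)) = fst x \<bullet> (\<lambda>i. fst (\<rho> i))"
  by (rule comp_push)

lemma rn_sem:
  "ty_rel (rn_ty r A) \<rho> = ty_rel A (\<lambda>i. \<rho> (r i))"
  "tm_val (rn_tm r t) \<rho> = tm_val t (\<lambda>i. \<rho> (r i))"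
  by (induction A and t arbitrary: r \<rho> and r \<rho>)
     (simp_all add: push_up_rn sb_rn up_sb_up_rn cong: tm.case_cong)

lemma elt_rn: "elt (rn_tm r t) \<rho> = elt t (\<lambda>i. \<rho> (r i))"
  by (simp add: elt_def rn_sem sb_rn)

lemma elt_Var [simp]: "elt (Var i) \<rho> = \<rho> i"
  by (simp add: elt_def)

lemma elt_up_sb: "(\<lambda>i. elt (up_sb s i) (x \<bullet> \<rho>)) = x \<bullet> (\<lambda>i. elt (s i) \<rho>)"
  by (rule ext) (simp add: up_sb_def elt_rn split: nat.split)

lemma fst_elt: "fst (elt t \<rho>) = sb_tm (\<lambda>i. fst (\<rho> i)) t"
  by (simp add: elt_def)

lemma snd_elt: "snd (elt t \<rho>) = tm_val t \<rho>"
  by (simp add: elt_def)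

text \<open>
  The substitution lemma of the model; the assignment on the right gives each variable the meaning
  of the term substituted for it.
\<close>

lemma sb_sem:
  "ty_rel (sb_ty s A) \<rho> = ty_rel A (\<lambda>i. elt (s i) \<rho>)"
  "tm_val (sb_tm s t) \<rho> = tm_val t (\<lambda>i. elt (s i) \<rho>)"
  by (induction A and t arbitrary: s \<rho> and s \<rho>)
     (simp_all add: elt_up_sb sb_sb sb_up_sb fst_elt snd_elt cong: tm.case_cong)

lemma elt_sb: "elt (sb_tm s t) \<rho> = elt t (\<lambda>i. elt (s i) \<rho>)"
  by (simp add: elt_def sb_sem sb_sb)

(* Elements are pairs, but quantifiers over them should not be split into components. *)
declare split_paired_All [simp del] split_paired_Ex [simp del]

lemma elt_inst_sb: "(\<lambda>i. elt (inst_sb k [] i) \<rho>) = (\<lambda>i. \<rho> (i + k))"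
  "(\<lambda>i. elt (inst_sb k (t # ts) i) \<rho>) = elt t \<rho> \<bullet> (\<lambda>i. elt (inst_sb k ts i) \<rho>)"
  by (simp_all add: inst_sb_push comp_push[where f="\<lambda>t. elt t \<rho>"])

lemmas sem_simps = rn_sem sb_sem elt_rn elt_sb elt_inst_sb eval_nat_numeral

section \<open>Semantic validity of judgements\<close>

text \<open>
  What the relation of any collection satisfies: it is a partial equivalence relation, and its domain
  is closed under reduction and expansion of realizers. Closure under expansion is what validates the
  \<beta>-equalities, and symmetry extends the third clause to the second argument.
\<close>

definition admissible :: "(elt \<Rightarrow> elt \<Rightarrow> bool) \<Rightarrow> bool" where
  "admissible E \<longleftrightarrow> symp E \<and> transp E \<and>
     (\<forall>x y r. step (fst x) = Some r \<longrightarrow> E x y = E (r, snd x) y)"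

definition all_or_none :: "(elt \<Rightarrow> elt \<Rightarrow> bool) \<Rightarrow> bool" where
  "all_or_none E \<longleftrightarrow> (\<forall>x y x' y'. E x y = E x' y')"

definition realizer_determined :: "(elt \<Rightarrow> elt \<Rightarrow> bool) \<Rightarrow> bool" where
  "realizer_determined E \<longleftrightarrow> (\<forall>r r' u u' v v'. E (r, u) (r', u') = E (r, v) (r', v'))"

text \<open>
  The power collections contain every predicate of the metalanguage, so small propositions can be
  interpreted in the same way as propositions. A constant relation meets the condition for sets.
\<close>

fun of_kind :: "kind \<Rightarrow> (elt \<Rightarrow> elt \<Rightarrow> bool) \<Rightarrow> bool" where
  "of_kind PropS E = all_or_none E"
| "of_kind Prop E = all_or_none E"
| "of_kind Set E = (admissible E \<and> realizer_determined E)"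
| "of_kind Col E = admissible E"

definition env_rel :: "ctx \<Rightarrow> env \<Rightarrow> env \<Rightarrow> bool" where
  "env_rel \<Gamma> \<rho> \<rho>' \<longleftrightarrow> (\<forall>i < length \<Gamma>. ty_rel (lift_ty (Suc i) (\<Gamma> ! i)) \<rho> (\<rho> i) (\<rho>' i))"

text \<open>
  Validity of \<open>A = B\<close> and \<open>a = b \<in> A\<close>. Comparing the two sides at \<^emph>\<open>related\<close> assignments
  combines the equality with the invariance of both sides, so that well-formedness is the diagonal
  case and each formation rule is an instance of its congruence rule.
\<close>

definition eq_types :: "ctx \<Rightarrow> ty \<Rightarrow> ty \<Rightarrow> kind \<Rightarrow> bool" where
  "eq_types \<Gamma> A B k \<longleftrightarrow>
     (\<forall>\<rho> \<rho>'. env_rel \<Gamma> \<rho> \<rho>' \<longrightarrow> ty_rel A \<rho> = ty_rel B \<rho>' \<and> of_kind k (ty_rel A \<rho>))"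

definition eq_terms :: "ctx \<Rightarrow> tm \<Rightarrow> tm \<Rightarrow> ty \<Rightarrow> bool" where
  "eq_terms \<Gamma> a b A \<longleftrightarrow> eq_types \<Gamma> A A Col \<and>
     (\<forall>\<rho> \<rho>'. env_rel \<Gamma> \<rho> \<rho>' \<longrightarrow> ty_rel A \<rho> (elt a \<rho>) (elt b \<rho>'))"

primrec valid_ctx :: "ctx \<Rightarrow> bool" where
  "valid_ctx [] = True"
| "valid_ctx (A # \<Gamma>) = (valid_ctx \<Gamma> \<and> eq_types \<Gamma> A A Col)"

lemma admissible_sym: "admissible E \<Longrightarrow> E x y \<Longrightarrow> E y x"
  by (auto simp: admissible_def dest: sympD)

lemma admissible_trans: "admissible E \<Longrightarrow> E x y \<Longrightarrow> E y z \<Longrightarrow> E x z"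
  by (auto simp: admissible_def dest: transpD)

lemma admissible_refl: "admissible E \<Longrightarrow> E x y \<Longrightarrow> E x x" "admissible E \<Longrightarrow> E x y \<Longrightarrow> E y y"
  by (meson admissible_sym admissible_trans)+

lemma admissible_steps1: "r \<longrightarrow>* r' \<Longrightarrow> admissible E \<Longrightarrow> E (r, v) y = E (r', v) y"
proof (induction rule: rtranclp_induct)
  case (step r' r'')
  then have "E (r', v) y = E (r'', v) y"
    by (metis admissible_def fst_conv snd_conv)
  with step show ?case by simp
qed simp

definition reduces :: "elt \<Rightarrow> elt \<Rightarrow> bool"  (infix "\<leadsto>" 50) where
  "x \<leadsto> y \<longleftrightarrow> fst x \<longrightarrow>* fst y \<and> snd x = snd y"

lemma reduces_refl [simp]: "x \<leadsto> x"
  by (simp add: reduces_def)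

lemma admissible_reduces: "admissible E \<Longrightarrow> x \<leadsto> x' \<Longrightarrow> y \<leadsto> y' \<Longrightarrow> E x y = E x' y'"
  unfolding reduces_def
  by (metis admissible_steps1 admissible_sym prod.collapse)

lemma all_or_none_admissible: "all_or_none E \<Longrightarrow> admissible E"
  unfolding all_or_none_def admissible_def by (blast intro!: sympI transpI)

lemma all_or_none_realizer_determined: "all_or_none E \<Longrightarrow> realizer_determined E"
  unfolding all_or_none_def realizer_determined_def by blast

lemma of_kind_admissible: "of_kind k E \<Longrightarrow> admissible E"
  by (cases k) (auto simp: all_or_none_admissible)

lemma of_kind_incl:
  "of_kind k E \<Longrightarrow> (k, k') \<in> {(PropS, Prop), (PropS, Set), (Prop, Col), (Set, Col)} \<Longrightarrow> of_kind k' E"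
  by (auto simp: all_or_none_admissible all_or_none_realizer_determined)

lemma realizer_determinedD:
  "realizer_determined E \<Longrightarrow> E x y \<Longrightarrow> fst x = fst x' \<Longrightarrow> fst y = fst y' \<Longrightarrow> E x' y'"
  unfolding realizer_determined_def by (metis prod.collapse)

lemma env_rel_Nil [simp]: "env_rel [] \<rho> \<rho>'"
  by (simp add: env_rel_def)

lemma env_rel_Cons: "env_rel (A # \<Gamma>) \<rho> \<rho>' \<longleftrightarrow>
    ty_rel A (\<lambda>i. \<rho> (Suc i)) (\<rho> 0) (\<rho>' 0) \<and> env_rel \<Gamma> (\<lambda>i. \<rho> (Suc i)) (\<lambda>i. \<rho>' (Suc i))"
  by (auto simp: env_rel_def rn_sem less_Suc_eq_0_disj)

lemma env_rel_push [simp]: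
  "env_rel (A # \<Gamma>) (x \<bullet> \<rho>) (y \<bullet> \<rho>') \<longleftrightarrow> ty_rel A \<rho> x y \<and> env_rel \<Gamma> \<rho> \<rho>'"
  by (simp add: env_rel_Cons)

lemma eq_typesD:
  assumes "eq_types \<Gamma> A B k" "env_rel \<Gamma> \<rho> \<rho>'"
  shows "ty_rel A \<rho> = ty_rel B \<rho>'" "of_kind k (ty_rel A \<rho>)" "admissible (ty_rel A \<rho>)"
  using assms of_kind_admissible unfolding eq_types_def by blast+

lemma eq_typesI:
  assumes "\<And>\<rho> \<rho>'. env_rel \<Gamma> \<rho> \<rho>' \<Longrightarrow> ty_rel A \<rho> = ty_rel B \<rho>'"
    and "\<And>\<rho> \<rho>'. env_rel \<Gamma> \<rho> \<rho>' \<Longrightarrow> of_kind k (ty_rel A \<rho>)"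
  shows "eq_types \<Gamma> A B k"
  using assms unfolding eq_types_def by blast

lemma eq_termsI:
  assumes "eq_types \<Gamma> A A Col"
    and "\<And>\<rho> \<rho>'. env_rel \<Gamma> \<rho> \<rho>' \<Longrightarrow> ty_rel A \<rho> (elt a \<rho>) (elt b \<rho>')"
  shows "eq_terms \<Gamma> a b A"
  using assms unfolding eq_terms_def by blast

lemma env_rel_sym: "valid_ctx \<Gamma> \<Longrightarrow> env_rel \<Gamma> \<rho> \<rho>' \<Longrightarrow> env_rel \<Gamma> \<rho>' \<rho>"
proof (induction \<Gamma> arbitrary: \<rho> \<rho>')
  case (Cons A \<Gamma>)
  let ?\<rho> = "\<lambda>i. \<rho> (Suc i)" and ?\<rho>' = "\<lambda>i. \<rho>' (Suc i)"
  have A: "eq_types \<Gamma> A A Col" and x: "ty_rel A ?\<rho> (\<rho> 0) (\<rho>' 0)" and env: "env_rel \<Gamma> ?\<rho> ?\<rho>'"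
    using Cons.prems by (simp_all add: env_rel_Cons)
  have "ty_rel A ?\<rho>' (\<rho>' 0) (\<rho> 0)"
    using admissible_sym[OF eq_typesD(3)[OF A env] x] eq_typesD(1)[OF A env] by simp
  moreover have "env_rel \<Gamma> ?\<rho>' ?\<rho>"
    using Cons.IH[OF _ env] Cons.prems(1) by simp
  ultimately show ?case by (simp add: env_rel_Cons)
qed simp

lemma env_rel_trans:
  "valid_ctx \<Gamma> \<Longrightarrow> env_rel \<Gamma> \<rho> \<rho>' \<Longrightarrow> env_rel \<Gamma> \<rho>' \<rho>'' \<Longrightarrow> env_rel \<Gamma> \<rho> \<rho>''"
proof (induction \<Gamma> arbitrary: \<rho> \<rho>' \<rho>'')
  case (Cons A \<Gamma>)
  let ?\<rho> = "\<lambda>i. \<rho> (Suc i)" and ?\<rho>' = "\<lambda>i. \<rho>' (Suc i)" and ?\<rho>'' = "\<lambda>i. \<rho>'' (Suc i)"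
  have A: "eq_types \<Gamma> A A Col"
    and x: "ty_rel A ?\<rho> (\<rho> 0) (\<rho>' 0)" "ty_rel A ?\<rho>' (\<rho>' 0) (\<rho>'' 0)"
    and env: "env_rel \<Gamma> ?\<rho> ?\<rho>'" "env_rel \<Gamma> ?\<rho>' ?\<rho>''"
    using Cons.prems by (simp_all add: env_rel_Cons)
  have "ty_rel A ?\<rho> (\<rho> 0) (\<rho>'' 0)"
    using admissible_trans[OF eq_typesD(3)[OF A env(1)] x(1)] x(2) eq_typesD(1)[OF A env(1)] by simp
  moreover have "env_rel \<Gamma> ?\<rho> ?\<rho>''"
    using Cons.IH[OF _ env] Cons.prems(1) by simp
  ultimately show ?case by (simp add: env_rel_Cons)
qed simp

lemma env_rel_refl:
  assumes "valid_ctx \<Gamma>" "env_rel \<Gamma> \<rho> \<rho>'"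
  shows "env_rel \<Gamma> \<rho> \<rho>" "env_rel \<Gamma> \<rho>' \<rho>'"
  using env_rel_trans[OF assms env_rel_sym[OF assms]] env_rel_trans[OF assms(1) env_rel_sym[OF assms] assms(2)]
  by simp_all

text \<open>
  The form in which a dependent family over \<open>A\<close> is used: it is invariant along the relation of
  \<open>A\<close>.
\<close>

lemma eq_types_family:
  assumes "eq_types (A # \<Gamma>) B B' k" "env_rel \<Gamma> \<rho> \<rho>'" "ty_rel A \<rho> x y"
  shows "ty_rel B (x \<bullet> \<rho>) = ty_rel B' (y \<bullet> \<rho>')" "of_kind k (ty_rel B (x \<bullet> \<rho>))"
    "admissible (ty_rel B (x \<bullet> \<rho>))"
  using assms eq_typesD[of "A # \<Gamma>" B B' k "x \<bullet> \<rho>" "y \<bullet> \<rho>'"] by simp_all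

lemma eq_types_incl:
  "eq_types \<Gamma> A B k \<Longrightarrow> (k, k') \<in> {(PropS, Prop), (PropS, Set), (Prop, Col), (Set, Col)}
    \<Longrightarrow> eq_types \<Gamma> A B k'"
  by (blast intro: eq_typesI of_kind_incl dest: eq_typesD)

lemma eq_types_Col: "eq_types \<Gamma> A B k \<Longrightarrow> eq_types \<Gamma> A B Col"
  unfolding eq_types_def using of_kind_admissible of_kind.simps(4) by blast

lemma eq_types_sym:
  assumes "valid_ctx \<Gamma>" "eq_types \<Gamma> A B k"
  shows "eq_types \<Gamma> B A k"
  using eq_typesD(1,2)[OF assms(2) env_rel_sym[OF assms(1)]] eq_typesD(1,2)[OF assms(2) env_rel_refl(1)[OF assms(1)]]
  by (intro eq_typesI) simp_all

lemma eq_types_trans: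
  assumes "valid_ctx \<Gamma>" "eq_types \<Gamma> A B k" "eq_types \<Gamma> B C k"
  shows "eq_types \<Gamma> A C k"
  using eq_typesD(1,2)[OF assms(2)] eq_typesD(1)[OF assms(3) env_rel_refl(2)[OF assms(1)]]
  by (intro eq_typesI) simp_all

lemma eq_types_refl:
  assumes "valid_ctx \<Gamma>" "eq_types \<Gamma> A B k"
  shows "eq_types \<Gamma> A A k" "eq_types \<Gamma> B B k"
  using eq_types_trans[OF assms(1)] eq_types_sym[OF assms] assms(2) by blast+

lemma eq_termsD:
  assumes "eq_terms \<Gamma> a b A" "env_rel \<Gamma> \<rho> \<rho>'"
  shows "ty_rel A \<rho> (elt a \<rho>) (elt b \<rho>')" "admissible (ty_rel A \<rho>)" "ty_rel A \<rho> = ty_rel A \<rho>'"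
proof -
  have A: "eq_types \<Gamma> A A Col" and ab: "ty_rel A \<rho> (elt a \<rho>) (elt b \<rho>')"
    using assms by (simp_all add: eq_terms_def)
  show "ty_rel A \<rho> (elt a \<rho>) (elt b \<rho>')" "admissible (ty_rel A \<rho>)" "ty_rel A \<rho> = ty_rel A \<rho>'"
    using ab eq_typesD(1,3)[OF A assms(2)] by simp_all
qed

lemma eq_terms_type: "eq_terms \<Gamma> a b A \<Longrightarrow> eq_types \<Gamma> A A Col"
  by (simp add: eq_terms_def)

lemma eq_terms_sym:
  assumes "valid_ctx \<Gamma>" "eq_terms \<Gamma> a b A"
  shows "eq_terms \<Gamma> b a A"
proof (rule eq_termsI[OF eq_terms_type[OF assms(2)]])
  fix \<rho> \<rho>' assume env: "env_rel \<Gamma> \<rho> \<rho>'"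
  note D = eq_termsD[OF assms(2) env_rel_sym[OF assms(1) env]]
  show "ty_rel A \<rho> (elt b \<rho>) (elt a \<rho>')"
    using admissible_sym[OF D(2,1)] D(3) by simp
qed

lemma eq_terms_trans:
  assumes "valid_ctx \<Gamma>" "eq_terms \<Gamma> a b A" "eq_terms \<Gamma> b c A"
  shows "eq_terms \<Gamma> a c A"
proof (rule eq_termsI[OF eq_terms_type[OF assms(2)]])
  fix \<rho> \<rho>' assume env: "env_rel \<Gamma> \<rho> \<rho>'"
  note D = eq_termsD[OF assms(2) env]
  show "ty_rel A \<rho> (elt a \<rho>) (elt c \<rho>')"
    using admissible_trans[OF D(2,1)] D(3) eq_termsD(1)[OF assms(3) env_rel_refl(2)[OF assms(1) env]]
    by simp
qed

lemma eq_terms_refl: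
  assumes "valid_ctx \<Gamma>" "eq_terms \<Gamma> a b A"
  shows "eq_terms \<Gamma> a a A" "eq_terms \<Gamma> b b A"
  using eq_terms_trans[OF assms(1)] eq_terms_sym[OF assms] assms(2) by blast+

lemma eq_terms_conv:
  assumes "valid_ctx \<Gamma>" "eq_terms \<Gamma> a b A" "eq_types \<Gamma> A B Col"
  shows "eq_terms \<Gamma> a b B"
proof (rule eq_termsI[OF eq_types_refl(2)[OF assms(1,3)]])
  fix \<rho> \<rho>' assume env: "env_rel \<Gamma> \<rho> \<rho>'"
  show "ty_rel B \<rho> (elt a \<rho>) (elt b \<rho>')"
    using eq_termsD[OF assms(2) env] eq_typesD(1)[OF assms(3) env_rel_refl(1)[OF assms(1) env]] by simp
qed

subsection \<open>Substitution\<close>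

text \<open>
  Related substitutions transport related assignments; with \<open>sb_sem\<close> this reduces the substitution
  rules to an instance of the validity of their first premise.
\<close>

lemma env_rel_subst:
  assumes "\<And>i. i < length \<Gamma> \<Longrightarrow> eq_terms \<Delta> (s i) (s' i) (sb_ty s (lift_ty (Suc i) (\<Gamma> ! i)))"
    and "env_rel \<Delta> \<rho> \<rho>'"
  shows "env_rel \<Gamma> (\<lambda>i. elt (s i) \<rho>) (\<lambda>i. elt (s' i) \<rho>')"
  using assms(1)[THEN eq_termsD(1), OF _ assms(2)] unfolding env_rel_def by (simp add: sb_sem)

lemma eq_types_subst:
  assumes "eq_types \<Gamma> A B k"
    and "\<And>i. i < length \<Gamma> \<Longrightarrow> eq_terms \<Delta> (s i) (s' i) (sb_ty s (lift_ty (Suc i) (\<Gamma> ! i)))"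
  shows "eq_types \<Delta> (sb_ty s A) (sb_ty s' B) k"
  using eq_typesD[OF assms(1) env_rel_subst[OF assms(2)]] by (intro eq_typesI) (simp_all add: sb_sem)

lemma eq_terms_subst:
  assumes "valid_ctx \<Delta>" "eq_terms \<Gamma> a b A"
    and s: "\<And>i. i < length \<Gamma> \<Longrightarrow> eq_terms \<Delta> (s i) (s' i) (sb_ty s (lift_ty (Suc i) (\<Gamma> ! i)))"
  shows "eq_terms \<Delta> (sb_tm s a) (sb_tm s' b) (sb_ty s A)"
proof -
  have "eq_types \<Delta> (sb_ty s A) (sb_ty s A) Col"
    using eq_types_subst[OF eq_terms_type[OF assms(2)] s] assms(1) eq_types_refl(1) by blast
  then show ?thesis
    using eq_termsD(1)[OF assms(2) env_rel_subst[OF s]] by (intro eq_termsI) (simp_all add: sb_sem elt_sb)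
qed

lemma eq_types_inst:
  assumes "eq_types (A # \<Gamma>) L L' k" "eq_terms \<Gamma> p p' A"
  shows "eq_types \<Gamma> (inst_ty 0 [p] L) (inst_ty 0 [p'] L') k"
  using eq_types_family[OF assms(1) _ eq_termsD(1)[OF assms(2)]]
  by (intro eq_typesI) (simp_all add: sem_simps)

lemma eq_types_inst_left:
  assumes "valid_ctx \<Gamma>" "eq_types (A # \<Gamma>) L L Col" "eq_terms \<Gamma> p p' A"
  shows "eq_types \<Gamma> (inst_ty 0 [p] L) (inst_ty 0 [p] L) Col"
  using eq_types_inst[OF assms(2) eq_terms_refl(1)[OF assms(1,3)]] .

lemma eq_terms_variable:
  assumes "valid_ctx \<Gamma>" "i < length \<Gamma>"
  shows "eq_terms \<Gamma> (Var i) (Var i) (lift_ty (Suc i) (\<Gamma> ! i))"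
proof -
  have "eq_types \<Gamma> (lift_ty (Suc i) (\<Gamma> ! i)) (lift_ty (Suc i) (\<Gamma> ! i)) Col"
    using assms
  proof (induction \<Gamma> arbitrary: i)
    case (Cons A \<Gamma>)
    have *: "eq_types \<Gamma> B B Col \<Longrightarrow> eq_types (A # \<Gamma>) (rn_ty Suc B) (rn_ty Suc B) Col" for B
      by (auto simp: eq_types_def env_rel_Cons rn_sem)
    show ?case
    proof (cases i)
      case 0
      then show ?thesis using * Cons.prems by simp
    next
      case (Suc j)
      then show ?thesis using *[OF Cons.IH[of j]] Cons.prems by (simp add: rn_rn)
    qed
  qed simp
  then show ?thesis using assms by (auto simp: eq_terms_def env_rel_def)
qed


section \<open>Soundness of the rules\<close>

subsection \<open>Propositions\<close>

lemma ty_rel_prop: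
  assumes "eq_types \<Gamma> \<phi> \<phi>' Prop" "env_rel \<Gamma> \<rho> \<rho>'"
  shows "ty_rel \<phi> \<rho> x y = holds \<phi> \<rho>"
  using eq_typesD(2)[OF assms] by (simp add: all_or_none_def)

text \<open>
  Proof terms are irrelevant: an inhabitant of a proposition only says that the proposition is true
  under every admissible assignment.
\<close>

lemma eq_terms_prop:
  "eq_types \<Gamma> \<phi> \<phi> Prop \<Longrightarrow> eq_terms \<Gamma> p q \<phi> \<longleftrightarrow> (\<forall>\<rho> \<rho>'. env_rel \<Gamma> \<rho> \<rho>' \<longrightarrow> holds \<phi> \<rho>)"
  using ty_rel_prop[of \<Gamma> \<phi> \<phi>] eq_types_Col[of \<Gamma> \<phi> \<phi> Prop] unfolding eq_terms_def by blast

lemma eq_terms_propI: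
  "eq_types \<Gamma> \<phi> \<phi> Prop \<Longrightarrow> (\<And>\<rho> \<rho>'. env_rel \<Gamma> \<rho> \<rho>' \<Longrightarrow> holds \<phi> \<rho>) \<Longrightarrow> eq_terms \<Gamma> p q \<phi>"
  using eq_terms_prop by blast

lemma all_or_none_const [simp]: "all_or_none (\<lambda>_ _. P)"
  by (simp add: all_or_none_def)

lemma of_kind_prop: "k \<in> {PropS, Prop} \<Longrightarrow> of_kind k E \<longleftrightarrow> all_or_none E"
  by auto

lemma holds_eq:
  "eq_types \<Gamma> \<phi> \<phi>' k \<Longrightarrow> env_rel \<Gamma> \<rho> \<rho>' \<Longrightarrow> holds \<phi> \<rho> = holds \<phi>' \<rho>'"
  using eq_typesD(1) by metis

lemma eq_types_propositional:
  assumes "k \<in> {PropS, Prop}"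
  shows "eq_types \<Gamma> BotP BotP k"
    and "eq_types \<Gamma> \<phi> \<phi>' k \<Longrightarrow> eq_types \<Gamma> \<psi> \<psi>' k \<Longrightarrow> eq_types \<Gamma> (AndP \<phi> \<psi>) (AndP \<phi>' \<psi>') k"
    and "eq_types \<Gamma> \<phi> \<phi>' k \<Longrightarrow> eq_types \<Gamma> \<psi> \<psi>' k \<Longrightarrow> eq_types \<Gamma> (OrP \<phi> \<psi>) (OrP \<phi>' \<psi>') k"
    and "eq_types \<Gamma> \<phi> \<phi>' k \<Longrightarrow> eq_types \<Gamma> \<psi> \<psi>' k \<Longrightarrow> eq_types \<Gamma> (ImpP \<phi> \<psi>) (ImpP \<phi>' \<psi>') k"
  using holds_eq[of \<Gamma> \<phi> \<phi>' k] holds_eq[of \<Gamma> \<psi> \<psi>' k]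
  by (auto intro!: eq_typesI simp: of_kind_prop[OF assms])

lemma eq_types_quantifiers:
  assumes "eq_types \<Gamma> A A' d" "eq_types (A # \<Gamma>) \<phi> \<phi>' k" "k \<in> {PropS, Prop}"
  shows "eq_types \<Gamma> (ExP A \<phi>) (ExP A' \<phi>') k" and "eq_types \<Gamma> (AllP A \<phi>) (AllP A' \<phi>') k"
proof -
  have *: "ty_rel A \<rho> = ty_rel A' \<rho>'" "ty_rel A \<rho> x x \<Longrightarrow> holds \<phi> (x \<bullet> \<rho>) = holds \<phi>' (x \<bullet> \<rho>')"
    if "env_rel \<Gamma> \<rho> \<rho>'" for \<rho> \<rho>' x
    using eq_typesD(1)[OF assms(1) that] eq_types_family(1)[OF assms(2) that, of x x] by simp_all
  show "eq_types \<Gamma> (ExP A \<phi>) (ExP A' \<phi>') k" "eq_types \<Gamma> (AllP A \<phi>) (AllP A' \<phi>') k"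
    using * by (intro eq_typesI; simp add: of_kind_prop[OF assms(3)]; metis)+
qed

lemma ty_rel_EqP: "ty_rel (EqP A a b) \<rho> = (\<lambda>_ _. ty_rel A \<rho> (elt a \<rho>) (elt b \<rho>))"
  by (simp add: elt_def)

lemma eq_types_EqP:
  assumes "eq_types \<Gamma> A A' d" "eq_terms \<Gamma> a a' A" "eq_terms \<Gamma> b b' A" "k \<in> {PropS, Prop}"
  shows "eq_types \<Gamma> (EqP A a b) (EqP A' a' b') k"
proof -
  have "ty_rel A \<rho> (elt a \<rho>) (elt b \<rho>) = ty_rel A' \<rho>' (elt a' \<rho>') (elt b' \<rho>')"
    if "env_rel \<Gamma> \<rho> \<rho>'" for \<rho> \<rho>'
    using eq_typesD[OF assms(1) that] eq_termsD[OF assms(2) that] eq_termsD[OF assms(3) that]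
    by (metis admissible_sym admissible_trans)
  then show ?thesis
    by (intro eq_typesI) (simp_all add: of_kind_prop[OF assms(4)] ty_rel_EqP del: ty_rel.simps)
qed

subsection \<open>Sets and collections\<close>

lemma realizer_determinedI:
  "(\<And>x y x' y'. E x y \<Longrightarrow> fst x = fst x' \<Longrightarrow> fst y = fst y' \<Longrightarrow> E x' y') \<Longrightarrow> realizer_determined E"
  unfolding realizer_determined_def by (metis fst_conv)

lemma realizer_determined_fst: "realizer_determined (\<lambda>x y. P (fst x) (fst y))"
  by (simp add: realizer_determined_def)

text \<open>
  Immediate from the clauses of \<open>ty_rel\<close>, which mention only the first components. For an indexed
  sum this requires an argument, given in \<open>of_kind_Sig\<close>.
\<close>

lemma realizer_determined_sets:
  "realizer_determined (ty_rel N0 \<rho>)" "realizer_determined (ty_rel N1 \<rho>)"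
  "realizer_determined (ty_rel (ListS A) \<rho>)" "realizer_determined (ty_rel (SumS A B) \<rho>)"
  "realizer_determined (ty_rel (PiS A B) \<rho>)" "realizer_determined (ty_rel (Quot A R) \<rho>)"
  unfolding ty_rel.simps by (rule realizer_determined_fst)+

lemma admissibleI:
  assumes "\<And>x y. E x y \<Longrightarrow> E y x" "\<And>x y z. E x y \<Longrightarrow> E y z \<Longrightarrow> E x z"
    "\<And>x y r. step (fst x) = Some r \<Longrightarrow> E x y = E (r, snd x) y"
  shows "admissible E"
  unfolding admissible_def using assms by (blast intro: sympI transpI)

lemma of_kind_N0: "of_kind Set (ty_rel N0 \<rho>)"
  using realizer_determined_sets(1) by (auto intro: admissibleI)

lemma of_kind_N1: "of_kind Set (ty_rel N1 \<rho>)"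
  using realizer_determined_sets(2) by (auto intro: admissibleI simp: evaluates_step)

lemma list_related_sym:
  "list_related E r r' \<Longrightarrow> (\<And>b b'. E b b' \<Longrightarrow> E b' b) \<Longrightarrow> list_related E r' r"
  by (induction rule: list_related.induct) (auto intro: list_related.intros)

lemma list_related_NilD: "list_related E r r' \<Longrightarrow> r \<Down> NilT \<Longrightarrow> r' \<Down> NilT"
  by (erule list_related.cases) (use evaluates_unique in blast)+

lemma list_related_ConsD:
  assumes "list_related E r r'" "r \<Down> ConsT l b"
  obtains l' b' where "r' \<Down> ConsT l' b'" "E b b'" "list_related E l l'"
proof -
  have "\<exists>l' b'. r' \<Down> ConsT l' b' \<and> E b b' \<and> list_related E l l'"
    using assms(1)
  proof cases
    case list_related_Nil
    then show ?thesis using evaluates_unique[OF assms(2)] by blast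
  next
    case list_related_Cons
    then show ?thesis using evaluates_unique[OF assms(2)] by blast
  qed
  then show thesis using that by blast
qed

lemma list_related_trans:
  "list_related E r r' \<Longrightarrow> list_related E r' r'' \<Longrightarrow> (\<And>b b' b''. E b b' \<Longrightarrow> E b' b'' \<Longrightarrow> E b b'')
    \<Longrightarrow> list_related E r r''"
proof (induction arbitrary: r'' rule: list_related.induct)
  case (list_related_Nil r r')
  then show ?case using list_related_NilD list_related.list_related_Nil by blast
next
  case (list_related_Cons r l b r' l' b')
  then obtain l'' b'' where "r'' \<Down> ConsT l'' b''" "E b' b''" "list_related E l' l''"
    by (meson list_related_ConsD)
  with list_related_Cons show ?case by (meson list_related.list_related_Cons)
qed

lemma list_related_step:
  "step r = Some s \<Longrightarrow> list_related E r r' = list_related E s r'"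
  unfolding list_related.simps[of E r] list_related.simps[of E s] by (simp add: evaluates_step)

lemma of_kind_ListS:
  assumes "admissible (ty_rel A \<rho>)"
  shows "of_kind Set (ty_rel (ListS A) \<rho>)"
proof -
  have "admissible (ty_rel (ListS A) \<rho>)"
    unfolding ty_rel.simps
    by (rule admissibleI)
       (simp_all add: list_related_step, (erule list_related_sym list_related_trans;
         blast intro: admissible_sym[OF assms] admissible_trans[OF assms])+)
  then show ?thesis by (simp add: realizer_determined_sets del: ty_rel.simps)
qed

lemma of_kind_SumS:
  assumes A: "admissible (ty_rel A \<rho>)" and B: "admissible (ty_rel B \<rho>)"
  shows "of_kind Set (ty_rel (SumS A B) \<rho>)"
proof -
  have "admissible (ty_rel (SumS A B) \<rho>)"
    unfolding ty_rel.simps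
  proof (rule admissibleI, goal_cases)
    case (1 x y)
    then show ?case using admissible_sym[OF A] admissible_sym[OF B] by blast
  next
    case (2 x y z)
    then show ?case
      using admissible_trans[OF A] admissible_trans[OF B] evaluates_unique[of "fst y"]
      by (metis tm.distinct tm.inject(6,7))
  next
    case (3 x y r)
    then show ?case by (simp add: evaluates_step)
  qed
  then show ?thesis by (simp add: realizer_determined_sets del: ty_rel.simps)
qed

text \<open>
  One lemma for both kinds of indexed sum. If the components are sets, then changing the value of a
  pair changes the values of its components, which their relations ignore; but it also moves the
  index of the family \<open>B\<close>, which is why invariance of \<open>B\<close> along \<open>A\<close> is used there.
\<close>

lemma of_kind_Sig:
  assumes k: "k \<in> {Set, Col}" and A: "of_kind k (ty_rel A \<rho>)"
    and B: "\<And>x y. ty_rel A \<rho> x y \<Longrightarrow> ty_rel B (x \<bullet> \<rho>) = ty_rel B (y \<bullet> \<rho>)"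
      "\<And>x y. ty_rel A \<rho> x y \<Longrightarrow> of_kind k (ty_rel B (x \<bullet> \<rho>))"
  shows "of_kind k (ty_rel (Sig A B) \<rho>)"
proof -
  note A' = of_kind_admissible[OF A] and B' = of_kind_admissible[OF B(2)]
  have adm: "admissible (ty_rel (Sig A B) \<rho>)"
  proof (rule admissibleI)
    fix x y assume "ty_rel (Sig A B) \<rho> x y"
    then obtain a b a' b' where "fst x \<Down> PairT a b" "fst y \<Down> PairT a' b'"
      and a: "ty_rel A \<rho> (a, val_fst (snd x)) (a', val_fst (snd y))"
      and b: "ty_rel B ((a, val_fst (snd x)) \<bullet> \<rho>) (b, val_snd (snd x)) (b', val_snd (snd y))"
      by auto
    moreover have "ty_rel A \<rho> (a', val_fst (snd y)) (a, val_fst (snd x))"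
      using a A' admissible_sym by blast
    moreover have "ty_rel B ((a', val_fst (snd y)) \<bullet> \<rho>) (b', val_snd (snd y)) (b, val_snd (snd x))"
      using admissible_sym[OF B'[OF a] b] B(1)[OF a] by simp
    ultimately show "ty_rel (Sig A B) \<rho> y x" by auto
  next
    fix x y z assume "ty_rel (Sig A B) \<rho> x y" "ty_rel (Sig A B) \<rho> y z"
    then obtain a b a' b' a'' b'' where ev: "fst x \<Down> PairT a b" "fst y \<Down> PairT a' b'" "fst z \<Down> PairT a'' b''"
      and a: "ty_rel A \<rho> (a, val_fst (snd x)) (a', val_fst (snd y))"
        "ty_rel A \<rho> (a', val_fst (snd y)) (a'', val_fst (snd z))"
      and b: "ty_rel B ((a, val_fst (snd x)) \<bullet> \<rho>) (b, val_snd (snd x)) (b', val_snd (snd y))"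
        "ty_rel B ((a', val_fst (snd y)) \<bullet> \<rho>) (b', val_snd (snd y)) (b'', val_snd (snd z))"
      by (auto dest: evaluates_unique)
    have "ty_rel A \<rho> (a, val_fst (snd x)) (a'', val_fst (snd z))"
      using a A' admissible_trans by blast
    moreover have "ty_rel B ((a, val_fst (snd x)) \<bullet> \<rho>) (b, val_snd (snd x)) (b'', val_snd (snd z))"
      using admissible_trans[OF B'[OF a(1)] b(1)] b(2) B(1)[OF a(1)] by simp
    ultimately show "ty_rel (Sig A B) \<rho> x z" using ev by auto
  qed (simp add: evaluates_step)
  moreover have "realizer_determined (ty_rel (Sig A B) \<rho>)" if "k = Set"
  proof (rule realizer_determinedI)
    fix x y x' y' :: elt assume xy: "ty_rel (Sig A B) \<rho> x y" "fst x = fst x'" "fst y = fst y'"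
    then obtain a b a' b' where ev: "fst x' \<Down> PairT a b" "fst y' \<Down> PairT a' b'"
      and a: "ty_rel A \<rho> (a, val_fst (snd x)) (a', val_fst (snd y))"
      and b: "ty_rel B ((a, val_fst (snd x)) \<bullet> \<rho>) (b, val_snd (snd x)) (b', val_snd (snd y))"
      by auto
    have rd: "realizer_determined (ty_rel A \<rho>)" "realizer_determined (ty_rel B ((a, val_fst (snd x)) \<bullet> \<rho>))"
      using A B(2)[OF a] that by auto
    have a1: "ty_rel A \<rho> (a, val_fst (snd x')) (a', val_fst (snd y'))"
      by (rule realizer_determinedD[OF rd(1) a]) auto
    have a2: "ty_rel A \<rho> (a, val_fst (snd x)) (a, val_fst (snd x'))"
      by (rule realizer_determinedD[OF rd(1) admissible_refl(1)[OF A' a]]) auto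
    have "ty_rel B ((a, val_fst (snd x)) \<bullet> \<rho>) (b, val_snd (snd x')) (b', val_snd (snd y'))"
      by (rule realizer_determinedD[OF rd(2) b]) auto
    then show "ty_rel (Sig A B) \<rho> x' y'"
      using ev a1 B(1)[OF a2] by auto
  qed
  ultimately show ?thesis using k by auto
qed

text \<open>
  The relation asks what a realizer does when applied, so closure under expansion of the function is
  inherited from the relations of the values of the function.
\<close>

lemma of_kind_PiS:
  assumes A: "admissible (ty_rel A \<rho>)"
    and B: "\<And>x y. ty_rel A \<rho> x y \<Longrightarrow> ty_rel B (x \<bullet> \<rho>) = ty_rel B (y \<bullet> \<rho>)"
      "\<And>x y. ty_rel A \<rho> x y \<Longrightarrow> admissible (ty_rel B (x \<bullet> \<rho>))"
  shows "of_kind Set (ty_rel (PiS A B) \<rho>)"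
proof -
  have "admissible (ty_rel (PiS A B) \<rho>)"
  proof (rule admissibleI)
    fix x y assume xy: "ty_rel (PiS A B) \<rho> x y"
    show "ty_rel (PiS A B) \<rho> y x"
      unfolding ty_rel.simps
    proof (intro allI impI)
      fix a a' assume a: "ty_rel A \<rho> a a'"
      have "ty_rel B (a' \<bullet> \<rho>) (App (fst x) (fst a'), VNone) (App (fst y) (fst a), VNone)"
        using xy admissible_sym[OF A a] by auto
      then show "ty_rel B (a \<bullet> \<rho>) (App (fst y) (fst a), VNone) (App (fst x) (fst a'), VNone)"
        using B[OF a] admissible_sym by metis
    qed
  next
    fix x y z assume xyz: "ty_rel (PiS A B) \<rho> x y" "ty_rel (PiS A B) \<rho> y z"
    show "ty_rel (PiS A B) \<rho> x z"
      unfolding ty_rel.simps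
    proof (intro allI impI)
      fix a a' assume a: "ty_rel A \<rho> a a'"
      have "ty_rel B (a \<bullet> \<rho>) (App (fst x) (fst a), VNone) (App (fst y) (fst a), VNone)"
        "ty_rel B (a \<bullet> \<rho>) (App (fst y) (fst a), VNone) (App (fst z) (fst a'), VNone)"
        using xyz admissible_refl(1)[OF A a] a by auto
      then show "ty_rel B (a \<bullet> \<rho>) (App (fst x) (fst a), VNone) (App (fst z) (fst a'), VNone)"
        using B(2)[OF a] admissible_trans by metis
    qed
  next
    fix x y :: elt and r assume r: "step (fst x) = Some r"
    have "ty_rel B (a \<bullet> \<rho>) (App (fst x) (fst a), VNone) z = ty_rel B (a \<bullet> \<rho>) (App r (fst a), VNone) z"
      if "ty_rel A \<rho> a a'" for a a' z
      using B(2)[OF that] step_cong(5)[OF r, of "fst a"] unfolding admissible_def by (metis fst_conv snd_conv)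
    then show "ty_rel (PiS A B) \<rho> x y = ty_rel (PiS A B) \<rho> (r, snd x) y"
      unfolding ty_rel.simps fst_conv by blast
  qed
  then show ?thesis by (simp add: realizer_determined_sets del: ty_rel.simps)
qed

lemma of_kind_P1: "of_kind Col (ty_rel P1 \<rho>)"
  by (auto intro: admissibleI)

lemma of_kind_Powr:
  assumes A: "admissible (ty_rel A \<rho>)"
  shows "of_kind Col (ty_rel (Powr A) \<rho>)"
  unfolding of_kind.simps ty_rel.simps
proof (rule admissibleI, goal_cases)
  case (1 x y)
  then show ?case using admissible_sym[OF A] by blast
next
  case (2 x y z)
  show ?case
  proof (intro allI impI)
    fix a a' assume "ty_rel A \<rho> a a'"
    then show "val_fun (snd x) (fst a) = val_fun (snd z) (fst a')"
      using 2 admissible_refl(1)[OF A] by metis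
  qed
qed simp

lemma eq_types_ListS:
  assumes "eq_types \<Gamma> A A' Set"
  shows "eq_types \<Gamma> (ListS A) (ListS A') Set"
  using eq_typesD[OF assms] of_kind_ListS by (intro eq_typesI) auto

lemma eq_types_SumS:
  assumes "eq_types \<Gamma> A A' Set" "eq_types \<Gamma> B B' Set"
  shows "eq_types \<Gamma> (SumS A B) (SumS A' B') Set"
  using eq_typesD[OF assms(1)] eq_typesD[OF assms(2)] of_kind_SumS by (intro eq_typesI) auto

lemma eq_types_Sig:
  assumes ctx: "valid_ctx \<Gamma>" and A: "eq_types \<Gamma> A A' k" and B: "eq_types (A # \<Gamma>) B B' k" and k: "k \<in> {Set, Col}"
  shows "eq_types \<Gamma> (Sig A B) (Sig A' B') k"
proof (rule eq_typesI)
  fix \<rho> \<rho>' assume env: "env_rel \<Gamma> \<rho> \<rho>'"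
  have r: "ty_rel A \<rho> x x" if "ty_rel A \<rho> x y" for x y
    using that admissible_refl(1)[OF eq_typesD(3)[OF A env]] by blast
  have "ty_rel B (x \<bullet> \<rho>) = ty_rel B' (x \<bullet> \<rho>')" if "ty_rel A \<rho> x y" for x y
    using eq_types_family(1)[OF B env r[OF that]] .
  then show "ty_rel (Sig A B) \<rho> = ty_rel (Sig A' B') \<rho>'"
    unfolding ty_rel.simps eq_typesD(1)[OF A env, symmetric] by (intro ext) metis
  have B2: "eq_types (A # \<Gamma>) B B k"
    using eq_types_refl(1)[OF _ B] ctx eq_types_Col[OF eq_types_refl(1)[OF ctx A]] by simp
  show "of_kind k (ty_rel (Sig A B) \<rho>)"
    using eq_typesD(2)[OF A env] eq_types_family[OF B2 env_rel_refl(1)[OF ctx env]]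
    by (intro of_kind_Sig[OF k]) auto
qed

lemma eq_types_PiS:
  assumes ctx: "valid_ctx \<Gamma>" and A: "eq_types \<Gamma> A A' Set" and B: "eq_types (A # \<Gamma>) B B' Set"
  shows "eq_types \<Gamma> (PiS A B) (PiS A' B') Set"
proof (rule eq_typesI)
  fix \<rho> \<rho>' assume env: "env_rel \<Gamma> \<rho> \<rho>'"
  have r: "ty_rel A \<rho> x x" if "ty_rel A \<rho> x y" for x y
    using that admissible_refl(1)[OF eq_typesD(3)[OF A env]] by blast
  have "ty_rel B (x \<bullet> \<rho>) = ty_rel B' (x \<bullet> \<rho>')" if "ty_rel A \<rho> x y" for x y
    using eq_types_family(1)[OF B env r[OF that]] .
  then show "ty_rel (PiS A B) \<rho> = ty_rel (PiS A' B') \<rho>'"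
    unfolding ty_rel.simps eq_typesD(1)[OF A env, symmetric] by (intro ext) metis
  have B2: "eq_types (A # \<Gamma>) B B Set"
    using eq_types_refl(1)[OF _ B] ctx eq_types_Col[OF eq_types_refl(1)[OF ctx A]] by simp
  show "of_kind Set (ty_rel (PiS A B) \<rho>)"
    using eq_typesD(3)[OF A env] eq_types_family(1,3)[OF B2 env_rel_refl(1)[OF ctx env]]
    by (intro of_kind_PiS) auto
qed

lemma eq_types_Powr:
  assumes "eq_types \<Gamma> A A' Set"
  shows "eq_types \<Gamma> (Powr A) (Powr A') Col"
  using eq_typesD[OF assms] of_kind_Powr by (intro eq_typesI) auto

lemma admissible_expand:
  "E x' y' \<Longrightarrow> admissible E \<Longrightarrow> x \<leadsto> x' \<Longrightarrow> y \<leadsto> y' \<Longrightarrow> E x y"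
  using admissible_reduces[of E x x' y y'] by simp

lemma admissible_expand_left: "E x' y \<Longrightarrow> admissible E \<Longrightarrow> x \<leadsto> x' \<Longrightarrow> E x y"
  using admissible_expand[of E x' y x y] by simp

text \<open>
  Unfolds the de Bruijn encoding: the assignment \<open>y \<bullet> x \<bullet> \<rho>\<close> evaluates \<open>R(x, y)\<close>.
\<close>

lemma holds_EquivP: "holds (EquivP A R) \<rho> \<longleftrightarrow>
    (\<forall>x. ty_rel A \<rho> x x \<longrightarrow> holds R (x \<bullet> x \<bullet> \<rho>)) \<and>
    (\<forall>x y. ty_rel A \<rho> x x \<longrightarrow> ty_rel A \<rho> y y \<longrightarrow> holds R (y \<bullet> x \<bullet> \<rho>) \<longrightarrow> holds R (x \<bullet> y \<bullet> \<rho>)) \<and>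
    (\<forall>x y z. ty_rel A \<rho> x x \<longrightarrow> ty_rel A \<rho> y y \<longrightarrow> ty_rel A \<rho> z z \<longrightarrow>
      holds R (y \<bullet> x \<bullet> \<rho>) \<longrightarrow> holds R (z \<bullet> y \<bullet> \<rho>) \<longrightarrow> holds R (z \<bullet> x \<bullet> \<rho>))"
  unfolding EquivP_def by (simp add: sem_simps)

lemma of_kind_Quot:
  assumes equiv: "holds (EquivP A R) \<rho>"
  shows "of_kind Set (ty_rel (Quot A R) \<rho>)"
proof -
  note E = equiv[unfolded holds_EquivP]
  have "admissible (ty_rel (Quot A R) \<rho>)"
    unfolding ty_rel.simps
  proof (rule admissibleI, goal_cases)
    case (1 x y)
    then show ?case using E by blast
  next
    case (2 x y z)
    then obtain a a' b b' where "fst x \<Down> Cls a" "fst y \<Down> Cls a'" "fst y \<Down> Cls b" "fst z \<Down> Cls b'"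
      "ty_rel A \<rho> (a, VNone) (a, VNone)" "ty_rel A \<rho> (a', VNone) (a', VNone)" "ty_rel A \<rho> (b', VNone) (b', VNone)"
      "holds R ((a', VNone) \<bullet> (a, VNone) \<bullet> \<rho>)" "holds R ((b', VNone) \<bullet> (b, VNone) \<bullet> \<rho>)"
      by blast
    moreover from this have "a' = b" using evaluates_unique by blast
    ultimately show ?case using E by blast
  next
    case (3 x y r)
    then show ?case by (simp add: evaluates_step)
  qed
  then show ?thesis by (simp add: realizer_determined_sets del: ty_rel.simps)
qed

lemma eq_types_Quot:
  assumes A: "eq_types \<Gamma> A A' Set" and R: "eq_types (rn_ty Suc A # A # \<Gamma>) R R' PropS"
    and equiv: "\<And>\<rho> \<rho>'. env_rel \<Gamma> \<rho> \<rho>' \<Longrightarrow> holds (EquivP A R) \<rho>"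
  shows "eq_types \<Gamma> (Quot A R) (Quot A' R') Set"
proof (rule eq_typesI)
  fix \<rho> \<rho>' assume env: "env_rel \<Gamma> \<rho> \<rho>'"
  have "holds R (y \<bullet> x \<bullet> \<rho>) = holds R' (y \<bullet> x \<bullet> \<rho>')" if "ty_rel A \<rho> x x" "ty_rel A \<rho> y y" for x y
    by (rule holds_eq[OF R]) (simp add: env that rn_sem)
  then show "ty_rel (Quot A R) \<rho> = ty_rel (Quot A' R') \<rho>'"
    unfolding ty_rel.simps eq_typesD(1)[OF A env, symmetric] by (intro ext) metis
qed (rule of_kind_Quot[OF equiv])

subsection \<open>Computation of eliminators, the empty set and the singleton\<close>

abbreviation realizer :: "tm \<Rightarrow> env \<Rightarrow> tm" where
  "realizer t \<rho> \<equiv> sb_tm (\<lambda>i. fst (\<rho> i)) t"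

text \<open>
  In a set, values may be exchanged at will. This is used to pass between the meaning of a term and
  the element with value \<open>VNone\<close> that an eliminator produces from the same realizer.
\<close>

lemma set_realizers:
  assumes "eq_types \<Gamma> A A' Set" "env_rel \<Gamma> \<rho> \<rho>'" "ty_rel A \<rho> x y" "fst x = fst x'" "fst y = fst y'"
  shows "ty_rel A \<rho> x' y'"
proof -
  have "realizer_determined (ty_rel A \<rho>)"
    using eq_typesD(2)[OF assms(1,2)] by simp
  then show ?thesis
    using realizer_determinedD assms(3-5) by blast
qed

text \<open>
  The next four lemmas say that an eliminator reduces to the branch chosen by its principal
  argument, with an unchanged value; by \<open>admissible_expand\<close> both then have the same standing in
  every collection.
\<close>

lemma elt_El1_reduces: "realizer p \<rho> \<Down> Star \<Longrightarrow> elt (El1 p c) \<rho> \<leadsto> elt c \<rho>"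
  by (simp add: reduces_def elt_def El1_steps)

lemma elt_ElSum_reduces:
  "realizer p \<rho> \<Down> InlT a \<Longrightarrow> elt (ElSum p d e) \<rho> \<leadsto> elt d ((a, VNone) \<bullet> \<rho>)"
  "realizer p \<rho> \<Down> InrT b \<Longrightarrow> elt (ElSum p d e) \<rho> \<leadsto> elt e ((b, VNone) \<bullet> \<rho>)"
  using ElSum_steps[where d="sb_tm (up_sb (\<lambda>i. fst (\<rho> i))) d"
      and e="sb_tm (up_sb (\<lambda>i. fst (\<rho> i))) e" and p="realizer p \<rho>"]
  by (auto simp: reduces_def elt_def fst_push inst_up)

lemma elt_ElSig_reduces:
  assumes "realizer p \<rho> \<Down> PairT a b"
  shows "elt (ElSig p m) \<rho> \<leadsto> elt m ((b, val_snd (tm_val p \<rho>)) \<bullet> (a, val_fst (tm_val p \<rho>)) \<bullet> \<rho>)"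
  using ElSig_steps[OF assms, of "sb_tm (up_sb (up_sb (\<lambda>i. fst (\<rho> i)))) m"] assms
  by (simp add: reduces_def elt_def fst_push inst_up)

lemma elt_ElQ_reduces:
  assumes "realizer p \<rho> \<Down> Cls a"
  shows "elt (ElQ p l) \<rho> \<leadsto> elt l ((a, VNone) \<bullet> \<rho>)"
  using ElQ_steps[OF assms, of "sb_tm (up_sb (\<lambda>i. fst (\<rho> i))) l"] assms
  by (simp add: reduces_def elt_def fst_push inst_up)

text \<open>
  The meaning of \<open>ElList p a c\<close> as a function of the realizer \<open>r\<close> of \<open>p\<close>. Lists are
  recursive, so the tail of \<open>r\<close> has to be fed back, and it need not be the realizer of a subterm of
  \<open>p\<close>.
\<close>

definition list_fold :: "tm \<Rightarrow> tm \<Rightarrow> env \<Rightarrow> tm \<Rightarrow> elt" where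
  "list_fold a c \<rho> r =
    (let f = (\<lambda>r. ElList r (realizer a \<rho>) (sb_tm (up_sb (up_sb (up_sb (\<lambda>i. fst (\<rho> i))))) c))
     in (f r, THE v. list_rec (tm_val a \<rho>)
          (\<lambda>l b v. tm_val c ((f l, v) \<bullet> (b, VNone) \<bullet> (l, VNone) \<bullet> \<rho>)) r v))"

lemma elt_ElList: "elt (ElList p a c) \<rho> = list_fold a c \<rho> (realizer p \<rho>)"
  by (simp add: elt_def list_fold_def)

lemma list_rec_unique: "list_rec z f r v \<Longrightarrow> list_rec z f r v' \<Longrightarrow> v = v'"
proof (induction arbitrary: v' rule: list_rec.induct)
  case (list_rec_Nil r)
  from list_rec_Nil(2,1) show ?case
    by cases (use evaluates_unique in blast)+
next
  case (list_rec_Cons r l b v)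
  from list_rec_Cons(4,1) show ?case
  proof cases
    case list_rec_Nil
    then show ?thesis using list_rec_Cons(1) evaluates_unique by blast
  next
    case (list_rec_Cons l' b' w)
    have "ConsT l b = ConsT l' b'"
      using list_rec_Cons(2) \<open>r \<Down> ConsT l b\<close> evaluates_unique by blast
    with list_rec_Cons list_rec_Cons.IH show ?thesis by auto
  qed
qed

lemma list_rec_exists: "list_related E r r' \<Longrightarrow> \<exists>v. list_rec z f r v"
  by (induction rule: list_related.induct) (blast intro: list_rec.intros)+

lemma list_fold_Nil: "r \<Down> NilT \<Longrightarrow> list_fold a c \<rho> r \<leadsto> elt a \<rho>"
  unfolding reduces_def list_fold_def Let_def elt_def
  by (auto simp: ElList_steps intro!: the_equality list_rec_Nil intro: list_rec_unique)

lemma list_fold_Cons: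
  assumes "r \<Down> ConsT l b" "list_related E l l'"
  shows "list_fold a c \<rho> r \<leadsto> elt c (list_fold a c \<rho> l \<bullet> (b, VNone) \<bullet> (l, VNone) \<bullet> \<rho>)"
proof -
  let ?c = "sb_tm (up_sb (up_sb (up_sb (\<lambda>i. fst (\<rho> i))))) c"
  let ?z = "tm_val a \<rho>"
  let ?f = "\<lambda>l b v. tm_val c ((ElList l (realizer a \<rho>) ?c, v) \<bullet> (b, VNone) \<bullet> (l, VNone) \<bullet> \<rho>)"
  obtain v where v: "list_rec ?z ?f l v"
    using list_rec_exists[OF assms(2)] by blast
  have "(THE v. list_rec ?z ?f l v) = v" "(THE v. list_rec ?z ?f r v) = ?f l b v"
    using v list_rec_Cons[OF assms(1) v] list_rec_unique by (blast intro!: the_equality)+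
  moreover have "ElList r (realizer a \<rho>) ?c \<longrightarrow>*
      sb_tm (ElList l (realizer a \<rho>) ?c \<bullet> b \<bullet> l \<bullet> (\<lambda>i. fst (\<rho> i))) c"
    using ElList_steps(2)[OF assms(1), of "realizer a \<rho>" ?c] by (simp add: inst_up)
  ultimately show ?thesis
    by (simp add: reduces_def list_fold_def elt_def fst_push)
qed

lemma eq_terms_prop_holds:
  assumes "eq_terms \<Gamma> p q \<phi>" "eq_types \<Gamma> \<phi> \<phi> Prop" "env_rel \<Gamma> \<rho> \<rho>'"
  shows "holds \<phi> \<rho>"
  using assms eq_terms_prop by blast

text \<open>
  Vacuous: the hypothesis says that no assignment satisfies the context.
\<close>

lemma eq_terms_El0:
  assumes "eq_terms \<Gamma> p p' N0"
  shows "eq_terms \<Gamma> (El0 p) (El0 p') A"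
  using eq_termsD(1)[OF assms] by (intro eq_termsI eq_typesI) auto

lemma eq_terms_Star: "eq_terms \<Gamma> Star Star N1"
  using of_kind_N1 by (intro eq_termsI eq_typesI) (auto simp: elt_def)

lemma eq_types_N0: "eq_types \<Gamma> N0 N0 Set" and eq_types_N1: "eq_types \<Gamma> N1 N1 Set"
  using of_kind_N0 of_kind_N1 by (intro eq_typesI; simp)+

lemma eq_terms_El1:
  assumes ctx: "valid_ctx \<Gamma>" and L: "eq_types (N1 # \<Gamma>) L L Col"
    and p: "eq_terms \<Gamma> p p' N1" and c: "eq_terms \<Gamma> c c' (inst_ty 0 [Star] L)"
  shows "eq_terms \<Gamma> (El1 p c) (El1 p' c') (inst_ty 0 [p] L)"
proof (rule eq_termsI[OF eq_types_inst_left[OF ctx L p]])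
  fix \<rho> \<rho>' assume env: "env_rel \<Gamma> \<rho> \<rho>'"
  have p': "realizer p \<rho> \<Down> Star" "realizer p' \<rho>' \<Down> Star"
    using eq_termsD(1)[OF p env] by (simp_all add: elt_def)
  have "ty_rel L (elt p \<rho> \<bullet> \<rho>) = ty_rel L (elt Star \<rho> \<bullet> \<rho>)" "admissible (ty_rel L (elt p \<rho> \<bullet> \<rho>))"
    using p' eq_types_family[OF L env_rel_refl(1)[OF ctx env], of "elt p \<rho>" "elt Star \<rho>"]
    by (simp_all add: elt_def)
  then show "ty_rel (inst_ty 0 [p] L) \<rho> (elt (El1 p c) \<rho>) (elt (El1 p' c') \<rho>')"
    using admissible_expand[OF _ _ elt_El1_reduces[OF p'(1)] elt_El1_reduces[OF p'(2)]] eq_termsD(1)[OF c env]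
    by (simp add: sem_simps)
qed

text \<open>
  The \<beta>-equalities of \<open>El1\<close> at \<open>Star\<close>, and below of \<open>ElList\<close> at \<open>NilT\<close>, have a right-hand side that
  is a subterm of the left-hand side, so the motive of the elimination does not matter.
\<close>

lemma eq_terms_El1_Star:
  assumes ctx: "valid_ctx \<Gamma>" and c: "eq_terms \<Gamma> c c' A"
  shows "eq_terms \<Gamma> (El1 Star c) c' A"
proof (rule eq_termsI[OF eq_terms_type[OF c]])
  fix \<rho> \<rho>' assume env: "env_rel \<Gamma> \<rho> \<rho>'"
  have "elt (El1 Star c) \<rho> \<leadsto> elt c \<rho>" by (rule elt_El1_reduces) simp
  then show "ty_rel A \<rho> (elt (El1 Star c) \<rho>) (elt c' \<rho>')"
    using admissible_expand_left[OF eq_termsD(1,2)[OF c env]] by blast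
qed

subsection \<open>Lists\<close>

lemma eq_terms_NilT:
  assumes "eq_types \<Gamma> A A Set"
  shows "eq_terms \<Gamma> NilT NilT (ListS A)"
  using eq_types_Col[OF eq_types_ListS[OF assms]]
  by (intro eq_termsI) (simp_all add: elt_def list_related_Nil)

lemma list_related_ConsT:
  "E a a' \<Longrightarrow> list_related E l l' \<Longrightarrow> list_related E (ConsT l a) (ConsT l' a')"
  by (rule list_related_Cons) auto

lemma eq_terms_ConsT:
  assumes A: "eq_types \<Gamma> A A Set" and l: "eq_terms \<Gamma> l l' (ListS A)" and a: "eq_terms \<Gamma> a a' A"
  shows "eq_terms \<Gamma> (ConsT l a) (ConsT l' a') (ListS A)"
proof (rule eq_termsI[OF eq_terms_type[OF l]])
  fix \<rho> \<rho>' assume env: "env_rel \<Gamma> \<rho> \<rho>'"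
  have "ty_rel A \<rho> (realizer a \<rho>, VNone) (realizer a' \<rho>', VNone)"
    by (rule set_realizers[OF A env eq_termsD(1)[OF a env]]) (simp_all add: elt_def)
  then show "ty_rel (ListS A) \<rho> (elt (ConsT l a) \<rho>) (elt (ConsT l' a') \<rho>')"
    using eq_termsD(1)[OF l env] by (simp add: elt_def list_related_ConsT)
qed

text \<open>
  The induction behind list elimination. It runs over the proof that two realizers represent equal
  lists; the result is stated in the fibre of \<open>L\<close> over the realizer itself and transferred to the
  fibre over its head form by invariance of \<open>L\<close>.
\<close>

lemma list_fold_related:
  assumes ctx: "valid_ctx \<Gamma>" and A: "eq_types \<Gamma> A A Set" and L: "eq_types (ListS A # \<Gamma>) L L Col"
    and a: "eq_terms \<Gamma> a a' (inst_ty 0 [NilT] L)"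
    and c: "eq_terms (inst_ty 2 [Var 1] L # rn_ty Suc A # ListS A # \<Gamma>) c c' (inst_ty 3 [ConsT (Var 2) (Var 1)] L)"
    and env: "env_rel \<Gamma> \<rho> \<rho>'"
    and r: "list_related (\<lambda>b b'. ty_rel A \<rho> (b, VNone) (b', VNone)) r r'"
  shows "ty_rel L ((r, VNone) \<bullet> \<rho>) (list_fold a c \<rho> r) (list_fold a' c' \<rho>' r')"
  using r
proof (induction rule: list_related.induct)
  have adm: "admissible (ty_rel (ListS A) \<rho>)"
    using eq_typesD(3)[OF eq_types_ListS[OF A] env] .
  have L_cong: "ty_rel L (x \<bullet> \<rho>) = ty_rel L (y \<bullet> \<rho>)" "admissible (ty_rel L (x \<bullet> \<rho>))"
    if "ty_rel (ListS A) \<rho> x y" for x y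
    using eq_types_family[OF L env_rel_refl(1)[OF ctx env] that] by simp_all
  {
    case (list_related_Nil r r')
    have "ty_rel (ListS A) \<rho> (r, VNone) (NilT, VNone)"
      using list_related_Nil by (auto intro: list_related.list_related_Nil)
    moreover have "ty_rel L ((NilT, VNone) \<bullet> \<rho>) (elt a \<rho>) (elt a' \<rho>')"
      using eq_termsD(1)[OF a env] by (simp add: sem_simps elt_def[of NilT])
    ultimately show ?case
      using admissible_expand[OF _ _ list_fold_Nil list_fold_Nil] L_cong list_related_Nil by metis
  next
    case (list_related_Cons r l b r' l' b')
    have l: "ty_rel (ListS A) \<rho> (l, VNone) (l', VNone)"
      using list_related_Cons by simp
    have b: "ty_rel A \<rho> (b, VNone) (b', VNone)"
      using list_related_Cons by simp
    have rel': "list_related (\<lambda>b b'. ty_rel A \<rho> (b, VNone) (b', VNone)) l' l"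
      using admissible_sym[OF adm l] by simp
    have cons: "ty_rel (ListS A) \<rho> (r, VNone) (ConsT l b, VNone)"
      unfolding ty_rel.simps fst_conv
      by (rule list_related.list_related_Cons[OF list_related_Cons(1), of "ConsT l b" l b])
         (use admissible_refl(1)[OF adm l] admissible_refl(1)[OF eq_typesD(3)[OF A env] b] in simp_all)
    let ?\<rho> = "list_fold a c \<rho> l \<bullet> (b, VNone) \<bullet> (l, VNone) \<bullet> \<rho>"
    let ?\<rho>' = "list_fold a' c' \<rho>' l' \<bullet> (b', VNone) \<bullet> (l', VNone) \<bullet> \<rho>'"
    have E: "env_rel (inst_ty 2 [Var 1] L # rn_ty Suc A # ListS A # \<Gamma>) ?\<rho> ?\<rho>'"
      using env l b list_related_Cons.IH by (simp add: sem_simps)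
    have "ty_rel L (elt (ConsT (Var 2) (Var 1)) ?\<rho> \<bullet> \<rho>) (elt c ?\<rho>) (elt c' ?\<rho>')"
      using eq_termsD(1)[OF c E] by (simp add: sem_simps)
    moreover have "elt (ConsT (Var 2) (Var 1)) ?\<rho> = (ConsT l b, VNone)"
      by (simp add: elt_def numeral_2_eq_2)
    moreover have "list_fold a c \<rho> r \<leadsto> elt c ?\<rho>" "list_fold a' c' \<rho>' r' \<leadsto> elt c' ?\<rho>'"
      using list_fold_Cons list_related_Cons rel' by blast+
    ultimately show ?case
      using L_cong[OF cons] admissible_expand by metis
  }
qed

lemma eq_terms_ElList:
  assumes ctx: "valid_ctx \<Gamma>" and A: "eq_types \<Gamma> A A Set" and L: "eq_types (ListS A # \<Gamma>) L L Col"
    and p: "eq_terms \<Gamma> p p' (ListS A)"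
    and a: "eq_terms \<Gamma> a a' (inst_ty 0 [NilT] L)"
    and c: "eq_terms (inst_ty 2 [Var 1] L # rn_ty Suc A # ListS A # \<Gamma>) c c' (inst_ty 3 [ConsT (Var 2) (Var 1)] L)"
  shows "eq_terms \<Gamma> (ElList p a c) (ElList p' a' c') (inst_ty 0 [p] L)"
proof (rule eq_termsI[OF eq_types_inst_left[OF ctx L p]])
  fix \<rho> \<rho>' assume env: "env_rel \<Gamma> \<rho> \<rho>'"
  note P = eq_termsD(1)[OF p env]
  have "ty_rel (ListS A) \<rho> (elt p \<rho>) (realizer p \<rho>, VNone)"
    using admissible_refl(1)[OF eq_termsD(2)[OF p env] P] by (simp add: elt_def)
  then have "ty_rel L (elt p \<rho> \<bullet> \<rho>) = ty_rel L ((realizer p \<rho>, VNone) \<bullet> \<rho>)"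
    by (rule eq_types_family(1)[OF L env_rel_refl(1)[OF ctx env]])
  moreover have "ty_rel L ((realizer p \<rho>, VNone) \<bullet> \<rho>)
      (list_fold a c \<rho> (realizer p \<rho>)) (list_fold a' c' \<rho>' (realizer p' \<rho>'))"
    using P by (intro list_fold_related[OF ctx A L a c env]) (simp add: elt_def)
  ultimately show "ty_rel (inst_ty 0 [p] L) \<rho> (elt (ElList p a c) \<rho>) (elt (ElList p' a' c') \<rho>')"
    by (simp add: sem_simps elt_ElList)
qed

lemma eq_terms_ElList_NilT:
  assumes a: "eq_terms \<Gamma> a a' A"
  shows "eq_terms \<Gamma> (ElList NilT a c) a' A"
proof (rule eq_termsI[OF eq_terms_type[OF a]])
  fix \<rho> \<rho>' assume env: "env_rel \<Gamma> \<rho> \<rho>'"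
  have "elt (ElList NilT a c) \<rho> \<leadsto> elt a \<rho>" by (simp add: elt_ElList list_fold_Nil)
  then show "ty_rel A \<rho> (elt (ElList NilT a c) \<rho>) (elt a' \<rho>')"
    using admissible_expand_left[OF eq_termsD(1,2)[OF a env]] by blast
qed

lemma eq_terms_ElList_ConsT:
  assumes ctx: "valid_ctx \<Gamma>" and A: "eq_types \<Gamma> A A Set" and L: "eq_types (ListS A # \<Gamma>) L L Col"
    and l: "eq_terms \<Gamma> l l (ListS A)" and b: "eq_terms \<Gamma> b b A"
    and a: "eq_terms \<Gamma> a a (inst_ty 0 [NilT] L)"
    and c: "eq_terms (inst_ty 2 [Var 1] L # rn_ty Suc A # ListS A # \<Gamma>) c c (inst_ty 3 [ConsT (Var 2) (Var 1)] L)"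
  shows "eq_terms \<Gamma> (ElList (ConsT l b) a c) (inst_tm 0 [ElList l a c, b, l] c) (inst_ty 0 [ConsT l b] L)"
proof (rule eq_termsI[OF eq_types_inst_left[OF ctx L eq_terms_ConsT[OF A l b]]])
  fix \<rho> \<rho>' assume env: "env_rel \<Gamma> \<rho> \<rho>'"
  let ?\<rho> = "list_fold a c \<rho> (realizer l \<rho>) \<bullet> (realizer b \<rho>, VNone) \<bullet> (realizer l \<rho>, VNone) \<bullet> \<rho>"
  let ?\<rho>' = "elt (ElList l a c) \<rho>' \<bullet> elt b \<rho>' \<bullet> elt l \<rho>' \<bullet> \<rho>'"
  have L': "list_related (\<lambda>b b'. ty_rel A \<rho> (b, VNone) (b', VNone)) (realizer l \<rho>) (realizer l \<rho>')"
    using eq_termsD(1)[OF l env] by (simp add: elt_def)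
  have "ty_rel A \<rho> (realizer b \<rho>, VNone) (elt b \<rho>')"
    by (rule set_realizers[OF A env eq_termsD(1)[OF b env]]) (simp_all add: elt_def)
  then have E: "env_rel (inst_ty 2 [Var 1] L # rn_ty Suc A # ListS A # \<Gamma>) ?\<rho> ?\<rho>'"
    using env L' list_fold_related[OF ctx A L a c env L'] by (simp add: sem_simps elt_ElList fst_elt)
  have "ty_rel L (elt (ConsT (Var 2) (Var 1)) ?\<rho> \<bullet> \<rho>) (elt c ?\<rho>) (elt c ?\<rho>')"
      "admissible (ty_rel L (elt (ConsT (Var 2) (Var 1)) ?\<rho> \<bullet> \<rho>))"
    using eq_termsD(1,2)[OF c E] by (simp_all add: sem_simps)
  moreover have "elt (ConsT (Var 2) (Var 1)) ?\<rho> = elt (ConsT l b) \<rho>"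
    by (simp add: elt_def numeral_2_eq_2)
  moreover have "elt (ElList (ConsT l b) a c) \<rho> \<leadsto> elt c ?\<rho>"
    using L' by (auto simp: elt_ElList intro!: list_fold_Cons)
  ultimately have "ty_rel L (elt (ConsT l b) \<rho> \<bullet> \<rho>) (elt (ElList (ConsT l b) a c) \<rho>) (elt c ?\<rho>')"
    using admissible_expand_left by metis
  then show "ty_rel (inst_ty 0 [ConsT l b] L) \<rho> (elt (ElList (ConsT l b) a c) \<rho>)
      (elt (inst_tm 0 [ElList l a c, b, l] c) \<rho>')"
    by (simp add: sem_simps)
qed

subsection \<open>Disjoint and indexed sums\<close>

lemma eq_terms_InlT:
  assumes A: "eq_types \<Gamma> A A Set" and B: "eq_types \<Gamma> B B Set" and a: "eq_terms \<Gamma> a a' A"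
  shows "eq_terms \<Gamma> (InlT a) (InlT a') (SumS A B)"
proof (rule eq_termsI[OF eq_types_Col[OF eq_types_SumS[OF A B]]])
  fix \<rho> \<rho>' assume env: "env_rel \<Gamma> \<rho> \<rho>'"
  have "ty_rel A \<rho> (realizer a \<rho>, VNone) (realizer a' \<rho>', VNone)"
    by (rule set_realizers[OF A env eq_termsD(1)[OF a env]]) (simp_all add: elt_def)
  then show "ty_rel (SumS A B) \<rho> (elt (InlT a) \<rho>) (elt (InlT a') \<rho>')"
    by (simp add: elt_def)
qed

lemma eq_terms_InrT:
  assumes A: "eq_types \<Gamma> A A Set" and B: "eq_types \<Gamma> B B Set" and b: "eq_terms \<Gamma> b b' B"
  shows "eq_terms \<Gamma> (InrT b) (InrT b') (SumS A B)"
proof (rule eq_termsI[OF eq_types_Col[OF eq_types_SumS[OF A B]]])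
  fix \<rho> \<rho>' assume env: "env_rel \<Gamma> \<rho> \<rho>'"
  have "ty_rel B \<rho> (realizer b \<rho>, VNone) (realizer b' \<rho>', VNone)"
    by (rule set_realizers[OF B env eq_termsD(1)[OF b env]]) (simp_all add: elt_def)
  then show "ty_rel (SumS A B) \<rho> (elt (InrT b) \<rho>) (elt (InrT b') \<rho>')"
    by (simp add: elt_def)
qed

text \<open>
  The branch is computed in the fibre of \<open>L\<close> over \<open>InlT a\<close> or \<open>InrT b\<close>, to which \<open>p\<close>
  evaluates; since \<open>p\<close> is related to its head form, this is the fibre over \<open>p\<close>. The
  eliminators of pairs and of quotients follow the same pattern.
\<close>

lemma eq_terms_ElSum:
  assumes ctx: "valid_ctx \<Gamma>" and L: "eq_types (SumS A B # \<Gamma>) L L Col"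
    and p: "eq_terms \<Gamma> p p' (SumS A B)"
    and d: "eq_terms (A # \<Gamma>) d d' (inst_ty 1 [InlT (Var 0)] L)"
    and e: "eq_terms (B # \<Gamma>) e e' (inst_ty 1 [InrT (Var 0)] L)"
  shows "eq_terms \<Gamma> (ElSum p d e) (ElSum p' d' e') (inst_ty 0 [p] L)"
proof (rule eq_termsI[OF eq_types_inst_left[OF ctx L p]])
  fix \<rho> \<rho>' assume env: "env_rel \<Gamma> \<rho> \<rho>'"
  note P = eq_termsD(1)[OF p env]
  have P1: "ty_rel (SumS A B) \<rho> (elt p \<rho>) (elt p \<rho>)"
    using admissible_refl(1)[OF eq_termsD(2)[OF p env] P] .
  note L_cong = eq_types_family[OF L env_rel_refl(1)[OF ctx env]]
  consider (inl) a a' where "realizer p \<rho> \<Down> InlT a" "realizer p' \<rho>' \<Down> InlT a'"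
      "ty_rel A \<rho> (a, VNone) (a', VNone)"
    | (inr) b b' where "realizer p \<rho> \<Down> InrT b" "realizer p' \<rho>' \<Down> InrT b'"
      "ty_rel B \<rho> (b, VNone) (b', VNone)"
    using P by (auto simp: elt_def)
  then show "ty_rel (inst_ty 0 [p] L) \<rho> (elt (ElSum p d e) \<rho>) (elt (ElSum p' d' e') \<rho>')"
  proof cases
    case inl
    have "ty_rel (SumS A B) \<rho> (elt p \<rho>) (InlT a, VNone)"
      using P1 inl(1) evaluates_unique by (fastforce simp: elt_def)
    note L_cong = L_cong[OF this]
    have "env_rel (A # \<Gamma>) ((a, VNone) \<bullet> \<rho>) ((a', VNone) \<bullet> \<rho>')"
      using env inl(3) by simp
    from eq_termsD(1)[OF d this]
    have "ty_rel L ((InlT a, VNone) \<bullet> \<rho>) (elt d ((a, VNone) \<bullet> \<rho>)) (elt d' ((a', VNone) \<bullet> \<rho>'))"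
      by (simp add: sem_simps elt_def[of "InlT _"])
    then show ?thesis
      using admissible_expand[OF _ _ elt_ElSum_reduces(1)[OF inl(1)] elt_ElSum_reduces(1)[OF inl(2)]] L_cong
      by (simp add: sem_simps)
  next
    case inr
    have "ty_rel (SumS A B) \<rho> (elt p \<rho>) (InrT b, VNone)"
      using P1 inr(1) evaluates_unique by (fastforce simp: elt_def)
    note L_cong = L_cong[OF this]
    have "env_rel (B # \<Gamma>) ((b, VNone) \<bullet> \<rho>) ((b', VNone) \<bullet> \<rho>')"
      using env inr(3) by simp
    from eq_termsD(1)[OF e this]
    have "ty_rel L ((InrT b, VNone) \<bullet> \<rho>) (elt e ((b, VNone) \<bullet> \<rho>)) (elt e' ((b', VNone) \<bullet> \<rho>'))"
      by (simp add: sem_simps elt_def[of "InrT _"])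
    then show ?thesis
      using admissible_expand[OF _ _ elt_ElSum_reduces(2)[OF inr(1)] elt_ElSum_reduces(2)[OF inr(2)]] L_cong
      by (simp add: sem_simps)
  qed
qed

lemma eq_terms_ElSum_InlT:
  assumes ctx: "valid_ctx \<Gamma>" and A: "eq_types \<Gamma> A A Set" and B: "eq_types \<Gamma> B B Set"
    and L: "eq_types (SumS A B # \<Gamma>) L L Col" and a: "eq_terms \<Gamma> a a A"
    and d: "eq_terms (A # \<Gamma>) d d (inst_ty 1 [InlT (Var 0)] L)"
  shows "eq_terms \<Gamma> (ElSum (InlT a) d e) (inst_tm 0 [a] d) (inst_ty 0 [InlT a] L)"
proof (rule eq_termsI[OF eq_types_inst_left[OF ctx L eq_terms_InlT[OF A B a]]])
  fix \<rho> \<rho>' assume env: "env_rel \<Gamma> \<rho> \<rho>'"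
  have "ty_rel A \<rho> (realizer a \<rho>, VNone) (elt a \<rho>')"
    by (rule set_realizers[OF A env eq_termsD(1)[OF a env]]) (simp_all add: elt_def)
  then have "env_rel (A # \<Gamma>) ((realizer a \<rho>, VNone) \<bullet> \<rho>) (elt a \<rho>' \<bullet> \<rho>')"
    using env by simp
  note D = eq_termsD(1,2)[OF d this]
  have "elt (InlT (Var 0)) ((realizer a \<rho>, VNone) \<bullet> \<rho>) = elt (InlT a) \<rho>"
    by (simp add: elt_def)
  moreover have "elt (ElSum (InlT a) d e) \<rho> \<leadsto> elt d ((realizer a \<rho>, VNone) \<bullet> \<rho>)"
    by (rule elt_ElSum_reduces) simp
  ultimately show "ty_rel (inst_ty 0 [InlT a] L) \<rho> (elt (ElSum (InlT a) d e) \<rho>) (elt (inst_tm 0 [a] d) \<rho>')"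
    using admissible_expand_left[OF D] by (simp add: sem_simps)
qed

lemma eq_terms_ElSum_InrT:
  assumes ctx: "valid_ctx \<Gamma>" and A: "eq_types \<Gamma> A A Set" and B: "eq_types \<Gamma> B B Set"
    and L: "eq_types (SumS A B # \<Gamma>) L L Col" and b: "eq_terms \<Gamma> b b B"
    and e: "eq_terms (B # \<Gamma>) e e (inst_ty 1 [InrT (Var 0)] L)"
  shows "eq_terms \<Gamma> (ElSum (InrT b) d e) (inst_tm 0 [b] e) (inst_ty 0 [InrT b] L)"
proof (rule eq_termsI[OF eq_types_inst_left[OF ctx L eq_terms_InrT[OF A B b]]])
  fix \<rho> \<rho>' assume env: "env_rel \<Gamma> \<rho> \<rho>'"
  have "ty_rel B \<rho> (realizer b \<rho>, VNone) (elt b \<rho>')"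
    by (rule set_realizers[OF B env eq_termsD(1)[OF b env]]) (simp_all add: elt_def)
  then have "env_rel (B # \<Gamma>) ((realizer b \<rho>, VNone) \<bullet> \<rho>) (elt b \<rho>' \<bullet> \<rho>')"
    using env by simp
  note D = eq_termsD(1,2)[OF e this]
  have "elt (InrT (Var 0)) ((realizer b \<rho>, VNone) \<bullet> \<rho>) = elt (InrT b) \<rho>"
    by (simp add: elt_def)
  moreover have "elt (ElSum (InrT b) d e) \<rho> \<leadsto> elt e ((realizer b \<rho>, VNone) \<bullet> \<rho>)"
    by (rule elt_ElSum_reduces) simp
  ultimately show "ty_rel (inst_ty 0 [InrT b] L) \<rho> (elt (ElSum (InrT b) d e) \<rho>) (elt (inst_tm 0 [b] e) \<rho>')"
    using admissible_expand_left[OF D] by (simp add: sem_simps)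
qed

lemma ty_rel_Sig_PairT:
  "ty_rel (Sig A B) \<rho> (elt (PairT a b) \<rho>') (elt (PairT c d) \<rho>'') \<longleftrightarrow>
    ty_rel A \<rho> (elt a \<rho>') (elt c \<rho>'') \<and> ty_rel B (elt a \<rho>' \<bullet> \<rho>) (elt b \<rho>') (elt d \<rho>'')"
  by (simp add: elt_def)

lemma eq_terms_PairT:
  assumes ctx: "valid_ctx \<Gamma>" and A: "eq_types \<Gamma> A A Col" and B: "eq_types (A # \<Gamma>) B B Col"
    and a: "eq_terms \<Gamma> a a' A" and b: "eq_terms \<Gamma> b b' (inst_ty 0 [a] B)"
  shows "eq_terms \<Gamma> (PairT a b) (PairT a' b') (Sig A B)"
proof (rule eq_termsI)
  show "eq_types \<Gamma> (Sig A B) (Sig A B) Col"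
    using eq_types_Sig[OF ctx A B] by simp
  fix \<rho> \<rho>' assume env: "env_rel \<Gamma> \<rho> \<rho>'"
  show "ty_rel (Sig A B) \<rho> (elt (PairT a b) \<rho>) (elt (PairT a' b') \<rho>')"
    unfolding ty_rel_Sig_PairT
    using eq_termsD(1)[OF a env] eq_termsD(1)[OF b env] by (simp add: sem_simps)
qed

lemma eq_terms_ElSig:
  assumes ctx: "valid_ctx \<Gamma>" and A: "eq_types \<Gamma> A A Col" and B: "eq_types (A # \<Gamma>) B B Col"
    and L: "eq_types (Sig A B # \<Gamma>) L L Col"
    and p: "eq_terms \<Gamma> p p' (Sig A B)"
    and m: "eq_terms (B # A # \<Gamma>) m m' (inst_ty 2 [PairT (Var 1) (Var 0)] L)"
  shows "eq_terms \<Gamma> (ElSig p m) (ElSig p' m') (inst_ty 0 [p] L)"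
proof (rule eq_termsI[OF eq_types_inst_left[OF ctx L p]])
  fix \<rho> \<rho>' assume env: "env_rel \<Gamma> \<rho> \<rho>'"
  let ?u = "tm_val p \<rho>" and ?u' = "tm_val p' \<rho>'"
  obtain a b a' b' where ev: "realizer p \<rho> \<Down> PairT a b" "realizer p' \<rho>' \<Down> PairT a' b'"
    and a: "ty_rel A \<rho> (a, val_fst ?u) (a', val_fst ?u')"
    and b: "ty_rel B ((a, val_fst ?u) \<bullet> \<rho>) (b, val_snd ?u) (b', val_snd ?u')"
    using eq_termsD(1)[OF p env] by (auto simp: elt_def)
  let ?\<rho> = "(b, val_snd ?u) \<bullet> (a, val_fst ?u) \<bullet> \<rho>"
  let ?\<rho>' = "(b', val_snd ?u') \<bullet> (a', val_fst ?u') \<bullet> \<rho>'"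
  have "env_rel (B # A # \<Gamma>) ?\<rho> ?\<rho>'"
    using env a b by simp
  note M = eq_termsD(1)[OF m this]
  \<comment> \<open>In the extended assignment, \<open>PairT (Var 1) (Var 0)\<close> denotes the pair to which \<open>p\<close> evaluates.\<close>
  have "ty_rel (Sig A B) \<rho> (elt p \<rho>) (elt (PairT (Var 1) (Var 0)) ?\<rho>)"
    using ev(1) admissible_refl(1)[OF eq_typesD(3)[OF A env] a]
      admissible_refl(1)[OF eq_types_family(3)[OF B env_rel_refl(1)[OF ctx env] a] b]
    by (simp add: elt_def) blast
  note L_cong = eq_types_family[OF L env_rel_refl(1)[OF ctx env] this]
  show "ty_rel (inst_ty 0 [p] L) \<rho> (elt (ElSig p m) \<rho>) (elt (ElSig p' m') \<rho>')"
    using admissible_expand[OF _ _ elt_ElSig_reduces[OF ev(1)] elt_ElSig_reduces[OF ev(2)]] M L_cong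
    by (simp add: sem_simps)
qed

lemma eq_terms_ElSig_PairT:
  assumes ctx: "valid_ctx \<Gamma>" and A: "eq_types \<Gamma> A A Col" and B: "eq_types (A # \<Gamma>) B B Col"
    and L: "eq_types (Sig A B # \<Gamma>) L L Col"
    and a: "eq_terms \<Gamma> a a A" and b: "eq_terms \<Gamma> b b (inst_ty 0 [a] B)"
    and m: "eq_terms (B # A # \<Gamma>) m m (inst_ty 2 [PairT (Var 1) (Var 0)] L)"
  shows "eq_terms \<Gamma> (ElSig (PairT a b) m) (inst_tm 0 [b, a] m) (inst_ty 0 [PairT a b] L)"
proof (rule eq_termsI[OF eq_types_inst_left[OF ctx L eq_terms_PairT[OF ctx A B a b]]])
  fix \<rho> \<rho>' assume env: "env_rel \<Gamma> \<rho> \<rho>'"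
  have "env_rel (B # A # \<Gamma>) (elt b \<rho> \<bullet> elt a \<rho> \<bullet> \<rho>) (elt b \<rho>' \<bullet> elt a \<rho>' \<bullet> \<rho>')"
    using env eq_termsD(1)[OF a env] eq_termsD(1)[OF b env] by (simp add: sem_simps)
  note M = eq_termsD(1,2)[OF m this]
  have "elt (PairT (Var 1) (Var 0)) (elt b \<rho> \<bullet> elt a \<rho> \<bullet> \<rho>) = elt (PairT a b) \<rho>"
    by (simp add: elt_def)
  moreover have "elt (ElSig (PairT a b) m) \<rho> \<leadsto> elt m (elt b \<rho> \<bullet> elt a \<rho> \<bullet> \<rho>)"
    using elt_ElSig_reduces[where p="PairT a b" and a="realizer a \<rho>" and b="realizer b \<rho>" and m=m and \<rho>=\<rho>]
    by (simp add: elt_def)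
  ultimately show "ty_rel (inst_ty 0 [PairT a b] L) \<rho> (elt (ElSig (PairT a b) m) \<rho>) (elt (inst_tm 0 [b, a] m) \<rho>')"
    using admissible_expand_left[OF M] by (simp add: sem_simps)
qed

subsection \<open>Dependent products of sets\<close>

lemma App_Lam_steps: "App (realizer (Lam b) \<rho>) (fst x) \<longrightarrow>* realizer b (x \<bullet> \<rho>)"
  by (rule r_into_rtranclp) (simp add: inst_up fst_push)

text \<open>
  The realizer of an abstraction, applied to a realizer of \<open>x\<close>, reduces to the realizer of the body
  at \<open>x\<close>. This application forgets the value of the body, which the relation of the set \<open>B\<close> ignores.
\<close>

lemma eq_terms_Lam:
  assumes ctx: "valid_ctx \<Gamma>" and A: "eq_types \<Gamma> A A Set" and B: "eq_types (A # \<Gamma>) B B Set"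
    and b: "eq_terms (A # \<Gamma>) b b' B"
  shows "eq_terms \<Gamma> (Lam b) (Lam b') (PiS A B)"
proof (rule eq_termsI[OF eq_types_Col[OF eq_types_PiS[OF ctx A B]]])
  fix \<rho> \<rho>' assume env: "env_rel \<Gamma> \<rho> \<rho>'"
  show "ty_rel (PiS A B) \<rho> (elt (Lam b) \<rho>) (elt (Lam b') \<rho>')"
    unfolding ty_rel.simps
  proof (intro allI impI)
    fix x x' assume x: "ty_rel A \<rho> x x'"
    have env': "env_rel (A # \<Gamma>) (x \<bullet> \<rho>) (x' \<bullet> \<rho>')" using env x by simp
    have "ty_rel B (x \<bullet> \<rho>) (realizer b (x \<bullet> \<rho>), VNone) (realizer b' (x' \<bullet> \<rho>'), VNone)"
      by (rule set_realizers[OF B env' eq_termsD(1)[OF b env']]) (simp_all add: elt_def)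
    then show "ty_rel B (x \<bullet> \<rho>) (App (fst (elt (Lam b) \<rho>)) (fst x), VNone)
        (App (fst (elt (Lam b') \<rho>')) (fst x'), VNone)"
      by (rule admissible_expand[OF _ eq_termsD(2)[OF b env']])
         (use App_Lam_steps in \<open>simp_all add: reduces_def fst_elt\<close>)
  qed
qed

lemma eq_terms_App:
  assumes ctx: "valid_ctx \<Gamma>" and A: "eq_types \<Gamma> A A Set" and B: "eq_types (A # \<Gamma>) B B Set"
    and f: "eq_terms \<Gamma> f f' (PiS A B)" and a: "eq_terms \<Gamma> a a' A"
  shows "eq_terms \<Gamma> (App f a) (App f' a') (inst_ty 0 [a] B)"
proof (rule eq_termsI[OF eq_types_inst_left[OF ctx eq_types_Col[OF B] a]])
  fix \<rho> \<rho>' assume env: "env_rel \<Gamma> \<rho> \<rho>'"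
  note a' = eq_termsD(1)[OF a env]
  have *: "ty_rel B (elt a \<rho> \<bullet> \<rho>) (realizer (App f a) \<rho>, VNone) (realizer (App f' a') \<rho>', VNone)"
    using eq_termsD(1)[OF f env] a' by (force simp: fst_elt)
  have env': "env_rel (A # \<Gamma>) (elt a \<rho> \<bullet> \<rho>) (elt a' \<rho>' \<bullet> \<rho>')"
    using env a' by simp
  have "ty_rel B (elt a \<rho> \<bullet> \<rho>) (elt (App f a) \<rho>) (elt (App f' a') \<rho>')"
    by (rule set_realizers[OF B env' *]) (simp_all add: fst_elt)
  then show "ty_rel (inst_ty 0 [a] B) \<rho> (elt (App f a) \<rho>) (elt (App f' a') \<rho>')"
    by (simp add: sem_simps)
qed

lemma eq_terms_App_Lam:
  assumes ctx: "valid_ctx \<Gamma>" and A: "eq_types \<Gamma> A A Set" and B: "eq_types (A # \<Gamma>) B B Set"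
    and b: "eq_terms (A # \<Gamma>) b b B" and a: "eq_terms \<Gamma> a a A"
  shows "eq_terms \<Gamma> (App (Lam b) a) (inst_tm 0 [a] b) (inst_ty 0 [a] B)"
proof (rule eq_termsI[OF eq_types_inst_left[OF ctx eq_types_Col[OF B] a]])
  fix \<rho> \<rho>' assume env: "env_rel \<Gamma> \<rho> \<rho>'"
  have env': "env_rel (A # \<Gamma>) (elt a \<rho> \<bullet> \<rho>) (elt a \<rho>' \<bullet> \<rho>')"
    using env eq_termsD(1)[OF a env] by simp
  note D = eq_termsD[OF b env']
  have "ty_rel B (elt a \<rho> \<bullet> \<rho>) (realizer b (elt a \<rho> \<bullet> \<rho>), tm_val (App (Lam b) a) \<rho>) (elt b (elt a \<rho>' \<bullet> \<rho>'))"
    by (rule set_realizers[OF B env' D(1)]) (simp_all add: fst_elt)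
  then have "ty_rel B (elt a \<rho> \<bullet> \<rho>) (elt (App (Lam b) a) \<rho>) (elt b (elt a \<rho>' \<bullet> \<rho>'))"
    by (rule admissible_expand_left[OF _ D(2)])
       (use App_Lam_steps[where x="elt a \<rho>" and b=b and \<rho>=\<rho>] in \<open>simp add: reduces_def elt_def\<close>)
  then show "ty_rel (inst_ty 0 [a] B) \<rho> (elt (App (Lam b) a) \<rho>) (elt (inst_tm 0 [a] b) \<rho>')"
    by (simp add: sem_simps)
qed

lemma eta_steps: "App (realizer (Lam (App (rn_tm Suc f) (Var 0))) \<rho>) r \<longrightarrow>* App (realizer f \<rho>) r"
  by (rule r_into_rtranclp) (simp add: sb_sb sb_rn)

lemma eq_terms_eta:
  assumes ctx: "valid_ctx \<Gamma>" and B: "eq_types (A # \<Gamma>) B B Set" and f: "eq_terms \<Gamma> f f (PiS A B)"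
  shows "eq_terms \<Gamma> (Lam (App (rn_tm Suc f) (Var 0))) f (PiS A B)"
proof (rule eq_termsI[OF eq_terms_type[OF f]])
  fix \<rho> \<rho>' assume env: "env_rel \<Gamma> \<rho> \<rho>'"
  note F = eq_termsD(1)[OF f env]
  show "ty_rel (PiS A B) \<rho> (elt (Lam (App (rn_tm Suc f) (Var 0))) \<rho>) (elt f \<rho>')"
    unfolding ty_rel.simps
  proof (intro allI impI)
    fix x x' assume x: "ty_rel A \<rho> x x'"
    have "ty_rel B (x \<bullet> \<rho>) (App (realizer f \<rho>) (fst x), VNone) (App (fst (elt f \<rho>')) (fst x'), VNone)"
      using F x by (simp add: fst_elt)
    then show "ty_rel B (x \<bullet> \<rho>) (App (fst (elt (Lam (App (rn_tm Suc f) (Var 0))) \<rho>)) (fst x), VNone)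
        (App (fst (elt f \<rho>')) (fst x'), VNone)"
      by (rule admissible_expand_left[OF _ eq_types_family(3)[OF B env x]])
         (use eta_steps in \<open>simp add: reduces_def fst_elt\<close>)
  qed
qed

subsection \<open>Quotients\<close>

lemma ty_rel_Cls:
  "ty_rel (Quot A R) \<rho> (elt (Cls a) \<rho>') (elt (Cls b) \<rho>'') \<longleftrightarrow>
    ty_rel A \<rho> (realizer a \<rho>', VNone) (realizer a \<rho>', VNone) \<and>
    ty_rel A \<rho> (realizer b \<rho>'', VNone) (realizer b \<rho>'', VNone) \<and>
    holds R ((realizer b \<rho>'', VNone) \<bullet> (realizer a \<rho>', VNone) \<bullet> \<rho>)"
  by (simp add: elt_def)

text \<open>
  What makes \<open>A/R\<close> a well-formed set. The introduction, equality and effectiveness rules of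
  quotients have only \<open>A/R set\<close> as a premise, and the relation denoted by \<open>A/R\<close> does not determine
  that \<open>A\<close> is a set or that \<open>R\<close> is an equivalence relation. The invariance of \<open>R\<close> is phrased with
  assignments rather than with a doubly extended context, so that it is visibly stable under
  substitution.
\<close>

definition quotient_data :: "ctx \<Rightarrow> ty \<Rightarrow> ty \<Rightarrow> bool" where
  "quotient_data \<Gamma> A R \<longleftrightarrow> eq_types \<Gamma> A A Set \<and>
     (\<forall>\<rho> \<rho>' x x' y y'. env_rel \<Gamma> \<rho> \<rho>' \<longrightarrow> ty_rel A \<rho> x x' \<longrightarrow> ty_rel A \<rho> y y' \<longrightarrow>
        ty_rel R (y \<bullet> x \<bullet> \<rho>) = ty_rel R (y' \<bullet> x' \<bullet> \<rho>') \<and> all_or_none (ty_rel R (y \<bullet> x \<bullet> \<rho>))) \<and>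
     (\<forall>\<rho> \<rho>'. env_rel \<Gamma> \<rho> \<rho>' \<longrightarrow> holds (EquivP A R) \<rho>)"

lemma quotient_dataI:
  assumes A: "eq_types \<Gamma> A A Set" and R: "eq_types (rn_ty Suc A # A # \<Gamma>) R R PropS"
    and equiv: "\<And>\<rho> \<rho>'. env_rel \<Gamma> \<rho> \<rho>' \<Longrightarrow> holds (EquivP A R) \<rho>"
  shows "quotient_data \<Gamma> A R"
proof -
  have "ty_rel R (y \<bullet> x \<bullet> \<rho>) = ty_rel R (y' \<bullet> x' \<bullet> \<rho>') \<and> all_or_none (ty_rel R (y \<bullet> x \<bullet> \<rho>))"
    if "env_rel \<Gamma> \<rho> \<rho>'" "ty_rel A \<rho> x x'" "ty_rel A \<rho> y y'" for \<rho> \<rho>' x x' y y'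
    using eq_typesD(1,2)[OF R, of "y \<bullet> x \<bullet> \<rho>" "y' \<bullet> x' \<bullet> \<rho>'"] that by (simp add: rn_sem)
  with A equiv show ?thesis unfolding quotient_data_def by blast
qed

lemma quotient_data_subst:
  assumes "quotient_data \<Gamma> A R"
    and s: "\<And>i. i < length \<Gamma> \<Longrightarrow> eq_terms \<Delta> (s i) (s i) (sb_ty s (lift_ty (Suc i) (\<Gamma> ! i)))"
  shows "quotient_data \<Delta> (sb_ty s A) (sb_ty (up_sb (up_sb s)) R)"
  unfolding quotient_data_def
proof (intro conjI allI impI)
  have A: "eq_types \<Gamma> A A Set"
    using assms(1) by (simp add: quotient_data_def)
  show "eq_types \<Delta> (sb_ty s A) (sb_ty s A) Set"
    using eq_types_subst[OF A s] .
next
  fix \<rho> \<rho>' x x' y y'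
  assume "env_rel \<Delta> \<rho> \<rho>'" "ty_rel (sb_ty s A) \<rho> x x'" "ty_rel (sb_ty s A) \<rho> y y'"
  then show "ty_rel (sb_ty (up_sb (up_sb s)) R) (y \<bullet> x \<bullet> \<rho>) = ty_rel (sb_ty (up_sb (up_sb s)) R) (y' \<bullet> x' \<bullet> \<rho>')"
    "all_or_none (ty_rel (sb_ty (up_sb (up_sb s)) R) (y \<bullet> x \<bullet> \<rho>))"
    using assms(1) env_rel_subst[OF s] unfolding quotient_data_def sb_sem elt_up_sb by blast+
next
  fix \<rho> \<rho>'
  assume "env_rel \<Delta> \<rho> \<rho>'"
  then have "holds (EquivP A R) (\<lambda>i. elt (s i) \<rho>)"
    using assms(1) env_rel_subst[OF s] unfolding quotient_data_def by blast
  then show "holds (EquivP (sb_ty s A) (sb_ty (up_sb (up_sb s)) R)) \<rho>"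
    unfolding holds_EquivP sb_sem elt_up_sb .
qed

context
  fixes \<Gamma> A R
  assumes ctx: "valid_ctx \<Gamma>" and Q: "quotient_data \<Gamma> A R"
begin

lemma quotient_carrier: "eq_types \<Gamma> A A Set"
  and quotient_rel_cong: "env_rel \<Gamma> \<rho> \<rho>' \<Longrightarrow> ty_rel A \<rho> x x' \<Longrightarrow> ty_rel A \<rho> y y' \<Longrightarrow>
    ty_rel R (y \<bullet> x \<bullet> \<rho>) = ty_rel R (y' \<bullet> x' \<bullet> \<rho>')"
  and quotient_rel_prop: "env_rel \<Gamma> \<rho> \<rho>' \<Longrightarrow> ty_rel A \<rho> x x' \<Longrightarrow> ty_rel A \<rho> y y' \<Longrightarrow>
    all_or_none (ty_rel R (y \<bullet> x \<bullet> \<rho>))"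
  and quotient_rel_refl: "env_rel \<Gamma> \<rho> \<rho>' \<Longrightarrow> ty_rel A \<rho> x x \<Longrightarrow> holds R (x \<bullet> x \<bullet> \<rho>)"
  using Q unfolding quotient_data_def holds_EquivP by blast+

lemma quotient_elements:
  assumes "eq_terms \<Gamma> a a' A" "env_rel \<Gamma> \<rho> \<rho>'"
  shows "ty_rel A \<rho> (realizer a \<rho>, VNone) (elt a \<rho>)" "ty_rel A \<rho> (realizer a \<rho>, VNone) (elt a' \<rho>')"
    "ty_rel A \<rho> (realizer a \<rho>, VNone) (realizer a' \<rho>', VNone)"
    "ty_rel A \<rho> (realizer a \<rho>, VNone) (realizer a \<rho>, VNone)"
    "ty_rel A \<rho> (realizer a' \<rho>', VNone) (realizer a' \<rho>', VNone)"
proof -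
  note D = eq_termsD(1)[OF assms]
  note R = admissible_refl[OF eq_termsD(2)[OF assms] D]
  note S = set_realizers[OF quotient_carrier assms(2)]
  show "ty_rel A \<rho> (realizer a \<rho>, VNone) (elt a \<rho>)" by (rule S[OF R(1)]) (simp_all add: fst_elt)
  show "ty_rel A \<rho> (realizer a \<rho>, VNone) (elt a' \<rho>')" by (rule S[OF D]) (simp_all add: fst_elt)
  show "ty_rel A \<rho> (realizer a \<rho>, VNone) (realizer a' \<rho>', VNone)" by (rule S[OF D]) (simp_all add: fst_elt)
  show "ty_rel A \<rho> (realizer a \<rho>, VNone) (realizer a \<rho>, VNone)" by (rule S[OF R(1)]) (simp_all add: fst_elt)
  show "ty_rel A \<rho> (realizer a' \<rho>', VNone) (realizer a' \<rho>', VNone)" by (rule S[OF R(2)]) (simp_all add: fst_elt)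
qed

lemma eq_types_Quot_refl: "eq_types \<Gamma> (Quot A R) (Quot A R) Set"
proof (rule eq_typesI)
  fix \<rho> \<rho>' assume env: "env_rel \<Gamma> \<rho> \<rho>'"
  show "of_kind Set (ty_rel (Quot A R) \<rho>)"
    using Q env unfolding quotient_data_def by (blast intro: of_kind_Quot)
  have "holds R (y \<bullet> x \<bullet> \<rho>) = holds R (y \<bullet> x \<bullet> \<rho>')" if "ty_rel A \<rho> x x" "ty_rel A \<rho> y y" for x y
    using quotient_rel_cong[OF env that] by simp
  then show "ty_rel (Quot A R) \<rho> = ty_rel (Quot A R) \<rho>'"
    unfolding ty_rel.simps eq_typesD(1)[OF quotient_carrier env, symmetric] by (intro ext) metis
qed

lemma eq_terms_Cls_cong:
  assumes a: "eq_terms \<Gamma> a a' A"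
  shows "eq_terms \<Gamma> (Cls a) (Cls a') (Quot A R)"
proof (rule eq_termsI[OF eq_types_Col[OF eq_types_Quot_refl]])
  fix \<rho> \<rho>' assume env: "env_rel \<Gamma> \<rho> \<rho>'"
  note a = quotient_elements[OF a env]
  have "holds R ((realizer a' \<rho>', VNone) \<bullet> (realizer a \<rho>, VNone) \<bullet> \<rho>)"
    using quotient_rel_refl[OF env a(4)] quotient_rel_cong[OF env_rel_refl(1)[OF ctx env] a(4) a(3)] by simp
  with a show "ty_rel (Quot A R) \<rho> (elt (Cls a) \<rho>) (elt (Cls a') \<rho>')"
    unfolding ty_rel_Cls by blast
qed

text \<open>
  Validity of equal classes from related representatives, and effectiveness: a class \<open>Cls a\<close> is
  already in head form, so the relation of the quotient compares just the given representatives.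
\<close>

lemma eq_terms_Cls_iff:
  assumes a: "eq_terms \<Gamma> a a A" and b: "eq_terms \<Gamma> b b A"
  shows "eq_terms \<Gamma> (Cls a) (Cls b) (Quot A R) \<longleftrightarrow> eq_terms \<Gamma> TrueT TrueT (inst_ty 0 [b, a] R)"
proof -
  have "eq_types \<Gamma> (inst_ty 0 [b, a] R) (inst_ty 0 [b, a] R) Prop"
    using quotient_rel_cong[OF _ eq_termsD(1)[OF a] eq_termsD(1)[OF b]]
      quotient_rel_prop[OF _ eq_termsD(1)[OF a] eq_termsD(1)[OF b]]
    by (intro eq_typesI) (simp_all add: sem_simps)
  note R_iff = eq_terms_prop[OF this]
  have "ty_rel (Quot A R) \<rho> (elt (Cls a) \<rho>) (elt (Cls b) \<rho>') \<longleftrightarrow> holds (inst_ty 0 [b, a] R) \<rho>"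
    if env: "env_rel \<Gamma> \<rho> \<rho>'" for \<rho> \<rho>'
  proof -
    note a = quotient_elements[OF a env] and b = quotient_elements[OF b env]
    have "holds R ((realizer b \<rho>', VNone) \<bullet> (realizer a \<rho>, VNone) \<bullet> \<rho>) =
        holds R ((realizer b \<rho>, VNone) \<bullet> (realizer a \<rho>, VNone) \<bullet> \<rho>)"
      "holds R ((realizer b \<rho>, VNone) \<bullet> (realizer a \<rho>, VNone) \<bullet> \<rho>) = holds R (elt b \<rho> \<bullet> elt a \<rho> \<bullet> \<rho>)"
      using quotient_rel_cong[OF env_rel_refl(1)[OF ctx env] a(4) b(3)]
        quotient_rel_cong[OF env_rel_refl(1)[OF ctx env] a(1) b(1)] by simp_all
    with a b show ?thesis
      unfolding ty_rel_Cls by (simp add: sem_simps)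
  qed
  then show ?thesis
    unfolding R_iff using eq_types_Col[OF eq_types_Quot_refl] unfolding eq_terms_def by blast
qed

lemma eq_terms_ElQ:
  assumes L: "eq_types (Quot A R # \<Gamma>) L L Col"
    and p: "eq_terms \<Gamma> p p' (Quot A R)"
    and l: "eq_terms (A # \<Gamma>) l l' (inst_ty 1 [Cls (Var 0)] L)"
    and l_eq: "eq_terms (R # rn_ty Suc A # A # \<Gamma>) (inst_tm 3 [Var 2] l') (inst_tm 3 [Var 1] l')
        (inst_ty 3 [Cls (Var 2)] L)"
  shows "eq_terms \<Gamma> (ElQ p l) (ElQ p' l') (inst_ty 0 [p] L)"
proof (rule eq_termsI[OF eq_types_inst_left[OF ctx L p]])
  fix \<rho> \<rho>' assume env: "env_rel \<Gamma> \<rho> \<rho>'"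
  obtain a a' where ev: "realizer p \<rho> \<Down> Cls a" "realizer p' \<rho>' \<Down> Cls a'"
    and a: "ty_rel A \<rho> (a, VNone) (a, VNone)" "ty_rel A \<rho> (a', VNone) (a', VNone)"
    and aa': "holds R ((a', VNone) \<bullet> (a, VNone) \<bullet> \<rho>)"
    using eq_termsD(1)[OF p env] by (auto simp: elt_def)
  have "ty_rel (Quot A R) \<rho> (elt p \<rho>) (Cls a, VNone)"
    using ev(1) a(1) quotient_rel_refl[OF env a(1)] by (simp add: elt_def) blast
  note L_cong = eq_types_family[OF L env_rel_refl(1)[OF ctx env] this]
  have "env_rel (A # \<Gamma>) ((a, VNone) \<bullet> \<rho>) ((a, VNone) \<bullet> \<rho>)"
    using env_rel_refl(1)[OF ctx env] a by simp
  from eq_termsD(1,2)[OF l this]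
  \<comment> \<open>First pass from \<open>l\<close> to \<open>l'\<close> at the representative \<open>a\<close>, then from \<open>a\<close> to \<open>a'\<close> in \<open>l'\<close>.\<close>
  have l1: "ty_rel L ((Cls a, VNone) \<bullet> \<rho>) (elt l ((a, VNone) \<bullet> \<rho>)) (elt l' ((a, VNone) \<bullet> \<rho>))"
    and adm: "admissible (ty_rel L ((Cls a, VNone) \<bullet> \<rho>))"
    by (simp_all add: sem_simps elt_def[of "Cls _"])
  have "ty_rel R ((a', VNone) \<bullet> (a, VNone) \<bullet> \<rho>) undefined undefined"
    using aa' .
  then have "env_rel (R # rn_ty Suc A # A # \<Gamma>) (undefined \<bullet> (a', VNone) \<bullet> (a, VNone) \<bullet> \<rho>)
      (undefined \<bullet> (a', VNone) \<bullet> (a, VNone) \<bullet> \<rho>')"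
    using env a by (simp add: rn_sem)
  from eq_termsD(1)[OF l_eq this]
  have l2: "ty_rel L ((Cls a, VNone) \<bullet> \<rho>) (elt l' ((a, VNone) \<bullet> \<rho>)) (elt l' ((a', VNone) \<bullet> \<rho>'))"
    by (simp add: sem_simps elt_def[of "Cls _"])
  show "ty_rel (inst_ty 0 [p] L) \<rho> (elt (ElQ p l) \<rho>) (elt (ElQ p' l') \<rho>')"
    using admissible_expand[OF admissible_trans[OF adm l1 l2] adm elt_ElQ_reduces[OF ev(1)] elt_ElQ_reduces[OF ev(2)]]
      L_cong by (simp add: sem_simps)
qed

lemma eq_terms_ElQ_Cls:
  assumes L: "eq_types (Quot A R # \<Gamma>) L L Col" and a: "eq_terms \<Gamma> a a A"
    and l: "eq_terms (A # \<Gamma>) l l (inst_ty 1 [Cls (Var 0)] L)"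
  shows "eq_terms \<Gamma> (ElQ (Cls a) l) (inst_tm 0 [a] l) (inst_ty 0 [Cls a] L)"
proof (rule eq_termsI[OF eq_types_inst_left[OF ctx L eq_terms_Cls_cong[OF a]]])
  fix \<rho> \<rho>' assume env: "env_rel \<Gamma> \<rho> \<rho>'"
  have "env_rel (A # \<Gamma>) ((realizer a \<rho>, VNone) \<bullet> \<rho>) (elt a \<rho>' \<bullet> \<rho>')"
    using env quotient_elements(2)[OF a env] by simp
  note D = eq_termsD(1,2)[OF l this]
  have "elt (Cls (Var 0)) ((realizer a \<rho>, VNone) \<bullet> \<rho>) = elt (Cls a) \<rho>"
    by (simp add: elt_def)
  moreover have "elt (ElQ (Cls a) l) \<rho> \<leadsto> elt l ((realizer a \<rho>, VNone) \<bullet> \<rho>)"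
    by (rule elt_ElQ_reduces) simp
  ultimately show "ty_rel (inst_ty 0 [Cls a] L) \<rho> (elt (ElQ (Cls a) l) \<rho>) (elt (inst_tm 0 [a] l) \<rho>')"
    using admissible_expand_left[OF D] by (simp add: sem_simps)
qed

end

subsection \<open>Power collections\<close>

lemma eq_types_P1: "eq_types \<Gamma> P1 P1 Col"
  using of_kind_P1 by (intro eq_typesI) simp_all

lemma eq_terms_P1:
  "eq_terms \<Gamma> U V P1 \<longleftrightarrow>
    (\<forall>\<rho> \<rho>'. env_rel \<Gamma> \<rho> \<rho>' \<longrightarrow> val_bool (tm_val U \<rho>) = val_bool (tm_val V \<rho>'))"
  using eq_types_P1 by (simp add: eq_terms_def elt_def)

lemma eq_terms_Powr_Lam:
  assumes A: "eq_types \<Gamma> A A Set" and b: "eq_terms (A # \<Gamma>) b b' P1"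
  shows "eq_terms \<Gamma> (Lam b) (Lam b') (Powr A)"
proof (rule eq_termsI[OF eq_types_Powr[OF A]])
  fix \<rho> \<rho>' assume env: "env_rel \<Gamma> \<rho> \<rho>'"
  have "val_bool (tm_val b ((fst x, VNone) \<bullet> \<rho>)) = val_bool (tm_val b' ((fst x', VNone) \<bullet> \<rho>'))"
    if "ty_rel A \<rho> x x'" for x x'
  proof -
    have "ty_rel A \<rho> (fst x, VNone) (fst x', VNone)"
      by (rule set_realizers[OF A env that]) simp_all
    then show ?thesis using b env unfolding eq_terms_P1 by simp
  qed
  then show "ty_rel (Powr A) \<rho> (elt (Lam b) \<rho>) (elt (Lam b') \<rho>')"
    by (simp add: elt_def del: split_paired_All)
qed

lemma eq_terms_Powr_App:
  assumes f: "eq_terms \<Gamma> f f' (Powr A)" and a: "eq_terms \<Gamma> a a' A"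
  shows "eq_terms \<Gamma> (App f a) (App f' a') P1"
  unfolding eq_terms_P1
proof (intro allI impI)
  fix \<rho> \<rho>' assume env: "env_rel \<Gamma> \<rho> \<rho>'"
  have "val_fun (snd (elt f \<rho>)) (fst (elt a \<rho>)) = val_fun (snd (elt f' \<rho>')) (fst (elt a' \<rho>'))"
    using eq_termsD(1)[OF f env] eq_termsD(1)[OF a env] unfolding ty_rel.simps by blast
  then show "val_bool (tm_val (App f a) \<rho>) = val_bool (tm_val (App f' a') \<rho>')"
    by (simp add: elt_def)
qed

lemma eq_terms_Powr_App_Lam:
  assumes A: "eq_types \<Gamma> A A Set" and b: "eq_terms (A # \<Gamma>) b b P1" and a: "eq_terms \<Gamma> a a A"
  shows "eq_terms \<Gamma> (App (Lam b) a) (inst_tm 0 [a] b) P1"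
  unfolding eq_terms_P1
proof (intro allI impI)
  fix \<rho> \<rho>' assume env: "env_rel \<Gamma> \<rho> \<rho>'"
  have "ty_rel A \<rho> (realizer a \<rho>, VNone) (elt a \<rho>')"
    by (rule set_realizers[OF A env eq_termsD(1)[OF a env]]) (simp_all add: elt_def)
  then have "val_bool (tm_val b ((realizer a \<rho>, VNone) \<bullet> \<rho>)) = val_bool (tm_val b (elt a \<rho>' \<bullet> \<rho>'))"
    using b env unfolding eq_terms_P1 by simp
  then show "val_bool (tm_val (App (Lam b) a) \<rho>) = val_bool (tm_val (inst_tm 0 [a] b) \<rho>')"
    by (simp add: sem_simps)
qed

lemma eq_terms_Powr_eta:
  assumes f: "eq_terms \<Gamma> f f (Powr A)"
  shows "eq_terms \<Gamma> (Lam (App (rn_tm Suc f) (Var 0))) f (Powr A)"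
proof (rule eq_termsI[OF eq_terms_type[OF f]])
  fix \<rho> \<rho>' assume env: "env_rel \<Gamma> \<rho> \<rho>'"
  have "snd (elt (Lam (App (rn_tm Suc f) (Var 0))) \<rho>) = VFun (val_fun (tm_val f \<rho>))"
    by (simp add: elt_def rn_sem)
  then show "ty_rel (Powr A) \<rho> (elt (Lam (App (rn_tm Suc f) (Var 0))) \<rho>) (elt f \<rho>')"
    using eq_termsD(1)[OF f env] by (simp add: snd_elt)
qed

subsection \<open>The soundness theorem\<close>

text \<open>
  The inversion principle for quotient formation, carried along as a part of the validity of
  \<open>B IS k\<close>. Quotients enter such judgements only by formation and are preserved by substitution, so
  the principle is maintained by every rule.
\<close>

definition quotient_inv :: "ctx \<Rightarrow> ty \<Rightarrow> bool" where
  "quotient_inv \<Gamma> B \<longleftrightarrow> (\<forall>A R. B = Quot A R \<longrightarrow> quotient_data \<Gamma> A R)"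

fun valid :: "ctx \<Rightarrow> judgement \<Rightarrow> bool" where
  "valid \<Gamma> CTX = valid_ctx \<Gamma>"
| "valid \<Gamma> (A IS k) = (valid_ctx \<Gamma> \<and> eq_types \<Gamma> A A k \<and> quotient_inv \<Gamma> A)"
| "valid \<Gamma> (A EQ B IS k) = (valid_ctx \<Gamma> \<and> eq_types \<Gamma> A B k)"
| "valid \<Gamma> (a IN A) = (valid_ctx \<Gamma> \<and> eq_terms \<Gamma> a a A)"
| "valid \<Gamma> (a EQ b IN A) = (valid_ctx \<Gamma> \<and> eq_terms \<Gamma> a b A)"

lemma quotient_inv_trivial [simp]:
  "quotient_inv \<Gamma> BotP" "quotient_inv \<Gamma> (AndP A B)" "quotient_inv \<Gamma> (OrP A B)"
  "quotient_inv \<Gamma> (ImpP A B)" "quotient_inv \<Gamma> (ExP A B)" "quotient_inv \<Gamma> (AllP A B)"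
  "quotient_inv \<Gamma> (EqP A a b)" "quotient_inv \<Gamma> N0" "quotient_inv \<Gamma> N1" "quotient_inv \<Gamma> (ListS A)"
  "quotient_inv \<Gamma> (SumS A B)" "quotient_inv \<Gamma> (Sig A B)" "quotient_inv \<Gamma> (PiS A B)"
  "quotient_inv \<Gamma> P1" "quotient_inv \<Gamma> (Powr A)" "quotient_inv \<Gamma> (Quot A R) = quotient_data \<Gamma> A R"
  by (simp_all add: quotient_inv_def)

lemma quotient_inv_subst:
  assumes "quotient_inv \<Gamma> B"
    and "\<And>i. i < length \<Gamma> \<Longrightarrow> eq_terms \<Delta> (s i) (s i) (sb_ty s (lift_ty (Suc i) (\<Gamma> ! i)))"
  shows "quotient_inv \<Delta> (sb_ty s B)"
  using assms quotient_data_subst[OF _ assms(2)] by (cases B) auto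

lemma valid_subst:
  assumes "valid \<Gamma> J" "valid_ctx \<Delta>"
    and s: "\<And>i. i < length \<Gamma> \<Longrightarrow> eq_terms \<Delta> (s i) (s i) (sb_ty s (lift_ty (Suc i) (\<Gamma> ! i)))"
  shows "valid \<Delta> (sb_judgement s J)"
  using assms(1,2) eq_types_subst[OF _ s] eq_terms_subst[OF assms(2) _ s] quotient_inv_subst[OF _ s]
  by (cases J) auto

lemma holds_under_hypothesis:
  assumes "eq_terms (\<phi> # \<Gamma>) p q (rn_ty Suc \<chi>)" "eq_types \<Gamma> \<chi> \<chi> Prop"
    and "env_rel \<Gamma> \<rho> \<rho>'" "holds \<phi> \<rho>"
  shows "holds \<chi> \<rho>"
proof -
  have "env_rel (\<phi> # \<Gamma>) (undefined \<bullet> \<rho>) (undefined \<bullet> \<rho>')"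
    using assms(3,4) by simp
  from eq_termsD(1)[OF assms(1) this] have "ty_rel \<chi> \<rho> (elt p (undefined \<bullet> \<rho>)) (elt q (undefined \<bullet> \<rho>'))"
    by (simp add: rn_sem)
  then show ?thesis by (rule iffD1[OF ty_rel_prop[OF assms(2,3)]])
qed

lemma holds_under_witness:
  assumes "eq_terms (\<phi> # A # \<Gamma>) p q (rn_ty (\<lambda>i. Suc (Suc i)) \<chi>)" "eq_types \<Gamma> \<chi> \<chi> Prop"
    and "valid_ctx \<Gamma>" "env_rel \<Gamma> \<rho> \<rho>'" "ty_rel A \<rho> x x" "holds \<phi> (x \<bullet> \<rho>)"
  shows "holds \<chi> \<rho>"
proof -
  have "env_rel (\<phi> # A # \<Gamma>) (undefined \<bullet> x \<bullet> \<rho>) (undefined \<bullet> x \<bullet> \<rho>)"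
    using assms(5,6) env_rel_refl(1)[OF assms(3,4)] by simp
  from eq_termsD(1)[OF assms(1) this]
  have "ty_rel \<chi> \<rho> (elt p (undefined \<bullet> x \<bullet> \<rho>)) (elt q (undefined \<bullet> x \<bullet> \<rho>))"
    by (simp add: rn_sem)
  then show ?thesis by (rule iffD1[OF ty_rel_prop[OF assms(2,4)]])
qed

lemma eq_terms_all_intro:
  assumes A: "eq_types \<Gamma> A A Col" and \<phi>: "eq_types (A # \<Gamma>) \<phi> \<phi> Prop"
    and t: "eq_terms (A # \<Gamma>) TrueT TrueT \<phi>" and ctx: "valid_ctx \<Gamma>"
  shows "eq_terms \<Gamma> TrueT TrueT (AllP A \<phi>)"
proof (rule eq_terms_propI)
  show "eq_types \<Gamma> (AllP A \<phi>) (AllP A \<phi>) Prop"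
    by (rule eq_types_quantifiers[OF A \<phi>]) simp
  fix \<rho> \<rho>' assume env: "env_rel \<Gamma> \<rho> \<rho>'"
  have "holds \<phi> (x \<bullet> \<rho>)" if "ty_rel A \<rho> x x" for x
    by (rule eq_terms_prop_holds[OF t \<phi>, of _ "x \<bullet> \<rho>"]) (simp add: that env_rel_refl(1)[OF ctx env])
  then show "holds (AllP A \<phi>) \<rho>" by simp
qed

lemma eq_terms_all_elim:
  assumes A: "eq_types \<Gamma> A A Col" and \<phi>: "eq_types (A # \<Gamma>) \<phi> \<phi> Prop"
    and t: "eq_terms \<Gamma> TrueT TrueT (AllP A \<phi>)" and a: "eq_terms \<Gamma> a a A" and ctx: "valid_ctx \<Gamma>"
  shows "eq_terms \<Gamma> TrueT TrueT (inst_ty 0 [a] \<phi>)"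
proof (rule eq_terms_propI)
  show "eq_types \<Gamma> (inst_ty 0 [a] \<phi>) (inst_ty 0 [a] \<phi>) Prop"
    by (rule eq_types_inst[OF \<phi> a])
  fix \<rho> \<rho>' assume env: "env_rel \<Gamma> \<rho> \<rho>'"
  have "holds (AllP A \<phi>) \<rho>"
    by (rule eq_terms_prop_holds[OF t eq_types_quantifiers(2)[OF A \<phi>] env]) simp
  then show "holds (inst_ty 0 [a] \<phi>) \<rho>"
    using eq_termsD(1)[OF a env_rel_refl(1)[OF ctx env]] by (simp add: sem_simps)
qed

lemma eq_terms_ex_intro:
  assumes A: "eq_types \<Gamma> A A Col" and \<phi>: "eq_types (A # \<Gamma>) \<phi> \<phi> Prop"
    and a: "eq_terms \<Gamma> a a A" and t: "eq_terms \<Gamma> TrueT TrueT (inst_ty 0 [a] \<phi>)" and ctx: "valid_ctx \<Gamma>"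
  shows "eq_terms \<Gamma> TrueT TrueT (ExP A \<phi>)"
proof (rule eq_terms_propI)
  show "eq_types \<Gamma> (ExP A \<phi>) (ExP A \<phi>) Prop"
    by (rule eq_types_quantifiers[OF A \<phi>]) simp
  fix \<rho> \<rho>' assume env: "env_rel \<Gamma> \<rho> \<rho>'"
  have "holds (inst_ty 0 [a] \<phi>) \<rho>"
    by (rule eq_terms_prop_holds[OF t eq_types_inst[OF \<phi> a] env])
  then show "holds (ExP A \<phi>) \<rho>"
    using eq_termsD(1)[OF a env_rel_refl(1)[OF ctx env]] by (auto simp add: sem_simps)
qed

lemma eq_terms_ex_elim:
  assumes A: "eq_types \<Gamma> A A Col" and \<phi>: "eq_types (A # \<Gamma>) \<phi> \<phi> Prop" and \<chi>: "eq_types \<Gamma> \<chi> \<chi> Prop"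
    and t: "eq_terms \<Gamma> TrueT TrueT (ExP A \<phi>)"
    and s: "eq_terms (\<phi> # A # \<Gamma>) TrueT TrueT (rn_ty (\<lambda>i. Suc (Suc i)) \<chi>)" and ctx: "valid_ctx \<Gamma>"
  shows "eq_terms \<Gamma> TrueT TrueT \<chi>"
proof (rule eq_terms_propI[OF \<chi>])
  fix \<rho> \<rho>' assume env: "env_rel \<Gamma> \<rho> \<rho>'"
  have "holds (ExP A \<phi>) \<rho>"
    by (rule eq_terms_prop_holds[OF t eq_types_quantifiers(1)[OF A \<phi>] env]) simp
  then obtain x where "ty_rel A \<rho> x x" "holds \<phi> (x \<bullet> \<rho>)"
    unfolding ty_rel.simps by blast
  then show "holds \<chi> \<rho>"
    by (rule holds_under_witness[OF s \<chi> ctx env])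
qed

text \<open>
  Equality propositions denote the relation of the type; this validates both the introduction of
  \<open>Eq\<close> and reflection.
\<close>

lemma eq_terms_EqP_iff:
  assumes a: "eq_terms \<Gamma> a a A" and b: "eq_terms \<Gamma> b b A" and ctx: "valid_ctx \<Gamma>"
  shows "eq_terms \<Gamma> TrueT TrueT (EqP A a b) \<longleftrightarrow> eq_terms \<Gamma> a b A"
proof -
  have "eq_types \<Gamma> (EqP A a b) (EqP A a b) Prop"
    by (rule eq_types_EqP[OF eq_terms_type[OF a] a b]) simp
  note E = eq_terms_prop[OF this, unfolded ty_rel_EqP]
  have "ty_rel A \<rho> (elt a \<rho>) (elt b \<rho>) = ty_rel A \<rho> (elt a \<rho>) (elt b \<rho>')" if "env_rel \<Gamma> \<rho> \<rho>'" for \<rho> \<rho>'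
    using eq_termsD(1,2)[OF b that] admissible_trans admissible_sym by metis
  then show ?thesis
    unfolding E using eq_terms_type[OF a] unfolding eq_terms_def by blast
qed

lemma eq_types_Dc:
  assumes U: "eq_terms \<Gamma> U U' P1"
  shows "eq_types \<Gamma> (EqP P1 U (Code TopP)) (EqP P1 U' (Code TopP)) PropS"
proof (rule eq_types_EqP[OF eq_types_P1 U])
  show "eq_terms \<Gamma> (Code TopP) (Code TopP) P1"
    by (simp add: eq_terms_P1 TopP_def NegP_def)
qed simp

lemma eq_terms_Code:
  assumes "eq_types \<Gamma> \<phi> \<psi> PropS"
  shows "eq_terms \<Gamma> (Code \<phi>) (Code \<psi>) P1"
  using holds_eq[OF assms] by (simp add: eq_terms_P1)

text \<open>
  A code denotes the truth value of its proposition, so equality of codes is logical equivalence.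
\<close>

lemma eq_terms_Code_iff:
  assumes \<phi>: "eq_types \<Gamma> \<phi> \<phi> PropS" and \<psi>: "eq_types \<Gamma> \<psi> \<psi> PropS"
  shows "eq_terms \<Gamma> (Code \<phi>) (Code \<psi>) P1 \<longleftrightarrow> eq_terms \<Gamma> TrueT TrueT (IffP \<phi> \<psi>)"
proof -
  have "eq_types \<Gamma> (IffP \<phi> \<psi>) (IffP \<phi> \<psi>) Prop"
    unfolding IffP_def using eq_types_incl[OF \<phi>, of Prop] eq_types_incl[OF \<psi>, of Prop]
    by (simp add: eq_types_propositional)
  note E = eq_terms_prop[OF this]
  have "holds (IffP \<phi> \<psi>) \<rho> \<longleftrightarrow> holds \<phi> \<rho> = holds \<psi> \<rho>'" if "env_rel \<Gamma> \<rho> \<rho>'" for \<rho> \<rho>'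
    using holds_eq[OF \<psi> that] by (auto simp: IffP_def)
  then show ?thesis
    unfolding E eq_terms_P1 by auto
qed

lemma eq_terms_Code_Dc:
  assumes "eq_terms \<Gamma> U U P1"
  shows "eq_terms \<Gamma> U (Code (EqP P1 U (Code TopP))) P1"
  using assms by (simp add: eq_terms_P1 TopP_def NegP_def)

text \<open>
  The case of excluded middle holds because a proposition is evaluated to a truth value of the
  classical metalanguage.
\<close>

theorem soundness: "T \<rhd> \<Gamma> \<turnstile> J \<Longrightarrow> valid \<Gamma> J"
proof (induction rule: derivable.induct)
  case (var \<Gamma> i)
  then show ?case by (simp add: eq_terms_variable del: add_Suc_right)
next
  case (subst \<Gamma> J \<Delta> s)
  then show ?case by (intro valid_subst[of \<Gamma> J]) simp_all
next
  case (subst_eq_type \<Gamma> A k \<Delta> s s')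
  then show ?case by (auto intro: eq_types_subst)
next
  case (subst_eq_term \<Gamma> a A \<Delta> s s')
  then show ?case by (auto intro: eq_terms_subst)
next
  case (sym_type \<Gamma> A B k)
  then show ?case by (auto intro: eq_types_sym)
next
  case (trans_type \<Gamma> A B k C)
  then show ?case by (auto intro: eq_types_trans)
next
  case (sym_term \<Gamma> a b A)
  then show ?case by (auto intro: eq_terms_sym)
next
  case (trans_term \<Gamma> a b A c)
  then show ?case by (auto intro: eq_terms_trans)
next
  case (conv \<Gamma> a A B)
  then show ?case by (auto intro: eq_terms_conv)
next
  case (conv_eq \<Gamma> a b A B)
  then show ?case by (auto intro: eq_terms_conv)
next
  case (incl \<Gamma> A k k')
  then show ?case by (auto intro: eq_types_incl simp del: insert_iff)
next
  case (incl_eq \<Gamma> A B k k')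
  then show ?case by (auto intro: eq_types_incl simp del: insert_iff)
next
  case (ex_form \<Gamma> A d \<phi> k)
  then show ?case by (auto intro!: eq_types_quantifiers)
next
  case (ex_cong \<Gamma> A A' d \<phi> \<phi>' k)
  then show ?case by (auto intro!: eq_types_quantifiers)
next
  case (all_form \<Gamma> A d \<phi> k)
  then show ?case by (auto intro!: eq_types_quantifiers)
next
  case (all_cong \<Gamma> A A' d \<phi> \<phi>' k)
  then show ?case by (auto intro!: eq_types_quantifiers)
next
  case (eq_form \<Gamma> A d a b k)
  then show ?case by (auto intro!: eq_types_EqP)
next
  case (eq_cong \<Gamma> A A' d a a' b b' k)
  then show ?case by (auto intro!: eq_types_EqP)
next
  case (sig_form \<Gamma> A k B)
  then show ?case by (simp add: eq_types_Sig)
next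
  case (sig_cong \<Gamma> A A' k B B')
  then show ?case by (simp add: eq_types_Sig)
next
  case (quot_form \<Gamma> A R)
  then have A: "eq_types \<Gamma> A A Set" and R: "eq_types (rn_ty Suc A # A # \<Gamma>) R R PropS"
    and ctx: "valid_ctx \<Gamma>" and t: "eq_terms \<Gamma> TrueT TrueT (EquivP A R)" by simp_all
  have "holds (EquivP A R) \<rho>" if "env_rel \<Gamma> \<rho> \<rho>'" for \<rho> \<rho>'
    using eq_termsD(1)[OF t that] by (simp add: EquivP_def)
  then have "quotient_data \<Gamma> A R"
    by (rule quotient_dataI[OF A R])
  then show ?case using eq_types_Quot_refl[OF ctx] ctx by simp
next
  case (quot_cong \<Gamma> A A' R R')
  then have A: "eq_types \<Gamma> A A' Set" and R: "eq_types (rn_ty Suc A # A # \<Gamma>) R R' PropS"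
    and ctx: "valid_ctx \<Gamma>" and t: "eq_terms \<Gamma> TrueT TrueT (EquivP A R)" by simp_all
  have "holds (EquivP A R) \<rho>" if "env_rel \<Gamma> \<rho> \<rho>'" for \<rho> \<rho>'
    using eq_termsD(1)[OF t that] by (simp add: EquivP_def)
  then have "eq_types \<Gamma> (Quot A R) (Quot A' R') Set"
    by (rule eq_types_Quot[OF A R])
  then show ?case using ctx by simp
next
  case (prop_true \<Gamma> \<phi> p)
  then show ?case by (simp add: eq_terms_prop)
next
  case (prop_irrel \<Gamma> \<phi> p q)
  then show ?case by (simp add: eq_terms_prop)
next
  case (bot_elim \<Gamma> \<phi>)
  then show ?case using eq_terms_prop[OF eq_types_propositional(1)[of Prop]] by (auto simp: eq_terms_prop)
next
  case (or_elim \<Gamma> \<phi> \<psi> \<chi>)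
  then have "eq_types \<Gamma> \<phi> \<phi> Prop" "eq_types \<Gamma> \<psi> \<psi> Prop" and \<chi>: "eq_types \<Gamma> \<chi> \<chi> Prop"
    and "eq_terms \<Gamma> TrueT TrueT (OrP \<phi> \<psi>)"
    and s: "eq_terms (\<phi> # \<Gamma>) TrueT TrueT (rn_ty Suc \<chi>)" "eq_terms (\<psi> # \<Gamma>) TrueT TrueT (rn_ty Suc \<chi>)"
    by simp_all
  then have "holds \<phi> \<rho> \<or> holds \<psi> \<rho>" if "env_rel \<Gamma> \<rho> \<rho>'" for \<rho> \<rho>'
    using that by (simp add: eq_terms_prop eq_types_propositional; blast)
  then have "eq_terms \<Gamma> TrueT TrueT \<chi>"
    using holds_under_hypothesis[OF s(1) \<chi>] holds_under_hypothesis[OF s(2) \<chi>]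
    by (intro eq_terms_propI[OF \<chi>]) blast
  then show ?case using or_elim by simp
next
  case (imp_intro \<Gamma> \<phi> \<psi>)
  then show ?case
    using holds_under_hypothesis[of \<phi> \<Gamma> TrueT TrueT \<psi>]
    by (simp add: eq_terms_prop eq_types_propositional)
next
  case (imp_elim \<Gamma> \<phi> \<psi>)
  then show ?case by (simp add: eq_terms_prop eq_types_propositional; blast)
next
  case (or_intro1 \<Gamma> \<phi> \<psi>)
  then show ?case by (simp add: eq_terms_prop eq_types_propositional; blast)
next
  case (or_intro2 \<Gamma> \<phi> \<psi>)
  then show ?case by (simp add: eq_terms_prop eq_types_propositional; blast)
next
  case (and_intro \<Gamma> \<phi> \<psi>)
  then show ?case by (simp add: eq_terms_prop eq_types_propositional)
next
  case (and_elim1 \<Gamma> \<phi> \<psi>)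
  then show ?case by (simp add: eq_terms_prop eq_types_propositional; blast)
next
  case (and_elim2 \<Gamma> \<phi> \<psi>)
  then show ?case by (simp add: eq_terms_prop eq_types_propositional; blast)
next
  case (ex_intro \<Gamma> A \<phi> a)
  then show ?case using eq_terms_ex_intro by simp
next
  case (ex_elim \<Gamma> A \<phi> \<chi>)
  then show ?case using eq_terms_ex_elim[of \<Gamma> A \<phi> \<chi>] by simp
next
  case (all_intro \<Gamma> A \<phi>)
  then show ?case using eq_terms_all_intro by simp
next
  case (all_elim \<Gamma> A \<phi> a)
  then show ?case using eq_terms_all_elim[of \<Gamma> A \<phi> a] by simp
next
  case (eq_intro \<Gamma> A a)
  then show ?case by (simp add: eq_terms_EqP_iff)
next
  case (eq_reflection \<Gamma> A a b)
  then show ?case using eq_terms_EqP_iff[of \<Gamma> a A b] by simp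
next
  case (LEM \<Gamma> \<phi>)
  then show ?case by (simp add: eq_terms_prop eq_types_propositional NegP_def)
next
  case (N0_elim \<Gamma> L p)
  then show ?case using eq_terms_El0 by simp
next
  case (N0_elim_cong \<Gamma> L p p')
  then show ?case using eq_terms_El0 by simp
next
  case (N1_elim \<Gamma> L p c)
  then show ?case using eq_terms_El1 by simp
next
  case (N1_elim_cong \<Gamma> L p p' c c')
  then show ?case using eq_terms_El1 by simp
next
  case (list_elim \<Gamma> A L p a c)
  then show ?case using eq_terms_ElList[of \<Gamma> A L p p a a c c] by simp
next
  case (list_elim_cong \<Gamma> A L p p' a a' c c')
  then show ?case using eq_terms_ElList[of \<Gamma> A L p p' a a' c c'] by simp
next
  case (list_beta_cons \<Gamma> A L l b a c)
  then show ?case using eq_terms_ElList_ConsT[of \<Gamma> A L l b a c] by simp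
next
  case (sum_elim \<Gamma> A B L p d e)
  then show ?case using eq_terms_ElSum[of \<Gamma> A B L p p d d e e] by simp
next
  case (sum_elim_cong \<Gamma> A B L p p' d d' e e')
  then show ?case using eq_terms_ElSum[of \<Gamma> A B L p p' d d' e e'] by simp
next
  case (sum_beta_inl \<Gamma> A B L a d e)
  then show ?case using eq_terms_ElSum_InlT[of \<Gamma> A B L a d e] by simp
next
  case (sum_beta_inr \<Gamma> A B L b d e)
  then show ?case using eq_terms_ElSum_InrT[of \<Gamma> A B L b e d] by simp
next
  case (pair_intro \<Gamma> A B a b)
  then show ?case using eq_terms_PairT by simp
next
  case (pair_cong \<Gamma> A B a a' b b')
  then show ?case using eq_terms_PairT by simp
next
  case (sig_elim \<Gamma> A B L p m)
  then show ?case using eq_terms_ElSig[of \<Gamma> A B L p p m m] by simp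
next
  case (sig_elim_cong \<Gamma> A B L p p' m m')
  then show ?case using eq_terms_ElSig[of \<Gamma> A B L p p' m m'] by simp
next
  case (sig_beta \<Gamma> A B L a b m)
  then show ?case using eq_terms_ElSig_PairT[of \<Gamma> A B L a b m] by simp
next
  case (pi_elim \<Gamma> A B f a)
  then show ?case using eq_terms_App[of \<Gamma> A B f f a a] by simp
next
  case (pi_app_cong \<Gamma> A B f f' a a')
  then show ?case using eq_terms_App[of \<Gamma> A B f f' a a'] by simp
next
  case (pi_beta \<Gamma> A B b a)
  then show ?case using eq_terms_App_Lam[of \<Gamma> A B b a] by simp
next
  case (pi_eta \<Gamma> A B f)
  then show ?case using eq_terms_eta[of \<Gamma> A B f] by simp
next
  case (quot_intro \<Gamma> A R a)
  then show ?case using eq_terms_Cls_cong by simp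
next
  case (quot_cls_cong \<Gamma> A R a a')
  then show ?case using eq_terms_Cls_cong by simp
next
  case (quot_eq \<Gamma> A R a b)
  then show ?case using eq_terms_Cls_iff[of \<Gamma> A R a b] by simp
next
  case (quot_eff \<Gamma> A R a b)
  then show ?case using eq_terms_Cls_iff[of \<Gamma> A R a b] by simp
next
  case (quot_elim \<Gamma> A R L p l)
  then show ?case using eq_terms_ElQ[of \<Gamma> A R L p p l l] by simp
next
  case (quot_elim_cong \<Gamma> A R L p p' l l')
  then show ?case using eq_terms_ElQ[of \<Gamma> A R L p p' l l'] by simp
next
  case (quot_beta \<Gamma> A R L a l)
  then show ?case using eq_terms_ElQ_Cls[of \<Gamma> A R L a l] by simp
next
  case (powr_elim \<Gamma> A f a)
  then show ?case using eq_terms_Powr_App[of \<Gamma> f f A a a] by simp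
next
  case (powr_app_cong \<Gamma> A f f' a a')
  then show ?case using eq_terms_Powr_App[of \<Gamma> f f' A a a'] by simp
next
  case (powr_beta \<Gamma> A b a)
  then show ?case using eq_terms_Powr_App_Lam[of \<Gamma> A b a] by simp
next
  case (powr_eta \<Gamma> A f)
  then show ?case using eq_terms_Powr_eta[of \<Gamma> f A] by simp
next
  case (power_eta \<Gamma> U)
  then show ?case using eq_terms_Code_Dc[of \<Gamma> U] by simp
qed (simp_all add: eq_types_propositional eq_types_ListS eq_types_SumS eq_types_PiS eq_types_Powr
    eq_types_P1 eq_types_N0 eq_types_N1 eq_types_Dc eq_terms_Star eq_terms_El1_Star eq_terms_NilT
    eq_terms_ConsT eq_terms_ElList_NilT eq_terms_InlT eq_terms_InrT eq_terms_Lam eq_terms_Powr_Lam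
    eq_terms_Code eq_terms_Code_iff)

section \<open>Sets have countably many elements\<close>

instance ty :: countable by countable_datatype
instance tm :: countable by countable_datatype

text \<open>
  Closed types and terms are evaluated at some assignment; which one is immaterial.
\<close>

definition closed_env :: env where
  "closed_env = (\<lambda>_. (TrueT, VNone))"

text \<open>
  If \<open>s\<close> maps \<open>C\<close> to a set \<open>A\<close> and \<open>t\<close> maps back, then the realizer of \<open>s(y)\<close> determines \<open>s(y)\<close> up
  to the relation of \<open>A\<close>; hence it determines \<open>t(s(y))\<close>, which is \<open>y\<close>, up to the relation of \<open>C\<close>.
\<close>

lemma set_isomorphism_separates:
  assumes "isomorphic_to_some_set T C"
  shows "\<exists>f :: elt \<Rightarrow> tm. \<forall>y y'. ty_rel C closed_env y y \<longrightarrow> ty_rel C closed_env y' y' \<longrightarrow> f y = f y'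
    \<longrightarrow> ty_rel C closed_env y y'"
proof -
  obtain A t s where A: "T \<rhd> [] \<turnstile> A IS Set" and t: "T \<rhd> [A] \<turnstile> t IN rn_ty Suc C"
    and s: "T \<rhd> [C] \<turnstile> s IN rn_ty Suc A"
    and iso: "T \<rhd> [] \<turnstile> Holds (AndP
        (AllP A (EqP (rn_ty Suc A) (inst_tm 1 [t] s) (Var 0)))
        (AllP C (EqP (rn_ty Suc C) (inst_tm 1 [s] t) (Var 0))))"
    using assms unfolding isomorphic_to_some_set_def isomorphic_def by auto
  let ?\<rho> = closed_env
  let ?s = "\<lambda>y. elt s (y \<bullet> ?\<rho>)" and ?t = "\<lambda>x. elt t (x \<bullet> ?\<rho>)"
  have A: "eq_types [] A A Set" and t: "eq_terms [A] t t (rn_ty Suc C)"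
    and s: "eq_terms [C] s s (rn_ty Suc A)" and C: "eq_types [] C C Col"
    using soundness[OF A] soundness[OF t] soundness[OF s] by simp_all
  have round_trip: "ty_rel C ?\<rho> (?t (?s y)) y" if "ty_rel C ?\<rho> y y" for y
    using soundness[OF iso] eq_termsD(1)[of "[]" TrueT TrueT _ ?\<rho> ?\<rho>] that
    by (force simp: sem_simps ty_rel_EqP simp del: ty_rel.simps(7))
  have s_rel: "ty_rel A ?\<rho> (?s y) (?s y)" if "ty_rel C ?\<rho> y y" for y
    using eq_termsD(1)[OF s, of "y \<bullet> ?\<rho>" "y \<bullet> ?\<rho>"] that by (simp add: rn_sem)
  have t_rel: "ty_rel C ?\<rho> (?t x) (?t x')" if "ty_rel A ?\<rho> x x'" for x x'
    using eq_termsD(1)[OF t, of "x \<bullet> ?\<rho>" "x' \<bullet> ?\<rho>"] that by (simp add: rn_sem)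
  have adm: "admissible (ty_rel C ?\<rho>)"
    using eq_typesD(3)[OF C, of ?\<rho> ?\<rho>] by simp
  show ?thesis
  proof (intro exI[of _ "\<lambda>y. fst (?s y)"] allI impI)
    fix y y' assume y: "ty_rel C ?\<rho> y y" "ty_rel C ?\<rho> y' y'" "fst (?s y) = fst (?s y')"
    have "ty_rel A ?\<rho> (?s y) (?s y')"
      by (rule set_realizers[OF A _ s_rel[OF y(1)], of ?\<rho>]) (simp_all add: y)
    from t_rel[OF this] show "ty_rel C ?\<rho> y y'"
      using round_trip[OF y(1)] round_trip[OF y(2)] adm admissible_sym admissible_trans by metis
  qed
qed

text \<open>
  The cardinality argument: the realizers are raw terms, which are countable, so a collection with an
  uncountable family of pairwise different elements cannot be isomorphic to a set.
\<close>

lemma not_isomorphic_to_set: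
  fixes c :: "'i \<Rightarrow> elt"
  assumes "uncountable (UNIV :: 'i set)"
    and "\<And>i. ty_rel C closed_env (c i) (c i)"
    and "\<And>i j. ty_rel C closed_env (c i) (c j) \<Longrightarrow> i = j"
  shows "\<not> isomorphic_to_some_set T C"
proof
  assume "isomorphic_to_some_set T C"
  then obtain f :: "elt \<Rightarrow> tm" where f:
    "\<forall>y y'. ty_rel C closed_env y y \<longrightarrow> ty_rel C closed_env y' y' \<longrightarrow> f y = f y' \<longrightarrow> ty_rel C closed_env y y'"
    using set_isomorphism_separates by blast
  have "inj (\<lambda>i. to_nat (f (c i)))"
  proof (rule injI)
    fix i j assume "to_nat (f (c i)) = to_nat (f (c j))"
    then show "i = j" using f assms(2,3) by simp
  qed
  then show False using assms(1) by (auto simp: countable_def)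
qed


section \<open>The natural numbers of the model\<close>

inductive represents :: "tm \<Rightarrow> nat \<Rightarrow> bool" where
  represents_0: "r \<Down> NilT \<Longrightarrow> represents r 0"
| represents_Suc: "r \<Down> ConsT l b \<Longrightarrow> b \<Down> Star \<Longrightarrow> represents l n \<Longrightarrow> represents r (Suc n)"

lemma represents_unique: "represents r m \<Longrightarrow> represents r n \<Longrightarrow> m = n"
proof (induction arbitrary: n rule: represents.induct)
  case (represents_0 r)
  from represents_0(2,1) show ?case
    by cases (use evaluates_unique in blast)+
next
  case (represents_Suc r l b m)
  from represents_Suc(5) show ?case
  proof cases
    case represents_0
    then show ?thesis using represents_Suc(1) evaluates_unique by blast
  next
    case (represents_Suc l' b' n')
    have "ConsT l b = ConsT l' b'"
      using represents_Suc(2) \<open>r \<Down> ConsT l b\<close> evaluates_unique by blast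
    with represents_Suc represents_Suc.IH show ?thesis by auto
  qed
qed

lemma represents_steps: "r \<longrightarrow>* r' \<Longrightarrow> represents r' n \<Longrightarrow> represents r n"
  unfolding represents.simps[of r] represents.simps[of r'] by (simp add: evaluates_steps)

lemma represents_NilT: "represents NilT 0"
  by (rule represents_0) simp

lemma represents_SucT: "represents t n \<Longrightarrow> represents (SucT t) (Suc n)"
  unfolding SucT_def by (rule represents_Suc) auto

primrec numeral_tm :: "nat \<Rightarrow> tm" where
  "numeral_tm 0 = NilT"
| "numeral_tm (Suc n) = SucT (numeral_tm n)"

lemma represents_numeral_tm: "represents (numeral_tm n) n"
  by (induction n) (simp_all add: represents_NilT represents_SucT)

text \<open>
  The natural numbers are standard in the model: the elements of \<open>NatS\<close> are the realizers of
  natural numbers of the metalanguage.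
\<close>

lemma ty_rel_NatS: "ty_rel NatS \<rho> x y \<longleftrightarrow> (\<exists>n. represents (fst x) n \<and> represents (fst y) n)"
proof -
  let ?E = "\<lambda>b b'. b \<Down> Star \<and> b' \<Down> Star"
  have "list_related ?E r r' \<Longrightarrow> \<exists>n. represents r n \<and> represents r' n" for r r'
    by (induction rule: list_related.induct) (blast intro: represents.intros)+
  moreover have "represents r n \<Longrightarrow> represents r' n \<Longrightarrow> list_related ?E r r'" for r r' n
  proof (induction arbitrary: r' rule: represents.induct)
    case (represents_0 r)
    then show ?case by (auto elim: represents.cases intro: list_related_Nil)
  next
    case (represents_Suc r l b n)
    from represents_Suc(5) obtain l' b' where "r' \<Down> ConsT l' b'" "b' \<Down> Star" "represents l' n"
      by cases auto
    with represents_Suc show ?case by (blast intro: list_related_Cons)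
  qed
  ultimately show ?thesis by (auto simp: NatS_def)
qed

lemma NatS_closed [simp]: "rn_ty r NatS = NatS" "sb_ty s NatS = NatS"
  by (simp_all add: NatS_def)

lemma ty_rel_ProdS: "ty_rel (ProdS A B) \<rho> x y \<longleftrightarrow>
    (\<exists>a b a' b'. fst x \<Down> PairT a b \<and> fst y \<Down> PairT a' b' \<and>
      ty_rel A \<rho> (a, val_fst (snd x)) (a', val_fst (snd y)) \<and>
      ty_rel B \<rho> (b, val_snd (snd x)) (b', val_snd (snd y)))"
  by (simp add: ProdS_def rn_sem)

lemma holds_Ex1P: "holds (Ex1P A \<phi>) \<rho> \<longleftrightarrow>
    (\<exists>x. ty_rel A \<rho> x x \<and> holds \<phi> (x \<bullet> \<rho>) \<and>
      (\<forall>y. ty_rel A \<rho> y y \<longrightarrow> holds \<phi> (y \<bullet> \<rho>) \<longrightarrow> ty_rel A \<rho> y x))"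
  by (simp add: Ex1P_def sem_simps ty_rel_EqP del: ty_rel.simps(7))

lemma holds_memP: "holds (memP a V) \<rho> \<longleftrightarrow> val_fun (tm_val V \<rho>) (realizer a \<rho>)"
  by (simp add: memP_def Dc_def TopP_def NegP_def)


section \<open>Functional relations\<close>

text \<open>
  The graph of the indicator function of a set of natural numbers, as a predicate on realizers. The
  set is arbitrary, so the graph is in general not decided by any realizer.
\<close>

definition indicator_graph :: "nat set \<Rightarrow> tm \<Rightarrow> bool" where
  "indicator_graph X r \<longleftrightarrow>
     (\<exists>p q n. r \<Down> PairT p q \<and> represents p n \<and> represents q (of_bool (n \<in> X)))"

definition indicator_elt :: "nat set \<Rightarrow> elt" where
  "indicator_elt X = (PairT TrueT TrueT, VPair (VFun (indicator_graph X)) VNone)"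

lemma indicator_graph_PairT:
  assumes "represents p n" "represents q m"
  shows "indicator_graph X (PairT p q) \<longleftrightarrow> m = of_bool (n \<in> X)"
proof
  assume "indicator_graph X (PairT p q)"
  then obtain n' where n': "represents p n'" "represents q (of_bool (n' \<in> X))"
    by (auto simp: indicator_graph_def)
  show "m = of_bool (n \<in> X)"
    using represents_unique[OF assms(1) n'(1)] represents_unique[OF assms(2) n'(2)] by simp
next
  assume "m = of_bool (n \<in> X)"
  then show "indicator_graph X (PairT p q)"
    using assms by (auto simp: indicator_graph_def)
qed

lemma indicator_graph_cong:
  assumes "ty_rel (ProdS NatS NatS) \<rho> x y"
  shows "indicator_graph X (fst x) = indicator_graph X (fst y)"
proof -
  obtain p q p' q' n m where ev: "fst x \<Down> PairT p q" "fst y \<Down> PairT p' q'"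
    and rep: "represents p n" "represents p' n" "represents q m" "represents q' m"
    using assms by (auto simp: ty_rel_ProdS ty_rel_NatS)
  have "indicator_graph X (fst x) = indicator_graph X (PairT p q)"
    "indicator_graph X (fst y) = indicator_graph X (PairT p' q')"
    using ev[THEN iffD1[OF evaluates_def], THEN conjunct1, THEN evaluates_steps]
    by (simp_all add: indicator_graph_def)
  with rep show ?thesis by (simp add: indicator_graph_PairT)
qed

text \<open>
  Functional relations are subsets of \<open>\<nat> \<times> \<nat>\<close>, so they are given by values and the indicator functions
  of all sets are among them; they are compared extensionally, so different sets give different
  elements. The second component of the pair is a proof and thus irrelevant.
\<close>

lemma ty_rel_indicator_elt: "ty_rel (FunRel NatS NatS) \<rho> (indicator_elt X) (indicator_elt Y) \<longleftrightarrow> X = Y"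
proof
  assume "ty_rel (FunRel NatS NatS) \<rho> (indicator_elt X) (indicator_elt Y)"
  then have graph: "indicator_graph X (fst x) = indicator_graph Y (fst y)"
    if "ty_rel (ProdS NatS NatS) \<rho> x y" for x y
    using that unfolding FunRel_def indicator_elt_def by simp
  have "n \<in> X \<longleftrightarrow> n \<in> Y" for n
  proof -
    \<comment> \<open>Membership of \<open>n\<close> is read off at the pair \<open>\<langle>n, 1\<rangle>\<close>.\<close>
    let ?x = "(PairT (numeral_tm n) (SucT NilT), VNone)"
    have one: "represents (SucT NilT) 1"
      using represents_SucT[OF represents_NilT] by simp
    have "ty_rel (ProdS NatS NatS) \<rho> ?x ?x"
      using represents_numeral_tm one by (auto simp: ty_rel_ProdS ty_rel_NatS)
    from graph[OF this] have "(1::nat) = of_bool (n \<in> X) \<longleftrightarrow> (1::nat) = of_bool (n \<in> Y)"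
      unfolding fst_conv indicator_graph_PairT[OF represents_numeral_tm one] .
    then show ?thesis by (cases "n \<in> X"; cases "n \<in> Y") simp_all
  qed
  then show "X = Y" by auto
next
  assume "X = Y"
  let ?V = "VFun (indicator_graph Y)"
  have total: "\<exists>y. ty_rel NatS (x \<bullet> \<rho>') y y \<and> indicator_graph Y (PairT (fst x) (fst y)) \<and>
      (\<forall>z. ty_rel NatS (x \<bullet> \<rho>') z z \<longrightarrow> indicator_graph Y (PairT (fst x) (fst z)) \<longrightarrow> ty_rel NatS (x \<bullet> \<rho>') z y)"
    if x: "ty_rel NatS \<rho>' x x" for x \<rho>'
  proof -
    obtain n where n: "represents (fst x) n" using x by (auto simp: ty_rel_NatS)
    let ?m = "of_bool (n \<in> Y)"
    note m = represents_numeral_tm[of ?m]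
    show ?thesis
    proof (intro exI[of _ "(numeral_tm ?m, VNone)"] conjI allI impI)
      show "ty_rel NatS (x \<bullet> \<rho>') (numeral_tm ?m, VNone) (numeral_tm ?m, VNone)"
        unfolding ty_rel_NatS fst_conv using m by blast
      show "indicator_graph Y (PairT (fst x) (fst (numeral_tm ?m, VNone)))"
        unfolding fst_conv indicator_graph_PairT[OF n m] ..
      fix z assume "ty_rel NatS (x \<bullet> \<rho>') z z"
      then obtain k where k: "represents (fst z) k" unfolding ty_rel_NatS by blast
      assume "indicator_graph Y (PairT (fst x) (fst z))"
      then have "k = ?m" unfolding indicator_graph_PairT[OF n k] .
      then show "ty_rel NatS (x \<bullet> \<rho>') z (numeral_tm ?m, VNone)"
        unfolding ty_rel_NatS fst_conv using k m by blast
    qed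
  qed
  show "ty_rel (FunRel NatS NatS) \<rho> (indicator_elt X) (indicator_elt Y)"
    unfolding FunRel_def indicator_elt_def \<open>X = Y\<close>
    using total by (simp add: holds_Ex1P holds_memP indicator_graph_cong numeral_2_eq_2)
qed

lemma uncountable_nat_set: "uncountable (UNIV :: nat set set)"
proof
  assume "countable (UNIV :: nat set set)"
  then obtain f :: "nat set \<Rightarrow> nat" where "inj f" by (auto simp: countable_def)
  then have "range (inv f) = UNIV" by (simp add: inj_imp_surj_inv)
  then show False using Cantors_theorem[of "UNIV :: nat set"] by (metis Pow_UNIV)
qed

theorem FunRel_not_isomorphic_to_set: "\<not> isomorphic_to_some_set T (FunRel NatS NatS)"
  by (rule not_isomorphic_to_set[OF uncountable_nat_set, of _ indicator_elt])
     (simp_all add: ty_rel_indicator_elt)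

section \<open>The rational numbers of the model\<close>

lemma sb_arith:
  "sb_tm s (SucT m) = SucT (sb_tm s m)"
  "sb_tm s (plusT m n) = plusT (sb_tm s m) (sb_tm s n)"
  "sb_tm s (timesT m n) = timesT (sb_tm s m) (sb_tm s n)"
  "sb_tm s (fstT p) = fstT (sb_tm s p)"
  "sb_tm s (sndT p) = sndT (sb_tm s p)"
  "sb_tm s (cross p q) = cross (sb_tm s p) (sb_tm s q)"
  by (simp_all add: SucT_def plusT_def timesT_def fstT_def sndT_def cross_def sb_rn rn_sb rn_rn
      numeral_3_eq_3 eval_nat_numeral)

lemma represents_plusT: "represents n j \<Longrightarrow> represents m i \<Longrightarrow> represents (plusT m n) (i + j)"
proof (induction rule: represents.induct)
  case (represents_0 n)
  then show ?case
    using represents_steps[OF ElList_steps(1)] by (simp add: plusT_def)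
next
  case (represents_Suc n l b j)
  have "plusT m n \<longrightarrow>* SucT (plusT m l)"
    using ElList_steps(2)[OF represents_Suc(1), of m "SucT (Var 0)"] by (simp add: plusT_def SucT_def)
  then show ?case
    using represents_steps represents_SucT represents_Suc by simp
qed

lemma represents_timesT: "represents n j \<Longrightarrow> represents m i \<Longrightarrow> represents (timesT m n) (i * j)"
proof (induction rule: represents.induct)
  case (represents_0 n)
  then show ?case
    using represents_steps[OF ElList_steps(1) represents_NilT] by (simp add: timesT_def)
next
  case (represents_Suc n l b j)
  have "timesT m n \<longrightarrow>* plusT (timesT m l) m"
    using ElList_steps(2)[OF represents_Suc(1), of NilT "plusT (Var 0) (lift_tm 3 m)"]
    by (simp add: timesT_def sb_arith sb_rn numeral_3_eq_3)
  moreover have "represents (plusT (timesT m l) m) (i * j + i)"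
    using represents_plusT represents_Suc by blast
  ultimately show ?case
    using represents_steps by (simp add: algebra_simps)
qed

lemma represents_projections:
  assumes "p \<Down> PairT a b"
  shows "represents a n \<Longrightarrow> represents (fstT p) n" "represents b n \<Longrightarrow> represents (sndT p) n"
  using ElSig_steps[OF assms, of "Var 1"] ElSig_steps[OF assms, of "Var 0"]
  by (simp_all add: fstT_def sndT_def represents_steps)

text \<open>
  The realizers of the triples \<open>\<langle>\<langle>a, b\<rangle>, c\<rangle>\<close> that represent fractions, and the rational numbers which
  they stand for. Comparing cross products of natural numbers amounts to comparing these rational
  numbers, by \<open>cross_eq_iff\<close> and \<open>cross_less_iff\<close>.
\<close>

definition fraction :: "tm \<Rightarrow> nat \<Rightarrow> nat \<Rightarrow> nat \<Rightarrow> bool" where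
  "fraction r a b c \<longleftrightarrow> (\<exists>p k i j. r \<Down> PairT p k \<and> p \<Down> PairT i j \<and>
     represents i a \<and> represents j b \<and> represents k c)"

definition fraction_value :: "nat \<Rightarrow> nat \<Rightarrow> nat \<Rightarrow> rat" where
  "fraction_value a b c = (of_nat a - of_nat b) / (of_nat c + 1)"

lemma fraction_unique:
  assumes "fraction r a b c" "fraction r a' b' c'"
  shows "a = a'" "b = b'" "c = c'"
proof -
  obtain p k i j p' k' i' j' where
    r: "r \<Down> PairT p k" "p \<Down> PairT i j" "represents i a" "represents j b" "represents k c"
       "r \<Down> PairT p' k'" "p' \<Down> PairT i' j'" "represents i' a'" "represents j' b'" "represents k' c'"
    using assms unfolding fraction_def by blast
  have "p = p'" "k = k'" using evaluates_unique[OF r(1,6)] by simp_all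
  moreover from this have "i = i'" "j = j'" using evaluates_unique[OF r(2), of "PairT i' j'"] r(7) by simp_all
  ultimately show "a = a'" "b = b'" "c = c'" using r represents_unique by blast+
qed

lemma steps_projections: "p \<Down> PairT a b \<Longrightarrow> fstT p \<longrightarrow>* a"
  using ElSig_steps[of p a b "Var 1"] by (simp add: fstT_def)

lemma represents_cross:
  assumes "fraction p a b c" "fraction q a' b' c'"
  shows "represents (cross p q) (a * Suc c' + b' * Suc c)"
proof -
  have parts: "represents (fstT (fstT r)) a" "represents (sndT (fstT r)) b" "represents (sndT r) c"
    if fr: "fraction r a b c" for r a b c
  proof -
    obtain p k i j where r: "r \<Down> PairT p k" "p \<Down> PairT i j" "represents i a" "represents j b" "represents k c"
      using fr unfolding fraction_def by blast
    have "fstT r \<Down> PairT i j"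
      using evaluates_steps[OF steps_projections[OF r(1)]] r(2) by simp
    with r show "represents (fstT (fstT r)) a" "represents (sndT (fstT r)) b" "represents (sndT r) c"
      by (auto intro: represents_projections)
  qed
  show ?thesis
    unfolding cross_def using parts[OF assms(1)] parts[OF assms(2)]
    by (intro represents_plusT represents_timesT represents_SucT)
qed

lemma cross_eq_iff: "a * Suc c' + b' * Suc c = a' * Suc c + b * Suc c'
    \<longleftrightarrow> fraction_value a b c = fraction_value a' b' c'" (is "?m = ?n \<longleftrightarrow> _")
  and cross_less_iff: "a * Suc c' + b' * Suc c < a' * Suc c + b * Suc c'
    \<longleftrightarrow> fraction_value a b c < fraction_value a' b' c'"
proof -
  have pos: "(of_nat c + 1 :: rat) > 0" "(of_nat c' + 1 :: rat) > 0"
    by (simp_all add: add_nonneg_pos)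
  have m: "of_nat ?m = of_nat a * (of_nat c' + 1) + of_nat b' * (of_nat c + 1 :: rat)"
    and n: "of_nat ?n = of_nat a' * (of_nat c + 1) + of_nat b * (of_nat c' + 1 :: rat)"
    by (simp_all add: algebra_simps)
  have "?m = ?n \<longleftrightarrow> (of_nat ?m :: rat) = of_nat ?n" by (rule of_nat_eq_iff[symmetric])
  also have "\<dots> \<longleftrightarrow> fraction_value a b c = fraction_value a' b' c'"
    using pos unfolding m n fraction_value_def by (simp add: frac_eq_eq algebra_simps; linarith)
  finally show "?m = ?n \<longleftrightarrow> fraction_value a b c = fraction_value a' b' c'" .
  have "?m < ?n \<longleftrightarrow> (of_nat ?m :: rat) < of_nat ?n" by (rule of_nat_less_iff[symmetric])
  also have "\<dots> \<longleftrightarrow> fraction_value a b c < fraction_value a' b' c'"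
    using pos unfolding m n fraction_value_def by (simp add: divide_less_eq less_divide_eq field_simps; linarith)
  finally show "?m < ?n \<longleftrightarrow> fraction_value a b c < fraction_value a' b' c'" .
qed

lemma ty_rel_Frac: "ty_rel Frac \<rho> x y \<longleftrightarrow> (\<exists>a b c. fraction (fst x) a b c \<and> fraction (fst y) a b c)"
  unfolding Frac_def ty_rel_ProdS ty_rel_NatS fraction_def fst_conv by blast

definition represents_rat :: "tm \<Rightarrow> rat \<Rightarrow> bool" where
  "represents_rat r u \<longleftrightarrow> (\<exists>p a b c. r \<Down> Cls p \<and> fraction p a b c \<and> u = fraction_value a b c)"

lemma represents_rat_unique: "represents_rat r u \<Longrightarrow> represents_rat r v \<Longrightarrow> u = v"
  unfolding represents_rat_def using evaluates_unique fraction_unique by (metis tm.inject(13))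

lemma represents_rat_exists: "\<exists>r. represents_rat r u"
proof -
  obtain i j where u: "u = Fract i j" and j: "j > 0" by (cases u)
  let ?a = "nat i" and ?b = "nat (- i)" and ?c = "nat j - 1"
  have "u = fraction_value ?a ?b ?c"
  proof -
    \<comment> \<open>The numerator is the difference of the positive and the negative part of \<open>i\<close>.\<close>
    have "(of_nat ?a - of_nat ?b :: rat) = of_int i" by (cases "i \<ge> 0") simp_all
    moreover have "(of_nat ?c + 1 :: rat) = of_int j" using j by (simp add: of_nat_diff)
    ultimately show ?thesis unfolding fraction_value_def u by (simp add: Fract_of_int_quotient)
  qed
  moreover have "fraction (PairT (PairT (numeral_tm ?a) (numeral_tm ?b)) (numeral_tm ?c)) ?a ?b ?c"
    unfolding fraction_def using represents_numeral_tm by (auto simp del: numeral_tm.simps)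
  moreover have "Cls p \<Down> Cls p" for p by simp
  ultimately show ?thesis
    unfolding represents_rat_def by blast
qed

text \<open>
  The elements of \<open>RatS\<close> are the rational numbers of the metalanguage, because equality of the cross
  products is equality of the represented fractions.
\<close>

lemma ty_rel_RatS: "ty_rel RatS \<rho> x y \<longleftrightarrow> (\<exists>u. represents_rat (fst x) u \<and> represents_rat (fst y) u)"
proof -
  have eq: "holds (EqP NatS (cross (Var 1) (Var 0)) (cross (Var 0) (Var 1))) ((q, VNone) \<bullet> (p, VNone) \<bullet> \<rho>)
      \<longleftrightarrow> fraction_value a b c = fraction_value a' b' c'"
    if "fraction p a b c" "fraction q a' b' c'" for p q a b c a' b' c'
  proof -
    have rep: "represents (cross p q) (a * Suc c' + b' * Suc c)" "represents (cross q p) (a' * Suc c + b * Suc c')"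
      using represents_cross that by blast+
    then have "(\<exists>n. represents (cross p q) n \<and> represents (cross q p) n)
        \<longleftrightarrow> a * Suc c' + b' * Suc c = a' * Suc c + b * Suc c'"
      using represents_unique by metis
    then show ?thesis
      unfolding cross_eq_iff by (simp add: ty_rel_NatS sb_arith)
  qed
  show ?thesis
  proof
    assume "ty_rel RatS \<rho> x y"
    then obtain p q where ev: "fst x \<Down> Cls p" "fst y \<Down> Cls q"
      and Fr: "ty_rel Frac \<rho> (p, VNone) (p, VNone)" "ty_rel Frac \<rho> (q, VNone) (q, VNone)"
      and R: "holds (EqP NatS (cross (Var 1) (Var 0)) (cross (Var 0) (Var 1))) ((q, VNone) \<bullet> (p, VNone) \<bullet> \<rho>)"
      unfolding RatS_def by auto
    obtain a b c a' b' c' where fr: "fraction p a b c" "fraction q a' b' c'"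
      using Fr by (auto simp: ty_rel_Frac)
    then show "\<exists>u. represents_rat (fst x) u \<and> represents_rat (fst y) u"
      using eq[OF fr] R ev unfolding represents_rat_def by metis
  next
    assume "\<exists>u. represents_rat (fst x) u \<and> represents_rat (fst y) u"
    then obtain p q a b c a' b' c' where ev: "fst x \<Down> Cls p" "fst y \<Down> Cls q"
      and fr: "fraction p a b c" "fraction q a' b' c'" and u: "fraction_value a b c = fraction_value a' b' c'"
      unfolding represents_rat_def by auto
    have "ty_rel Frac \<rho> (p, VNone) (p, VNone)" "ty_rel Frac \<rho> (q, VNone) (q, VNone)"
      using fr by (auto simp: ty_rel_Frac)
    with ev eq[OF fr] u show "ty_rel RatS \<rho> x y"
      unfolding RatS_def ty_rel.simps(14) by blast
  qed
qed

lemma RatS_closed [simp]: "rn_ty r RatS = RatS" "sb_ty s RatS = RatS" and Frac_closed [simp]: "rn_ty r Frac = Frac"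
  by (simp_all add: RatS_def Frac_def ProdS_def NatS_def cross_def plusT_def timesT_def fstT_def sndT_def SucT_def eval_nat_numeral)

lemma holds_lessN:
  assumes "represents (realizer m \<rho>) i" "represents (realizer n \<rho>) j"
  shows "holds (lessN m n) \<rho> \<longleftrightarrow> i < j"
proof -
  have sum: "(\<exists>l. represents (plusT (realizer m \<rho>) (SucT (fst x))) l \<and> represents (realizer n \<rho>) l) \<longleftrightarrow> i + Suc k = j"
    if "represents (fst x) k" for x :: elt and k
    using represents_plusT[OF represents_SucT[OF that] assms(1)] assms(2) represents_unique by metis
  have "holds (lessN m n) \<rho> \<longleftrightarrow> (\<exists>(x :: elt) k. represents (fst x) k \<and>
      (\<exists>l. represents (plusT (realizer m \<rho>) (SucT (fst x))) l \<and> represents (realizer n \<rho>) l))"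
    by (simp add: lessN_def ty_rel_NatS sb_arith sb_rn)
  also have "\<dots> \<longleftrightarrow> (\<exists>k. i + Suc k = j)"
    using sum represents_numeral_tm by (metis fst_conv)
  also have "\<dots> \<longleftrightarrow> i < j" by (auto simp: less_iff_Suc_add)
  finally show ?thesis .
qed

text \<open>
  The order of the theory is defined through some representatives of both classes; by
  \<open>cross_less_iff\<close> the comparison of representatives depends only on the rational numbers.
\<close>

lemma holds_lessQ:
  assumes q: "represents_rat (realizer q \<rho>) u" and r: "represents_rat (realizer r \<rho>) v"
  shows "holds (lessQ q r) \<rho> \<longleftrightarrow> u < v"
proof -
  have less: "holds (lessN (cross (Var 1) (Var 0)) (cross (Var 0) (Var 1))) (y \<bullet> x \<bullet> \<rho>)
      \<longleftrightarrow> fraction_value a b c < fraction_value a' b' c'"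
    if "fraction (fst x) a b c" "fraction (fst y) a' b' c'" for x y a b c a' b' c'
    unfolding cross_less_iff[symmetric]
    by (rule holds_lessN) (use that represents_cross in \<open>simp_all add: sb_arith\<close>)
  have Cls: "represents_rat (Cls p) w \<longleftrightarrow> (\<exists>a b c. fraction p a b c \<and> w = fraction_value a b c)" for p w
    by (auto simp: represents_rat_def)
  have "holds (lessQ q r) \<rho> \<longleftrightarrow> (\<exists>x y. ty_rel Frac \<rho> x x \<and> ty_rel Frac (x \<bullet> \<rho>) y y \<and>
      represents_rat (Cls (fst x)) u \<and> represents_rat (Cls (fst y)) v \<and>
      holds (lessN (cross (Var 1) (Var 0)) (cross (Var 0) (Var 1))) (y \<bullet> x \<bullet> \<rho>))"
  proof -
    have "(\<exists>w. represents_rat (Cls p) w \<and> represents_rat (realizer q \<rho>) w) \<longleftrightarrow> represents_rat (Cls p) u"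
      "(\<exists>w. represents_rat (Cls p) w \<and> represents_rat (realizer r \<rho>) w) \<longleftrightarrow> represents_rat (Cls p) v" for p
      using q r represents_rat_unique by blast+
    then show ?thesis
      unfolding lessQ_def by (simp add: ty_rel_RatS sb_rn numeral_2_eq_2 del: ty_rel.simps(14))
  qed
  also have "\<dots> \<longleftrightarrow> u < v"
  proof
    assume "\<exists>x y. ty_rel Frac \<rho> x x \<and> ty_rel Frac (x \<bullet> \<rho>) y y \<and>
      represents_rat (Cls (fst x)) u \<and> represents_rat (Cls (fst y)) v \<and>
      holds (lessN (cross (Var 1) (Var 0)) (cross (Var 0) (Var 1))) (y \<bullet> x \<bullet> \<rho>)"
    then show "u < v" unfolding Cls using less by blast
  next
    assume "u < v"
    have "\<exists>p. represents_rat (Cls p) w" if "represents_rat r w" for r w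
      using that unfolding Cls represents_rat_def[of r] by blast
    then obtain p q where "represents_rat (Cls p) u" "represents_rat (Cls q) v"
      using assms by blast
    then obtain a b c a' b' c' where fr: "fraction p a b c" "fraction q a' b' c'"
      "u = fraction_value a b c" "v = fraction_value a' b' c'" unfolding Cls by blast
    then have "holds (lessN (cross (Var 1) (Var 0)) (cross (Var 0) (Var 1))) ((q, VNone) \<bullet> (p, VNone) \<bullet> \<rho>)"
      using less[of "(p, VNone)" a b c "(q, VNone)" a' b' c'] \<open>u < v\<close> by simp
    with fr show "\<exists>x y. ty_rel Frac \<rho> x x \<and> ty_rel Frac (x \<bullet> \<rho>) y y \<and>
      represents_rat (Cls (fst x)) u \<and> represents_rat (Cls (fst y)) v \<and>
      holds (lessN (cross (Var 1) (Var 0)) (cross (Var 0) (Var 1))) (y \<bullet> x \<bullet> \<rho>)"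
      unfolding Cls ty_rel_Frac by (intro exI[of _ "(p, VNone)"] exI[of _ "(q, VNone)"]) auto
  qed
  finally show ?thesis .
qed


section \<open>Dedekind cuts\<close>

definition cut :: "real \<Rightarrow> tm \<Rightarrow> bool" where
  "cut x r \<longleftrightarrow> (\<exists>u. represents_rat r u \<and> of_rat u < x)"

definition cut_elt :: "real \<Rightarrow> elt" where
  "cut_elt x = (PairT TrueT TrueT, VPair (VFun (cut x)) VNone)"

lemma cut_iff: "represents_rat r u \<Longrightarrow> cut x r \<longleftrightarrow> of_rat u < x"
  unfolding cut_def using represents_rat_unique by blast

lemma holds_AllQ: "holds (AllQ V \<phi>) \<rho> \<longleftrightarrow>
    (\<forall>q. ty_rel RatS \<rho> q q \<longrightarrow> val_fun (tm_val V \<rho>) (fst q) \<longrightarrow> holds \<phi> (q \<bullet> \<rho>))"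
  and holds_ExQ: "holds (ExQ V \<phi>) \<rho> \<longleftrightarrow>
    (\<exists>q. ty_rel RatS \<rho> q q \<and> val_fun (tm_val V \<rho>) (fst q) \<and> holds \<phi> (q \<bullet> \<rho>))"
  by (simp_all add: AllQ_def ExQ_def holds_memP rn_sem)

text \<open>
  As the rational numbers and their order are standard in the model, the lower cut of any real number
  satisfies the four axioms of a Dedekind cut there; each is a consequence of the density of the
  rational numbers or of transitivity. Density also recovers the real number from its cut.
\<close>

lemma ty_rel_cut_elt: "ty_rel Reals \<rho> (cut_elt x) (cut_elt y) \<longleftrightarrow> x = y"
proof
  assume "ty_rel Reals \<rho> (cut_elt x) (cut_elt y)"
  then have eq: "cut x (fst p) = cut y (fst q)" if "ty_rel RatS \<rho> p q" for p q
    using that unfolding Reals_def cut_elt_def by simp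
  have "of_rat u < x \<longleftrightarrow> of_rat u < y" for u
  proof -
    obtain r where r: "represents_rat r u" using represents_rat_exists by blast
    then show ?thesis
      using eq[of "(r, VNone)" "(r, VNone)"] by (auto simp: ty_rel_RatS cut_iff)
  qed
  then show "x = y"
    using of_rat_dense by (metis linorder_neqE_linordered_idom order_less_asym)
next
  assume "x = y"
  have rat: "\<exists>p. represents_rat (fst p) u \<and> ty_rel RatS \<rho>' p p" for u \<rho>'
  proof -
    obtain r where "represents_rat r u" using represents_rat_exists by blast
    then show ?thesis unfolding ty_rel_RatS by (intro exI[of _ "(r, VNone)"]) auto
  qed
  let ?\<rho> = "(TrueT, VFun (cut y)) \<bullet> \<rho>"
  have inhabited: "\<exists>p. ty_rel RatS ?\<rho> p p \<and> cut y (fst p)"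
  proof -
    obtain u where "of_rat u < y" using of_rat_dense[of "y - 1" y] by auto
    with rat[of u ?\<rho>] show ?thesis using cut_iff by blast
  qed
  have bounded: "\<exists>p. ty_rel RatS ?\<rho> p p \<and> \<not> cut y (fst p)"
  proof -
    obtain u where "y < of_rat u" using of_rat_dense[of y "y + 1"] by auto
    with rat[of u ?\<rho>] show ?thesis using cut_iff order_less_asym by blast
  qed
  have downward: "cut y (fst r)"
    if q: "ty_rel RatS ?\<rho> q q" "cut y (fst q)" and r: "ty_rel RatS (q \<bullet> ?\<rho>) r r"
      and less: "holds (lessQ (Var 0) (Var 1)) (r \<bullet> q \<bullet> ?\<rho>)" for q r
  proof -
    obtain u v where u: "represents_rat (fst q) u" and v: "represents_rat (fst r) v"
      using q(1) r unfolding ty_rel_RatS by blast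
    have "v < u"
      using less u v by (simp add: holds_lessQ[of _ _ v _ u])
    then have "(of_rat v :: real) < of_rat u" by (simp add: of_rat_less)
    with q(2) show ?thesis unfolding cut_iff[OF u] cut_iff[OF v] by simp
  qed
  have open_end: "\<exists>r. ty_rel RatS (q \<bullet> ?\<rho>) r r \<and> cut y (fst r) \<and> holds (lessQ (Var 1) (Var 0)) (r \<bullet> q \<bullet> ?\<rho>)"
    if q: "ty_rel RatS ?\<rho> q q" "cut y (fst q)" for q
  proof -
    obtain u where u: "represents_rat (fst q) u"
      using q(1) unfolding ty_rel_RatS by blast
    obtain v where v: "of_rat u < (of_rat v :: real)" "of_rat v < y"
      using of_rat_dense q(2) unfolding cut_iff[OF u] by blast
    obtain r where r: "represents_rat (fst r) v" "ty_rel RatS (q \<bullet> ?\<rho>) r r"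
      using rat by blast
    have "holds (lessQ (Var 1) (Var 0)) (r \<bullet> q \<bullet> ?\<rho>)"
      using u r(1) v(1) by (simp add: holds_lessQ[of _ _ u _ v] of_rat_less)
    with r v show ?thesis using cut_iff by blast
  qed
  have "holds (AndP (ExP RatS (memP (Var 0) (Var 1)))
     (AndP (ExP RatS (NegP (memP (Var 0) (Var 1))))
     (AndP (AllQ (Var 0) (AllP RatS (ImpP (lessQ (Var 0) (Var 1)) (memP (Var 0) (Var 2)))))
           (AllQ (Var 0) (ExQ (Var 1) (lessQ (Var 1) (Var 0))))))) ?\<rho>"
    using inhabited bounded downward open_end
    by (simp add: holds_AllQ holds_ExQ holds_memP NegP_def numeral_2_eq_2)
  then show "ty_rel Reals \<rho> (cut_elt x) (cut_elt y)"
    unfolding Reals_def cut_elt_def \<open>x = y\<close> ty_rel.simps(12)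
    by (auto simp: ty_rel_RatS cut_iff)
qed

theorem Reals_not_isomorphic_to_set: "\<not> isomorphic_to_some_set T Reals"
  by (rule not_isomorphic_to_set[OF uncountable_UNIV_real, of _ cut_elt])
     (simp_all add: ty_rel_cut_elt)

theorem theorem3:
  shows "\<not> isomorphic_to_some_set emTTc Reals \<and>
         \<not> isomorphic_to_some_set emTTc (FunRel NatS NatS) \<and>
         \<not> isomorphic_to_some_set emTT Reals \<and>
         \<not> isomorphic_to_some_set emTT (FunRel NatS NatS)"
  by (simp add: Reals_not_isomorphic_to_set FunRel_not_isomorphic_to_set)

end
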